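(* Two almost gentle algebras $A$ and $B$ have the same associated hypergraph with orientation (i.e. $\mathcal H_A$ and $\mathcal H_B$ are isomorphic as hypergraphs with orientation) if and only if their trivial extensions are isomorphic, $T(A)\simeq T(B)$.
   Context: $K$ is a field; all algebras are indecomposable and finite dimensional over $K$. Quivers are finite, $Q_0$ and $Q_1$ denote vertices and arrows, $e_v$ is the trivial path at $v$; $ab$ denotes the arrow $a$ followed by the arrow $b$ (and is $0$ if not composable). For a presentation $KQ/I$ the ideal $I$ is admissible. An almost gentle algebra is an algebra $A=KQ/I$ such that (S0) $I$ is generated by paths of length 2, and (S1) for every $a\in Q_1$ there is at most one arrow $b$ with $ab\notin I$ and at most one arrow $c$ with $ca\notin I$. A path $p$ in $Q$ is a maximal path of $A$ if $p\notin I$ and $ap\in I$ and $pa\in I$ for every $a\in Q_1$; $\mathcal M$ is the set of maximal paths of $A$. With $D(A)=\operatorname{Hom}_K(A,K)$, $T(A)$ is the vector space $A\oplus D(A)$ with multiplication $(a,f)(b,g)=(ab,ag+fb)$, where $(afb)(x)=f(bxa)$. A hypergraph is a pair $(\mathcal H_0,\mathcal H_1)$ with $\mathcal H_0$ a finite set of vertices and $\mathcal H_1$ a finite set (indexed family) of hyperedges, which are multisets of elements of $\mathcal H_0$. A hypergraph with orientation is a hypergraph together with, for each vertex $x\in\mathcal H_0$, a cyclic ordering of the hyperedges containing $x$, counting repeats. An isomorphism of hypergraphs with orientation is a pair of bijections between vertices and between hyperedges compatible with the multisets (with multiplicities) and with the cyclic orderings. The hypergraph with orientation $\mathcal H_A=(\mathcal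 H_0,\mathcal H_1)$ of an almost gentle algebra $A=KQ/I$: let $V_0\subseteq Q_0$ be the set of vertices $v$ such that one of the following holds: (1) $v$ is the source of exactly one arrow and no arrow ends at $v$; (2) $v$ is the target of exactly one arrow and no arrow starts at $v$; (3) $v$ is the target of exactly one arrow $a$ and the source of exactly one arrow $b$, and $ab\notin I$. Set $\overline{\mathcal M}=\mathcal M\cup\{e_v\mid v\in V_0\}$. The vertices $\mathcal H_0$ are in bijection with $\overline{\mathcal M}$. The hyperedges are in bijection with $Q_0$: the hyperedge $V$ corresponding to $v\in Q_0$ is the multiset of all $p\in\overline{\mathcal M}$ such that $v$ lies in $p$ (i.e. $p=qe_vr$ for possibly trivial paths $q,r$), each $p$ being counted as many times as $v$ occurs as a vertex of $p$. Orientation: if $x\in\mathcal H_0$ corresponds to $p=e_{v_1}a_1e_{v_2}a_2e_{v_3}\cdots a_{n-1}e_{v_n}$ with $a_i\in Q_1$, the cyclic ordering at $x$ is $V_1<V_2<\cdots<V_n<V_1$, where $V_i$ is the hyperedge corresponding to $v_i$. *)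

theory Defs
  imports
    "HOL-Algebra.Module"
    "HOL-Algebra.QuotRing"
    "HOL-Algebra.Ideal_Product"
    "HOL-Library.FuncSet"
    "HOL-Library.Multiset"
    "Graph_Theory.Arc_Walk"
begin

section \<open>Algebras over a field\<close>

text \<open>
  The ground field is a type of class \<^class>\<open>field\<close>. A \<open>K\<close>-algebra is a record of type
  \<^type>\<open>module\<close>, which carries the ring operations together with the scalar multiplication.
\<close>

definition alg_iso :: "('k::field, 'a) module \<Rightarrow> ('k, 'b) module \<Rightarrow> bool" (infix "\<simeq>\<^sub>K" 60)
  where "A \<simeq>\<^sub>K B \<longleftrightarrow>
    (\<exists>h \<in> ring_iso A B. \<forall>c. \<forall>x \<in> carrier A. h (c \<odot>\<^bsub>A\<^esub> x) = c \<odot>\<^bsub>B\<^esub> h x)"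

text \<open>
  A decomposition \<open>A \<cong> B \<times> C\<close> as algebras is the same as a decomposition
  \<open>A = B \<oplus> C\<close> into two-sided ideals; these are automatically \<open>K\<close>-subspaces.
\<close>

definition indecomposable_alg :: "('k::field, 'a) module \<Rightarrow> bool"
  where "indecomposable_alg A \<longleftrightarrow>
    carrier A \<noteq> {\<zero>\<^bsub>A\<^esub>} \<and>
    (\<forall>B C. ideal B A \<and> ideal C A \<and> B <+>\<^bsub>A\<^esub> C = carrier A \<and> B \<inter> C = {\<zero>\<^bsub>A\<^esub>}
       \<longrightarrow> B = {\<zero>\<^bsub>A\<^esub>} \<or> C = {\<zero>\<^bsub>A\<^esub>})"

text \<open>
  \<^const>\<open>FactRing\<close> drops the scalar multiplication; it is put back here, as
  \<open>c (x + I) = c x + I\<close>.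
\<close>

definition quot_alg :: "('k::field, 'a) module \<Rightarrow> 'a set \<Rightarrow> ('k, 'a set) module"
  where "quot_alg R I =
    \<lparr> carrier = carrier (R Quot I), monoid.mult = monoid.mult (R Quot I), one = one (R Quot I),
      zero = zero (R Quot I), add = add (R Quot I),
      smult = (\<lambda>c X. \<Union>x\<in>X. I +>\<^bsub>R\<^esub> (c \<odot>\<^bsub>R\<^esub> x)) \<rparr>"

primrec ideal_pow :: "('a, 'b) ring_scheme \<Rightarrow> 'a set \<Rightarrow> nat \<Rightarrow> 'a set"
  where
    "ideal_pow R J 0 = carrier R"
  | "ideal_pow R J (Suc n) = J \<cdot>\<^bsub>R\<^esub> ideal_pow R J n"


section \<open>Trivial extensions\<close>

text \<open>
  Linear forms on \<open>A\<close> are normalised to be \<^const>\<open>undefined\<close> outside \<open>carrier A\<close>, so that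
  they are determined by their values on \<open>A\<close>.
\<close>

definition dual_space :: "('k::field, 'a) module \<Rightarrow> ('a \<Rightarrow> 'k) set"
  where "dual_space A = {f \<in> carrier A \<rightarrow>\<^sub>E UNIV.
    (\<forall>x \<in> carrier A. \<forall>y \<in> carrier A. f (x \<oplus>\<^bsub>A\<^esub> y) = f x + f y) \<and>
    (\<forall>c. \<forall>x \<in> carrier A. f (c \<odot>\<^bsub>A\<^esub> x) = c * f x)}"

definition dual_act :: "('k::field, 'a) module \<Rightarrow> 'a \<Rightarrow> ('a \<Rightarrow> 'k) \<Rightarrow> 'a \<Rightarrow> ('a \<Rightarrow> 'k)"
  where "dual_act A a f b = (\<lambda>x \<in> carrier A. f (b \<otimes>\<^bsub>A\<^esub> x \<otimes>\<^bsub>A\<^esub> a))"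

definition trivial_ext :: "('k::field, 'a) module \<Rightarrow> ('k, 'a \<times> ('a \<Rightarrow> 'k)) module"
  where "trivial_ext A =
    \<lparr> carrier = carrier A \<times> dual_space A,
      monoid.mult = (\<lambda>(a, f) (b, g). (a \<otimes>\<^bsub>A\<^esub> b,
                \<lambda>x \<in> carrier A. dual_act A a g \<one>\<^bsub>A\<^esub> x + dual_act A \<one>\<^bsub>A\<^esub> f b x)),
      one = (\<one>\<^bsub>A\<^esub>, \<lambda>x \<in> carrier A. 0),
      zero = (\<zero>\<^bsub>A\<^esub>, \<lambda>x \<in> carrier A. 0),
      add = (\<lambda>(a, f) (b, g). (a \<oplus>\<^bsub>A\<^esub> b, \<lambda>x \<in> carrier A. f x + g x)),
      smult = (\<lambda>c (a, f). (c \<odot>\<^bsub>A\<^esub> a, \<lambda>x \<in> carrier A. c * f x)) \<rparr>"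


section \<open>Path algebras\<close>

text \<open>
  A finite quiver is a \<^locale>\<open>fin_digraph\<close> (loops and parallel arrows are allowed). A path is a
  pair of its start vertex and its list of arrows, read from left to right; \<open>(v, [])\<close> is
  \<open>e\<^sub>v\<close>.
\<close>

type_synonym ('v, 'e) path = "'v \<times> 'e list"

definition paths :: "('v, 'e) pre_digraph \<Rightarrow> ('v, 'e) path set"
  where "paths Q = {(u, es). \<exists>w. pre_digraph.awalk Q u es w}"

definition path_verts :: "('v, 'e) pre_digraph \<Rightarrow> ('v, 'e) path \<Rightarrow> 'v list"
  where "path_verts Q p = pre_digraph.awalk_verts Q (fst p) (snd p)"

text \<open>
  Elements of \<open>KQ\<close> are finitely supported coefficient functions on paths. The coefficient of
  a path in a product is the sum over all ways of cutting the path into two pieces.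
\<close>

definition path_alg :: "('v, 'e) pre_digraph \<Rightarrow> ('k::field, ('v, 'e) path \<Rightarrow> 'k) module"
  where "path_alg Q =
    \<lparr> carrier = {f. finite {p. f p \<noteq> 0} \<and> {p. f p \<noteq> 0} \<subseteq> paths Q},
      monoid.mult = (\<lambda>f g (u, es). \<Sum>(xs, ys) | xs @ ys = es.
                f (u, xs) * g (last (path_verts Q (u, xs)), ys)),
      one = (\<lambda>(u, es). if u \<in> verts Q \<and> es = [] then 1 else 0),
      zero = (\<lambda>p. 0),
      add = (\<lambda>f g p. f p + g p),
      smult = (\<lambda>c f p. c * f p) \<rparr>"

definition path_elem :: "('v, 'e) path \<Rightarrow> ('v, 'e) path \<Rightarrow> 'k::field"
  where "path_elem p = (\<lambda>q. if q = p then 1 else 0)"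

definition arrow_elem :: "('v, 'e) pre_digraph \<Rightarrow> 'e \<Rightarrow> ('v, 'e) path \<Rightarrow> 'k::field"
  where "arrow_elem Q a = path_elem (tail Q a, [a])"

definition arrow_ideal :: "('v, 'e) pre_digraph \<Rightarrow> (('v, 'e) path \<Rightarrow> 'k::field) set"
  where "arrow_ideal Q = Idl\<^bsub>path_alg Q\<^esub> (arrow_elem Q ` arcs Q)"

definition admissible :: "('v, 'e) pre_digraph \<Rightarrow> (('v, 'e) path \<Rightarrow> 'k::field) set \<Rightarrow> bool"
  where "admissible Q I \<longleftrightarrow> ideal I (path_alg Q) \<and>
    I \<subseteq> ideal_pow (path_alg Q) (arrow_ideal Q) 2 \<and>
    (\<exists>m\<ge>2. ideal_pow (path_alg Q) (arrow_ideal Q) m \<subseteq> I)"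

abbreviation bound_quiver_alg ::
    "('v, 'e) pre_digraph \<Rightarrow> (('v, 'e) path \<Rightarrow> 'k::field) set
      \<Rightarrow> ('k, (('v, 'e) path \<Rightarrow> 'k) set) module"
  where "bound_quiver_alg Q I \<equiv> quot_alg (path_alg Q) I"


section \<open>Almost gentle algebras\<close>

text \<open>
  Products of arrows and paths are formed in \<open>KQ\<close>. A non-composable product is \<open>0\<close>,
  hence lies in \<open>I\<close>. Finite-dimensionality of \<open>KQ/I\<close> is a consequence of admissibility.
\<close>

definition almost_gentle :: "('v, 'e) pre_digraph \<Rightarrow> (('v, 'e) path \<Rightarrow> 'k::field) set \<Rightarrow> bool"
  where "almost_gentle Q I \<longleftrightarrow>
    fin_digraph Q \<and> admissible Q I \<and> indecomposable_alg (bound_quiver_alg Q I) \<and>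
    (\<exists>R \<subseteq> {p \<in> paths Q. length (snd p) = 2}. I = Idl\<^bsub>path_alg Q\<^esub> (path_elem ` R)) \<and>
    (\<forall>a \<in> arcs Q.
      (\<exists>\<^sub>\<le>\<^sub>1b. b \<in> arcs Q \<and> arrow_elem Q a \<otimes>\<^bsub>path_alg Q\<^esub> arrow_elem Q b \<notin> I) \<and>
      (\<exists>\<^sub>\<le>\<^sub>1c. c \<in> arcs Q \<and> arrow_elem Q c \<otimes>\<^bsub>path_alg Q\<^esub> arrow_elem Q a \<notin> I))"

definition maximal_paths ::
    "('v, 'e) pre_digraph \<Rightarrow> (('v, 'e) path \<Rightarrow> 'k::field) set \<Rightarrow> ('v, 'e) path set"
  where "maximal_paths Q I = {p \<in> paths Q. path_elem p \<notin> I \<and>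
    (\<forall>a \<in> arcs Q. arrow_elem Q a \<otimes>\<^bsub>path_alg Q\<^esub> path_elem p \<in> I \<and>
                  path_elem p \<otimes>\<^bsub>path_alg Q\<^esub> arrow_elem Q a \<in> I)}"


section \<open>Hypergraphs with orientation\<close>

text \<open>
  A cyclic ordering with repetitions is a list up to rotation, i.e. the set of all rotations of
  some list. Hyperedges form a family: \<open>members H h\<close> is the multiset of the hyperedge \<open>h\<close>.
  The record only carries the data; \<open>oriented_hypergraph\<close> states the conditions on them.
\<close>

definition rotations :: "'a list \<Rightarrow> 'a list set"
  where "rotations xs = range (\<lambda>n. rotate n xs)"

record ('x, 'h) hypergraph =
  hverts :: "'x set"
  hedges :: "'h set"
  members :: "'h \<Rightarrow> 'x multiset"
  orient :: "'x \<Rightarrow> 'h list set"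

locale oriented_hypergraph =
  fixes H :: "('x, 'h) hypergraph"
  assumes finite_hverts: "finite (hverts H)"
    and finite_hedges: "finite (hedges H)"
    and members_subset: "h \<in> hedges H \<Longrightarrow> set_mset (members H h) \<subseteq> hverts H"
    and orient_cyclic: "x \<in> hverts H \<Longrightarrow> \<exists>hs. orient H x = rotations hs \<and>
          set hs \<subseteq> hedges H \<and> (\<forall>h \<in> hedges H. count_list hs h = count (members H h) x)"

definition hypergraph_iso :: "('x, 'h) hypergraph \<Rightarrow> ('y, 'g) hypergraph \<Rightarrow> bool"
  where "hypergraph_iso H H' \<longleftrightarrow> (\<exists>\<phi> \<psi>.
    bij_betw \<phi> (hverts H) (hverts H') \<and> bij_betw \<psi> (hedges H) (hedges H') \<and>
    (\<forall>h \<in> hedges H. members H' (\<psi> h) = image_mset \<phi> (members H h)) \<and>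
    (\<forall>x \<in> hverts H. orient H' (\<phi> x) = map \<psi> ` orient H x))"


section \<open>The hypergraph of an almost gentle algebra\<close>

definition trivial_verts ::
    "('v, 'e) pre_digraph \<Rightarrow> (('v, 'e) path \<Rightarrow> 'k::field) set \<Rightarrow> 'v set"
  where "trivial_verts Q I = {v \<in> verts Q.
    (\<exists>a. out_arcs Q v = {a}) \<and> in_arcs Q v = {} \<or>
    (\<exists>a. in_arcs Q v = {a}) \<and> out_arcs Q v = {} \<or>
    (\<exists>a b. in_arcs Q v = {a} \<and> out_arcs Q v = {b} \<and>
       arrow_elem Q a \<otimes>\<^bsub>path_alg Q\<^esub> arrow_elem Q b \<notin> I)}"

definition extended_maximal_paths ::
    "('v, 'e) pre_digraph \<Rightarrow> (('v, 'e) path \<Rightarrow> 'k::field) set \<Rightarrow> ('v, 'e) path set"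
  where "extended_maximal_paths Q I = maximal_paths Q I \<union> {(v, []) | v. v \<in> trivial_verts Q I}"

definition hypergraph_of ::
    "('v, 'e) pre_digraph \<Rightarrow> (('v, 'e) path \<Rightarrow> 'k::field) set \<Rightarrow> (('v, 'e) path, 'v) hypergraph"
  where "hypergraph_of Q I =
    \<lparr> hverts = extended_maximal_paths Q I,
      hedges = verts Q,
      members = (\<lambda>v. \<Sum>p \<in> extended_maximal_paths Q I.
                   replicate_mset (count_list (path_verts Q p) v) p),
      orient = (\<lambda>p. rotations (path_verts Q p)) \<rparr>"

end

theory Submission
  imports Defs
begin

text \<open>
  In \<open>T(A)\<close> a maximal path \<open>m\<close> from \<open>v\<^sub>1\<close> to \<open>v\<^sub>n\<close> is closed up by the dual basis vector \<open>m\<^sup>*\<close> to an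
  oriented cycle through \<open>v\<^sub>1, \<dots>, v\<^sub>n\<close>. The paths on these cycles, all full cycles at one vertex being
  identified, form a multiplicative basis of \<open>T(A)\<close>, so \<open>T(A)\<close> is determined by the cyclic words of
  the hypergraph, and a hypergraph isomorphism permutes the basis.

  Conversely, let \<open>r\<close> be the radical. The characters of \<open>T(A)\<close> are the coefficients of the \<open>e\<^sub>v\<close>, so an
  isomorphism induces a bijection of the vertices. For vertices \<open>v\<^sub>1, \<dots>, v\<^sub>k\<close>, the dimension of
  \<open>(e\<^sub>1 r e\<^sub>2 r \<dots> r e\<^sub>k + r\<^sup>k + soc) / (r\<^sup>k + soc)\<close>, with \<open>e\<^sub>i\<close> the idempotent of \<open>v\<^sub>i\<close>, is invariant and counts the occurrences of
  \<open>v\<^sub>1 \<dots> v\<^sub>k\<close> in the cyclic words of length at least \<open>k\<close>. By descending induction on \<open>k\<close> these numbers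
  determine all cyclic words of length at least 2. The words of length 1 are those of the vertices
  occurring at most once in the longer words.
\<close>

section \<open>Algebras with a multiplicative basis\<close>

text \<open>The difficulty lies in the socle. All full cycles at a vertex are identified, although
  the cycles through it may have different lengths, so in general length is no grading of T(A).
  Modulo soc, every remaining basis path has a definite length and a definite position on one cycle.
  That soc is preserved by isomorphisms comes from duality: a basis path in r outside soc is
  completed to a full cycle by its complement, which lies in r as well, so soc is exactly what r
  annihilates inside r. A path visiting k vertices has k - 1 arrows and is a proper part of a cycle
  exactly when the cycle has length at least k. This is why the count for k sees the words of length
  k together with all longer ones, and why the induction has to descend. A word of length 1 has no
  proper path of positive length, hence leaves no trace in the algebra and has to be recovered from
  the other words. This is possible because the trivial paths at V_0 are chosen so that every vertex
  that meets an arrow has at least two occurrences in all.\<close>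

definition basis_alg ::
    "'i set \<Rightarrow> ('i \<Rightarrow> 'i \<Rightarrow> 'i \<Rightarrow> bool) \<Rightarrow> 'i set \<Rightarrow> ('k::field, 'i \<Rightarrow> 'k) module"
  where "basis_alg B m U =
    \<lparr> carrier = {f. \<forall>i. i \<notin> B \<longrightarrow> f i = 0},
      monoid.mult = (\<lambda>f g u. if u \<in> B then \<Sum>(s, t) | s \<in> B \<and> t \<in> B \<and> m s t u. f s * g t else 0),
      one = (\<lambda>i. if i \<in> U then 1 else 0),
      zero = (\<lambda>i. 0),
      add = (\<lambda>f g i. f i + g i),
      smult = (\<lambda>c f i. c * f i) \<rparr>"

lemma basis_alg_simps [simp]:
  "f \<in> carrier (basis_alg B m U) \<longleftrightarrow> (\<forall>i. i \<notin> B \<longrightarrow> f i = 0)"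
  "(f \<otimes>\<^bsub>basis_alg B m U\<^esub> g) =
    (\<lambda>u. if u \<in> B then \<Sum>(s, t) | s \<in> B \<and> t \<in> B \<and> m s t u. f s * g t else 0)"
  "\<one>\<^bsub>basis_alg B m U\<^esub> = (\<lambda>i. if i \<in> U then 1 else 0)"
  "\<zero>\<^bsub>basis_alg B m U\<^esub> = (\<lambda>i. 0)"
  "f \<oplus>\<^bsub>basis_alg B m U\<^esub> g = (\<lambda>i. f i + g i)"
  "c \<odot>\<^bsub>basis_alg B m U\<^esub> f = (\<lambda>i. c * f i)"
  by (simp_all add: basis_alg_def)

section \<open>Homomorphisms, inverses and change of basis\<close>

definition alg_hom :: "('k::field, 'a) module \<Rightarrow> ('k, 'b) module \<Rightarrow> ('a \<Rightarrow> 'b) \<Rightarrow> bool"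
  where "alg_hom A B h \<longleftrightarrow> h \<in> ring_hom A B \<and> (\<forall>c. \<forall>x \<in> carrier A. h (c \<odot>\<^bsub>A\<^esub> x) = c \<odot>\<^bsub>B\<^esub> h x)"

lemma alg_homD:
  assumes "alg_hom A B h"
  shows "\<And>x. x \<in> carrier A \<Longrightarrow> h x \<in> carrier B"
    and "\<And>x y. x \<in> carrier A \<Longrightarrow> y \<in> carrier A \<Longrightarrow> h (x \<otimes>\<^bsub>A\<^esub> y) = h x \<otimes>\<^bsub>B\<^esub> h y"
    and "\<And>x y. x \<in> carrier A \<Longrightarrow> y \<in> carrier A \<Longrightarrow> h (x \<oplus>\<^bsub>A\<^esub> y) = h x \<oplus>\<^bsub>B\<^esub> h y"
    and "h \<one>\<^bsub>A\<^esub> = \<one>\<^bsub>B\<^esub>"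
    and "\<And>c x. x \<in> carrier A \<Longrightarrow> h (c \<odot>\<^bsub>A\<^esub> x) = c \<odot>\<^bsub>B\<^esub> h x"
  using assms ring_hom_memE[of h A B] by (auto simp: alg_hom_def)

lemma alg_isoI:
  assumes "\<And>x. x \<in> carrier A \<Longrightarrow> h x \<in> carrier B"
    and "\<And>x y. x \<in> carrier A \<Longrightarrow> y \<in> carrier A \<Longrightarrow> h (x \<otimes>\<^bsub>A\<^esub> y) = h x \<otimes>\<^bsub>B\<^esub> h y"
    and "\<And>x y. x \<in> carrier A \<Longrightarrow> y \<in> carrier A \<Longrightarrow> h (x \<oplus>\<^bsub>A\<^esub> y) = h x \<oplus>\<^bsub>B\<^esub> h y"
    and "h \<one>\<^bsub>A\<^esub> = \<one>\<^bsub>B\<^esub>"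
    and "\<And>c x. x \<in> carrier A \<Longrightarrow> h (c \<odot>\<^bsub>A\<^esub> x) = c \<odot>\<^bsub>B\<^esub> h x"
    and "bij_betw h (carrier A) (carrier B)"
  shows "A \<simeq>\<^sub>K B"
  using assms unfolding alg_iso_def ring_iso_def ring_hom_def by blast

lemma alg_isoE:
  assumes "A \<simeq>\<^sub>K B"
  obtains h where "alg_hom A B h" "bij_betw h (carrier A) (carrier B)"
  using assms unfolding alg_iso_def alg_hom_def ring_iso_def by blast

lemma alg_iso_trans:
  assumes "A \<simeq>\<^sub>K B" "B \<simeq>\<^sub>K C"
  shows "A \<simeq>\<^sub>K C"
proof -
  obtain h where h: "h \<in> ring_iso A B" "\<forall>c. \<forall>x \<in> carrier A. h (c \<odot>\<^bsub>A\<^esub> x) = c \<odot>\<^bsub>B\<^esub> h x"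
    using assms(1) unfolding alg_iso_def by blast
  obtain g where g: "g \<in> ring_iso B C" "\<forall>c. \<forall>x \<in> carrier B. g (c \<odot>\<^bsub>B\<^esub> x) = c \<odot>\<^bsub>C\<^esub> g x"
    using assms(2) unfolding alg_iso_def by blast
  have "g \<circ> h \<in> ring_iso A C"
    using h(1) g(1) by (rule ring_iso_set_trans)
  moreover have "h x \<in> carrier B" if "x \<in> carrier A" for x
    using h(1) that unfolding ring_iso_def by (auto dest: ring_hom_closed)
  ultimately show ?thesis
    unfolding alg_iso_def using h(2) g(2) by (intro bexI[of _ "g \<circ> h"]) auto
qed

text \<open>No ring axioms are assumed on either side. The inverse is a homomorphism because the
  operations of \<open>basis_alg\<close> stay in its carrier, where \<open>U \<subseteq> S\<close>
  is what puts the unit there.\<close>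

lemma basis_alg_iso_inverse:
  fixes S :: "'i set" and B :: "('k::field, 'b) module"
  assumes "basis_alg S m U \<simeq>\<^sub>K B" "U \<subseteq> S"
  obtains h g where "alg_hom (basis_alg S m U) B h" "alg_hom B (basis_alg S m U) g"
    "\<And>x. x \<in> carrier (basis_alg S m U) \<Longrightarrow> g (h x) = x" "\<And>y. y \<in> carrier B \<Longrightarrow> h (g y) = y"
proof -
  define A :: "('k, 'i \<Rightarrow> 'k) module" where "A = basis_alg S m U"
  have closed: "x \<otimes>\<^bsub>A\<^esub> y \<in> carrier A" "\<one>\<^bsub>A\<^esub> \<in> carrier A" for x y
    using assms(2) by (auto simp: A_def)
  have closed': "x \<oplus>\<^bsub>A\<^esub> y \<in> carrier A" "c \<odot>\<^bsub>A\<^esub> x \<in> carrier A"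
    if "x \<in> carrier A" "y \<in> carrier A" for c x y
    using that by (auto simp: A_def)
  obtain h where hom: "alg_hom A B h" and bij: "bij_betw h (carrier A) (carrier B)"
    using alg_isoE[OF assms(1)[folded A_def]] .
  note h = alg_homD[OF hom]
  define g where "g = inv_into (carrier A) h"
  have gh: "g (h x) = x" if "x \<in> carrier A" for x
    using bij that by (simp add: g_def bij_betw_inv_into_left)
  have ex: "\<exists>y \<in> carrier A. x = h y" if "x \<in> carrier B" for x
    using bij that by (auto simp: bij_betw_def)
  have "alg_hom B A g"
    unfolding alg_hom_def
  proof (intro conjI ring_hom_memI ballI allI)
    fix x y assume "x \<in> carrier B" "y \<in> carrier B"
    then obtain x' y' where "x' \<in> carrier A" "x = h x'" "y' \<in> carrier A" "y = h y'"
      using ex by meson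
    then show "g (x \<otimes>\<^bsub>B\<^esub> y) = g x \<otimes>\<^bsub>A\<^esub> g y" "g (x \<oplus>\<^bsub>B\<^esub> y) = g x \<oplus>\<^bsub>A\<^esub> g y"
      by (simp_all add: gh closed closed' flip: h(2,3))
  next
    fix c x assume "x \<in> carrier B"
    then obtain x' where "x' \<in> carrier A" "x = h x'"
      using ex by meson
    then show "g (c \<odot>\<^bsub>B\<^esub> x) = c \<odot>\<^bsub>A\<^esub> g x" "g x \<in> carrier A"
      by (simp_all add: gh closed'(2)[where y = x'] flip: h(5))
  next
    show "g \<one>\<^bsub>B\<^esub> = \<one>\<^bsub>A\<^esub>"
      by (simp add: gh closed flip: h(4))
  qed
  moreover have "h (g y) = y" if "y \<in> carrier B" for y
    using bij that by (simp add: g_def bij_betw_inv_into_right)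
  ultimately show ?thesis
    using that[of h g] hom gh unfolding A_def by blast
qed

lemma basis_alg_iso_sym:
  fixes S :: "'i set" and B :: "('k::field, 'b) module"
  assumes "basis_alg S m U \<simeq>\<^sub>K B" "U \<subseteq> S"
  shows "B \<simeq>\<^sub>K basis_alg S m U"
proof -
  obtain h g where h: "alg_hom (basis_alg S m U) B h" and g: "alg_hom B (basis_alg S m U) g"
    and gh: "\<And>x. x \<in> carrier (basis_alg S m U) \<Longrightarrow> g (h x) = x" "\<And>y. y \<in> carrier B \<Longrightarrow> h (g y) = y"
    using basis_alg_iso_inverse[OF assms] by blast
  have bij: "bij_betw g (carrier B) (carrier (basis_alg S m U))"
    using alg_homD(1)[OF g] alg_homD(1)[OF h] gh by (intro bij_betwI[where g = h]) blast+
  show ?thesis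
    by (rule alg_isoI[OF alg_homD[OF g] bij])
qed

lemma basis_alg_reindex:
  fixes \<theta> :: "'i \<Rightarrow> 'j"
  assumes \<theta>: "bij_betw \<theta> B B'" and U: "U \<subseteq> B" "U' = \<theta> ` U"
    and m: "\<And>s t u. s \<in> B \<Longrightarrow> t \<in> B \<Longrightarrow> u \<in> B \<Longrightarrow> m' (\<theta> s) (\<theta> t) (\<theta> u) \<longleftrightarrow> m s t u"
  shows "(basis_alg B m U :: ('k::field, 'i \<Rightarrow> 'k) module) \<simeq>\<^sub>K basis_alg B' m' U'"
\<comment> \<open>Precomposition with \<open>\<theta>\<close> is given by a formula and goes from
  the second algebra to the first, so this direction is constructed and then inverted.\<close>
proof (rule basis_alg_iso_sym)
  let ?A = "basis_alg B m U :: ('k, 'i \<Rightarrow> 'k) module"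
  let ?A' = "basis_alg B' m' U' :: ('k, 'j \<Rightarrow> 'k) module"
  have mem: "\<theta> s \<in> B'" if "s \<in> B" for s
    using \<theta> that by (auto simp: bij_betw_def)
  have inj: "inj_on \<theta> B"
    using \<theta> by (simp add: bij_betw_def)
  show "?A' \<simeq>\<^sub>K ?A"
  proof (rule alg_isoI[of _ "\<lambda>f i. if i \<in> B then f (\<theta> i) else 0"])
    fix f g :: "'j \<Rightarrow> 'k"
    have m_inv: "m (inv_into B \<theta> a) (inv_into B \<theta> b) u \<longleftrightarrow> m' a b (\<theta> u)"
      if "a \<in> B'" "b \<in> B'" "u \<in> B" for a b u
      using m[of "inv_into B \<theta> a" "inv_into B \<theta> b" u] that bij_betw_inv_into_right[OF \<theta>]
        bij_betwE[OF bij_betw_inv_into[OF \<theta>]] by simp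
    have "(\<Sum>(s, t) | s \<in> B' \<and> t \<in> B' \<and> m' s t (\<theta> u). f s * g t) =
        (\<Sum>(s, t) | s \<in> B \<and> t \<in> B \<and> m s t u. f (\<theta> s) * g (\<theta> t))" if u: "u \<in> B" for u
      using \<theta> bij_betw_inv_into_left[OF \<theta>] bij_betw_inv_into_right[OF \<theta>]
        bij_betwE[OF bij_betw_inv_into[OF \<theta>]] m[OF _ _ u]
      by (intro sum.reindex_bij_witness[of _ "\<lambda>(s, t). (\<theta> s, \<theta> t)"
            "\<lambda>(s, t). (inv_into B \<theta> s, inv_into B \<theta> t)"]) (auto simp: mem m_inv u)
    then show "(\<lambda>i. if i \<in> B then (f \<otimes>\<^bsub>?A'\<^esub> g) (\<theta> i) else 0) =
        (\<lambda>i. if i \<in> B then f (\<theta> i) else 0) \<otimes>\<^bsub>?A\<^esub> (\<lambda>i. if i \<in> B then g (\<theta> i) else 0)"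
      by (auto simp: fun_eq_iff mem intro!: sum.cong)
  next
    show "(\<lambda>i. if i \<in> B then \<one>\<^bsub>?A'\<^esub> (\<theta> i) else 0) = \<one>\<^bsub>?A\<^esub>"
      using U inj by (auto simp: fun_eq_iff dest: inj_onD)
  next
    show "bij_betw (\<lambda>f i. if i \<in> B then f (\<theta> i) else 0) (carrier ?A') (carrier ?A)"
    proof (rule bij_betwI[where g = "\<lambda>f j. if j \<in> B' then f (inv_into B \<theta> j) else 0"])
    qed (use bij_betw_inv_into_left[OF \<theta>] bij_betw_inv_into_right[OF \<theta>]
          bij_betwE[OF bij_betw_inv_into[OF \<theta>]] in \<open>auto simp: mem fun_eq_iff\<close>)
  qed (auto simp: fun_eq_iff)
  show "U' \<subseteq> B'"
    using U mem by auto
qed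

section \<open>Coordinates, dual bases and the trivial extension\<close>

lemma basis_mult_eq:
  assumes "finite B" "u \<in> B"
  shows "(f \<otimes>\<^bsub>basis_alg B m U\<^esub> g) u = (\<Sum>s\<in>B. \<Sum>t\<in>B. if m s t u then f s * g t else 0)"
proof -
  have "(\<Sum>s\<in>B. \<Sum>t\<in>B. if m s t u then f s * g t else 0) =
      (\<Sum>(s, t)\<in>B \<times> B. if m s t u then f s * g t else 0)"
    by (simp add: sum.cartesian_product)
  also have "\<dots> = (\<Sum>(s, t) | s \<in> B \<and> t \<in> B \<and> m s t u. f s * g t)"
    using assms(1) by (intro sum.mono_neutral_cong_right) (auto split: if_splits)
  finally show ?thesis
    using assms(2) by simp
qed

definition basis_vec :: "'i \<Rightarrow> 'i \<Rightarrow> 'k::field"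
  where "basis_vec p = (\<lambda>i. if i = p then 1 else 0)"

text \<open>Linearity is asked only on vectors supported in \<open>B\<close>, because the maps it is
  applied to are linear only on a carrier.\<close>

lemma basis_expansion:
  fixes \<phi> :: "('i \<Rightarrow> 'k::field) \<Rightarrow> 'k"
  assumes "finite B"
    and add: "\<And>f g. (\<forall>i. i \<notin> B \<longrightarrow> f i = 0) \<Longrightarrow> (\<forall>i. i \<notin> B \<longrightarrow> g i = 0) \<Longrightarrow>
      \<phi> (\<lambda>i. f i + g i) = \<phi> f + \<phi> g"
    and smult: "\<And>c f. (\<forall>i. i \<notin> B \<longrightarrow> f i = 0) \<Longrightarrow> \<phi> (\<lambda>i. c * f i) = c * \<phi> f"
    and f: "\<forall>i. i \<notin> B \<longrightarrow> f i = 0"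
  shows "\<phi> f = (\<Sum>p\<in>B. f p * \<phi> (basis_vec p))"
proof -
  have "\<phi> (\<lambda>i. if i \<in> S then f i else 0) = (\<Sum>p\<in>S. f p * \<phi> (basis_vec p))" if "finite S" "S \<subseteq> B" for S
    using that
  proof (induction S rule: finite_induct)
    case empty
    then show ?case
      using smult[of f 0] f by simp
  next
    case (insert p S)
    have "(\<lambda>i. if i \<in> insert p S then f i else 0) =
        (\<lambda>i. f p * basis_vec p i + (if i \<in> S then f i else 0))"
      using insert.hyps by (auto simp: fun_eq_iff basis_vec_def)
    then have "\<phi> (\<lambda>i. if i \<in> insert p S then f i else 0) =
        \<phi> (\<lambda>i. f p * basis_vec p i) + \<phi> (\<lambda>i. if i \<in> S then f i else 0)"
      using insert.prems by (simp only:) (rule add; auto simp: basis_vec_def)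
    also have "\<phi> (\<lambda>i. f p * basis_vec p i) = f p * \<phi> (basis_vec p)"
      using insert.prems by (intro smult) (auto simp: basis_vec_def)
    finally show ?case
      using insert by simp
  qed
  moreover have "f = (\<lambda>i. if i \<in> B then f i else 0)"
    using f by auto
  ultimately show ?thesis
    using assms(1) by (metis subset_refl)
qed

text \<open>
  In the basis consisting of a basis of \<open>A\<close> (left summand) and its dual basis (right summand),
  \<open>p \<cdot> q\<^sup>* = x\<^sup>*\<close> if \<open>q = x p\<close>, and \<open>q\<^sup>* \<cdot> p = x\<^sup>*\<close> if \<open>q = p x\<close>.
\<close>

fun trivial_mult :: "('i \<Rightarrow> 'i \<Rightarrow> 'i \<Rightarrow> bool) \<Rightarrow> 'i + 'i \<Rightarrow> 'i + 'i \<Rightarrow> 'i + 'i \<Rightarrow> bool"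
  where
    "trivial_mult m (Inl p) (Inl q) (Inl x) = m p q x"
  | "trivial_mult m (Inl p) (Inr q) (Inr x) = m x p q"
  | "trivial_mult m (Inr q) (Inl p) (Inr x) = m p x q"
  | "trivial_mult m _ _ _ = False"

text \<open>The isomorphism \<open>\<Theta>\<close> reads the left coordinates as an element of
  \<open>A\<close> and the right ones as the coordinates of a linear form in the basis dual to the
  vectors \<open>\<sigma> (basis_vec p)\<close>. The unit laws enter because the bimodule products
  \<open>ag\<close> and \<open>fb\<close> are written in \<open>trivial_ext\<close> as
  \<open>ag1\<close> and \<open>1fb\<close>.\<close>

lemma trivial_ext_basis_alg:
  fixes A :: "('k::field, 'a) module" and B :: "'i set"
  assumes B: "finite B" "U \<subseteq> B" and iso: "basis_alg B m U \<simeq>\<^sub>K A"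
    and unit: "\<And>x. x \<in> carrier A \<Longrightarrow> \<one>\<^bsub>A\<^esub> \<otimes>\<^bsub>A\<^esub> x = x" "\<And>x. x \<in> carrier A \<Longrightarrow> x \<otimes>\<^bsub>A\<^esub> \<one>\<^bsub>A\<^esub> = x"
  shows "basis_alg (B <+> B) (trivial_mult m) (Inl ` U) \<simeq>\<^sub>K trivial_ext A"
proof -
  let ?A = "basis_alg B m U :: ('k, 'i \<Rightarrow> 'k) module"
  let ?C = "basis_alg (B <+> B) (trivial_mult m) (Inl ` U) :: ('k, 'i + 'i \<Rightarrow> 'k) module"
  let ?T = "trivial_ext A"
  obtain \<sigma> where hom: "alg_hom ?A A \<sigma>" and bij: "bij_betw \<sigma> (carrier ?A) (carrier A)"
    using alg_isoE[OF iso] .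
  note \<sigma> = alg_homD[OF hom] bij
  define \<rho> where "\<rho> = inv_into (carrier ?A) \<sigma>"
  have \<rho>\<sigma>: "\<rho> (\<sigma> x) = x" if "x \<in> carrier ?A" for x
    unfolding \<rho>_def using bij_betw_inv_into_left[OF \<sigma>(6) that] .
  have \<sigma>\<rho>: "\<sigma> (\<rho> X) = X" "\<rho> X \<in> carrier ?A" if "X \<in> carrier A" for X
    unfolding \<rho>_def using bij_betw_inv_into_right[OF \<sigma>(6) that]
      bij_betw_inv_into[OF \<sigma>(6)] that by (auto dest: bij_betwE)
  have \<rho>_add: "\<rho> (X \<oplus>\<^bsub>A\<^esub> Y) = (\<lambda>i. \<rho> X i + \<rho> Y i)" "X \<oplus>\<^bsub>A\<^esub> Y \<in> carrier A"
    if "X \<in> carrier A" "Y \<in> carrier A" for X Y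
    using \<sigma>(3)[of "\<rho> X" "\<rho> Y"] \<rho>\<sigma>[of "\<rho> X \<oplus>\<^bsub>?A\<^esub> \<rho> Y"] \<sigma>(1)[of "\<rho> X \<oplus>\<^bsub>?A\<^esub> \<rho> Y"] \<sigma>\<rho>[of X] \<sigma>\<rho>[of Y] that
    by simp_all
  have \<rho>_mult: "\<rho> (X \<otimes>\<^bsub>A\<^esub> Y) = \<rho> X \<otimes>\<^bsub>?A\<^esub> \<rho> Y" "X \<otimes>\<^bsub>A\<^esub> Y \<in> carrier A"
    if "X \<in> carrier A" "Y \<in> carrier A" for X Y
    using \<sigma>(2)[of "\<rho> X" "\<rho> Y"] \<rho>\<sigma>[of "\<rho> X \<otimes>\<^bsub>?A\<^esub> \<rho> Y"] \<sigma>(1)[of "\<rho> X \<otimes>\<^bsub>?A\<^esub> \<rho> Y"] \<sigma>\<rho>[of X] \<sigma>\<rho>[of Y] that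
    by simp_all
  have \<rho>_smult: "\<rho> (c \<odot>\<^bsub>A\<^esub> X) = (\<lambda>i. c * \<rho> X i)" "c \<odot>\<^bsub>A\<^esub> X \<in> carrier A"
    if "X \<in> carrier A" for c X
    using \<sigma>(5)[of "\<rho> X" c] \<rho>\<sigma>[of "c \<odot>\<^bsub>?A\<^esub> \<rho> X"] \<sigma>(1)[of "c \<odot>\<^bsub>?A\<^esub> \<rho> X"] \<sigma>\<rho>[of X] that
    by simp_all
  have one: "\<one>\<^bsub>A\<^esub> \<in> carrier A"
  proof -
    have "\<one>\<^bsub>?A\<^esub> \<in> carrier ?A"
      using B(2) by auto
    then show ?thesis
      using \<sigma>(1,4) by metis
  qed
  have dual: "F X = (\<Sum>p\<in>B. \<rho> X p * F (\<sigma> (basis_vec p)))"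
    if "F \<in> dual_space A" "X \<in> carrier A" for F X
  proof -
    have "F (\<sigma> (\<rho> X)) = (\<Sum>p\<in>B. \<rho> X p * F (\<sigma> (basis_vec p)))"
      using that \<sigma>(1,3,5) \<sigma>\<rho>[OF that(2)] unfolding dual_space_def
      by (intro basis_expansion[where \<phi> = "F \<circ> \<sigma>", unfolded o_def] B) auto
    then show ?thesis
      using \<sigma>\<rho>[OF that(2)] by simp
  qed
  define \<delta> where "\<delta> c = (\<lambda>X\<in>carrier A. \<Sum>p\<in>B. c p * \<rho> X p)" for c
  have \<delta>: "\<delta> c \<in> dual_space A" for c
    by (auto simp: \<delta>_def dual_space_def \<rho>_add \<rho>_smult algebra_simps sum.distrib sum_distrib_left)
  have \<delta>_basis: "\<delta> c (\<sigma> (basis_vec p)) = c p" if "p \<in> B" for c p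
  proof -
    have "basis_vec p \<in> carrier ?A"
      using that by (auto simp: basis_vec_def)
    then have "\<delta> c (\<sigma> (basis_vec p)) = (\<Sum>q\<in>B. c q * basis_vec p q)"
      using \<sigma>(1) by (simp add: \<delta>_def \<rho>\<sigma>)
    also have "\<dots> = (\<Sum>q\<in>B. if q = p then c q else 0)"
      by (intro sum.cong) (auto simp: basis_vec_def)
    finally show ?thesis
      using B(1) that by simp
  qed
  define \<Theta> where "\<Theta> c = (\<sigma> (c \<circ> Inl), \<delta> (c \<circ> Inr))" for c
  have carC: "c \<circ> Inl \<in> carrier ?A" "c \<circ> Inr \<in> carrier ?A" if "c \<in> carrier ?C" for c
    using that by auto
  have sum_Inl: "(c \<otimes>\<^bsub>?C\<^esub> d) \<circ> Inl = (c \<circ> Inl) \<otimes>\<^bsub>?A\<^esub> (d \<circ> Inl)" for c d :: "'i + 'i \<Rightarrow> 'k"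
  proof
    fix p
    show "((c \<otimes>\<^bsub>?C\<^esub> d) \<circ> Inl) p = ((c \<circ> Inl) \<otimes>\<^bsub>?A\<^esub> (d \<circ> Inl)) p"
    proof (cases "p \<in> B")
      case True
      then have "Inl p \<in> B <+> B" "finite (B <+> B)"
        using B(1) by auto
      then show ?thesis
        using B(1) True unfolding o_def
        by (simp add: basis_mult_eq sum.Plus del: basis_alg_simps)
    qed auto
  qed
  have sum_Inr: "(c \<otimes>\<^bsub>?C\<^esub> d) (Inr p) =
      (\<Sum>q\<in>B. \<Sum>r\<in>B. if m p q r then c (Inl q) * d (Inr r) else 0) +
      (\<Sum>r\<in>B. \<Sum>q\<in>B. if m q p r then c (Inr r) * d (Inl q) else 0)"
    if "p \<in> B" for c d :: "'i + 'i \<Rightarrow> 'k" and p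
  proof -
    have "Inr p \<in> B <+> B" "finite (B <+> B)"
      using B(1) that by auto
    then show ?thesis
      using B(1) that by (simp add: basis_mult_eq sum.Plus del: basis_alg_simps)
  qed
  have \<delta>_mult: "\<delta> ((c \<otimes>\<^bsub>?C\<^esub> d) \<circ> Inr) X =
      \<delta> (d \<circ> Inr) (X \<otimes>\<^bsub>A\<^esub> \<sigma> (c \<circ> Inl)) + \<delta> (c \<circ> Inr) (\<sigma> (d \<circ> Inl) \<otimes>\<^bsub>A\<^esub> X)"
    if c: "c \<in> carrier ?C" and d: "d \<in> carrier ?C" and X: "X \<in> carrier A" for c d X
  proof -
    define a f b g x where "a = c \<circ> Inl" "f = c \<circ> Inr" "b = d \<circ> Inl" "g = d \<circ> Inr" "x = \<rho> X"
    have "\<delta> g (X \<otimes>\<^bsub>A\<^esub> \<sigma> a) = (\<Sum>r\<in>B. g r * (x \<otimes>\<^bsub>?A\<^esub> a) r)"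
      using X carC[OF c] \<sigma>(1) by (simp add: \<delta>_def \<rho>_mult \<rho>\<sigma> a_f_b_g_x_def del: basis_alg_simps)
    also have "\<dots> = (\<Sum>r\<in>B. \<Sum>p\<in>B. \<Sum>q\<in>B. if m p q r then g r * (x p * a q) else 0)"
      using B(1) by (intro sum.cong)
        (auto simp: basis_mult_eq sum_distrib_left if_distrib cong: if_cong simp del: basis_alg_simps)
    \<comment> \<open>The coordinate of \<open>x\<close> is moved to the outside, so that the
      coefficient of \<open>x p\<close> can be compared with \<open>sum_Inr\<close>.\<close>
    also have "\<dots> = (\<Sum>p\<in>B. \<Sum>r\<in>B. \<Sum>q\<in>B. if m p q r then g r * (x p * a q) else 0)"
      by (rule sum.swap)
    also have "\<dots> = (\<Sum>p\<in>B. \<Sum>q\<in>B. \<Sum>r\<in>B. if m p q r then g r * (x p * a q) else 0)"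
      by (intro sum.cong refl sum.swap)
    finally have 1: "\<delta> g (X \<otimes>\<^bsub>A\<^esub> \<sigma> a) =
        (\<Sum>p\<in>B. (\<Sum>q\<in>B. \<Sum>r\<in>B. if m p q r then a q * g r else 0) * x p)"
      by (simp add: sum_distrib_right sum_distrib_left if_distrib if_distribR mult_ac cong: if_cong)
    have "\<delta> f (\<sigma> b \<otimes>\<^bsub>A\<^esub> X) = (\<Sum>r\<in>B. f r * (b \<otimes>\<^bsub>?A\<^esub> x) r)"
      using X carC[OF d] \<sigma>(1) by (simp add: \<delta>_def \<rho>_mult \<rho>\<sigma> a_f_b_g_x_def del: basis_alg_simps)
    also have "\<dots> = (\<Sum>r\<in>B. \<Sum>q\<in>B. \<Sum>p\<in>B. if m q p r then f r * (b q * x p) else 0)"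
      using B(1) by (intro sum.cong)
        (auto simp: basis_mult_eq sum_distrib_left if_distrib cong: if_cong simp del: basis_alg_simps)
    also have "\<dots> = (\<Sum>r\<in>B. \<Sum>p\<in>B. \<Sum>q\<in>B. if m q p r then f r * (b q * x p) else 0)"
      by (intro sum.cong refl sum.swap)
    also have "\<dots> = (\<Sum>p\<in>B. \<Sum>r\<in>B. \<Sum>q\<in>B. if m q p r then f r * (b q * x p) else 0)"
      by (rule sum.swap)
    finally have 2: "\<delta> f (\<sigma> b \<otimes>\<^bsub>A\<^esub> X) =
        (\<Sum>p\<in>B. (\<Sum>r\<in>B. \<Sum>q\<in>B. if m q p r then f r * b q else 0) * x p)"
      by (simp add: sum_distrib_right sum_distrib_left if_distrib if_distribR mult_ac cong: if_cong)
    have "\<delta> ((c \<otimes>\<^bsub>?C\<^esub> d) \<circ> Inr) X = (\<Sum>p\<in>B. (c \<otimes>\<^bsub>?C\<^esub> d) (Inr p) * x p)"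
      using X by (simp add: \<delta>_def a_f_b_g_x_def del: basis_alg_simps)
    also have "\<dots> = \<delta> g (X \<otimes>\<^bsub>A\<^esub> \<sigma> a) + \<delta> f (\<sigma> b \<otimes>\<^bsub>A\<^esub> X)"
      unfolding 1 2 sum.distrib[symmetric]
      unfolding a_f_b_g_x_def o_def
      by (intro sum.cong) (simp_all add: sum_Inr distrib_right o_def del: basis_alg_simps)
    finally show ?thesis
      by (simp add: a_f_b_g_x_def)
  qed
  show ?thesis
  proof (rule alg_isoI[of _ \<Theta>])
    fix c assume "c \<in> carrier ?C"
    then show "\<Theta> c \<in> carrier ?T"
      using \<sigma>(1)[OF carC(1)] \<delta> by (simp add: \<Theta>_def trivial_ext_def)
  next
    fix c d assume c: "c \<in> carrier ?C" and d: "d \<in> carrier ?C"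
    have "\<sigma> ((c \<otimes>\<^bsub>?C\<^esub> d) \<circ> Inl) = \<sigma> (c \<circ> Inl) \<otimes>\<^bsub>A\<^esub> \<sigma> (d \<circ> Inl)"
      unfolding sum_Inl using \<sigma>(2) carC c d by blast
    moreover have "\<delta> ((c \<otimes>\<^bsub>?C\<^esub> d) \<circ> Inr) = (\<lambda>X\<in>carrier A.
        dual_act A (\<sigma> (c \<circ> Inl)) (\<delta> (d \<circ> Inr)) \<one>\<^bsub>A\<^esub> X + dual_act A \<one>\<^bsub>A\<^esub> (\<delta> (c \<circ> Inr)) (\<sigma> (d \<circ> Inl)) X)"
    proof (rule extensionalityI[of _ "carrier A"])
      fix X assume "X \<in> carrier A"
      then show "\<delta> ((c \<otimes>\<^bsub>?C\<^esub> d) \<circ> Inr) X = (\<lambda>X\<in>carrier A.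
        dual_act A (\<sigma> (c \<circ> Inl)) (\<delta> (d \<circ> Inr)) \<one>\<^bsub>A\<^esub> X + dual_act A \<one>\<^bsub>A\<^esub> (\<delta> (c \<circ> Inr)) (\<sigma> (d \<circ> Inl)) X) X"
        using \<delta>_mult[OF c d] unit \<rho>_mult(2) \<sigma>(1) carC[OF c] carC[OF d]
        by (simp add: dual_act_def del: basis_alg_simps)
    qed (auto simp: \<delta>_def)
    ultimately show "\<Theta> (c \<otimes>\<^bsub>?C\<^esub> d) = \<Theta> c \<otimes>\<^bsub>?T\<^esub> \<Theta> d"
      by (simp add: \<Theta>_def trivial_ext_def del: basis_alg_simps)
  next
    fix c d assume c: "c \<in> carrier ?C" and d: "d \<in> carrier ?C"
    show "\<Theta> (c \<oplus>\<^bsub>?C\<^esub> d) = \<Theta> c \<oplus>\<^bsub>?T\<^esub> \<Theta> d"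
      using \<sigma>(3)[OF carC(1)[OF c] carC(1)[OF d]]
      by (auto simp: \<Theta>_def trivial_ext_def o_def \<delta>_def algebra_simps sum.distrib)
  next
    have "\<one>\<^bsub>?C\<^esub> \<circ> Inl = \<one>\<^bsub>?A\<^esub>"
      by (auto simp: fun_eq_iff)
    then show "\<Theta> \<one>\<^bsub>?C\<^esub> = \<one>\<^bsub>?T\<^esub>"
      using \<sigma>(4) by (auto simp: \<Theta>_def trivial_ext_def \<delta>_def simp del: basis_alg_simps)
        (auto simp: image_iff fun_eq_iff)
  next
    fix k c assume c: "c \<in> carrier ?C"
    show "\<Theta> (k \<odot>\<^bsub>?C\<^esub> c) = k \<odot>\<^bsub>?T\<^esub> \<Theta> c"
      using \<sigma>(5)[OF carC(1)[OF c], of k]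
      by (auto simp: \<Theta>_def trivial_ext_def o_def \<delta>_def algebra_simps sum_distrib_left)
  next
    show "bij_betw \<Theta> (carrier ?C) (carrier ?T)"
    proof (rule bij_betwI[where g = "\<lambda>(X, F). case_sum (\<rho> X)
          (\<lambda>p. if p \<in> B then F (\<sigma> (basis_vec p)) else 0)"])
      show "\<Theta> \<in> carrier ?C \<rightarrow> carrier ?T"
        using \<sigma>(1)[OF carC(1)] \<delta> by (auto simp: \<Theta>_def trivial_ext_def simp del: basis_alg_simps)
    next
      show "(\<lambda>(X, F). case_sum (\<rho> X) (\<lambda>p. if p \<in> B then F (\<sigma> (basis_vec p)) else 0))
          \<in> carrier ?T \<rightarrow> carrier ?C"
      proof -
        have "i \<in> B" if "\<rho> X i \<noteq> 0" "X \<in> carrier A" for X i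
          using \<sigma>\<rho>(2)[OF that(2)] that(1) by auto
        then show ?thesis
          by (auto simp: trivial_ext_def split: sum.splits)
      qed
    next
      fix c assume c: "c \<in> carrier ?C"
      then show "(case \<Theta> c of (X, F) \<Rightarrow> case_sum (\<rho> X) (\<lambda>p. if p \<in> B then F (\<sigma> (basis_vec p)) else 0)) = c"
        using \<rho>\<sigma>[OF carC(1)[OF c]] by (auto simp: \<Theta>_def \<delta>_basis fun_eq_iff split: sum.splits)
    next
      fix Y assume "Y \<in> carrier ?T"
      then obtain X F where Y: "Y = (X, F)" "X \<in> carrier A" "F \<in> dual_space A"
        by (auto simp: trivial_ext_def)
      have "\<delta> (\<lambda>p. if p \<in> B then F (\<sigma> (basis_vec p)) else 0) = F"
      proof (rule extensionalityI[of _ "carrier A"])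
        fix Z assume "Z \<in> carrier A"
        then show "\<delta> (\<lambda>p. if p \<in> B then F (\<sigma> (basis_vec p)) else 0) Z = F Z"
          using dual[OF Y(3)] by (simp add: \<delta>_def mult.commute)
      qed (use Y(3) in \<open>auto simp: \<delta>_def dual_space_def PiE_def\<close>)
      then show "\<Theta> (case Y of (X, F) \<Rightarrow>
          case_sum (\<rho> X) (\<lambda>p. if p \<in> B then F (\<sigma> (basis_vec p)) else 0)) = Y"
        using Y \<sigma>\<rho> by (simp add: \<Theta>_def o_def)
    qed
  qed
qed

section \<open>Quotients of path algebras by quadratic monomial relations\<close>

definition path_end :: "('v, 'e) pre_digraph \<Rightarrow> ('v, 'e) path \<Rightarrow> 'v"
  where "path_end Q p = last (path_verts Q p)"

text \<open>A relation rather than an operation, to serve as the structure constants of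
  \<open>basis_alg\<close>.\<close>

definition path_comp :: "('v, 'e) pre_digraph \<Rightarrow> ('v, 'e) path \<Rightarrow> ('v, 'e) path \<Rightarrow> ('v, 'e) path \<Rightarrow> bool"
  where "path_comp Q p q r \<longleftrightarrow> fst q = path_end Q p \<and> r = (fst p, snd p @ snd q)"

lemma path_alg_simps:
  "f \<in> carrier (path_alg Q) \<longleftrightarrow> finite {p. f p \<noteq> 0} \<and> {p. f p \<noteq> 0} \<subseteq> paths Q"
  "(f \<otimes>\<^bsub>path_alg Q\<^esub> g) (u, es) = (\<Sum>(xs, ys) | xs @ ys = es. f (u, xs) * g (path_end Q (u, xs), ys))"
  "\<one>\<^bsub>path_alg Q\<^esub> (u, es) = (if u \<in> verts Q \<and> es = [] then 1 else 0)"
  "\<zero>\<^bsub>path_alg Q\<^esub> = (\<lambda>p. 0)"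
  "f \<oplus>\<^bsub>path_alg Q\<^esub> g = (\<lambda>p. f p + g p)"
  "c \<odot>\<^bsub>path_alg Q\<^esub> f = (\<lambda>p. c * f p)"
  by (simp_all add: path_alg_def path_end_def)

lemma finite_splits: "finite {(xs, ys). xs @ ys = es}"
proof (rule finite_subset)
  show "{(xs, ys). xs @ ys = es} \<subseteq> (\<lambda>n. (take n es, drop n es)) ` {..length es}"
  proof clarify
    fix xs ys :: "'a list"
    show "(xs, ys) \<in> (\<lambda>n. (take n (xs @ ys), drop n (xs @ ys))) ` {..length (xs @ ys)}"
      by (rule image_eqI[of _ _ "length xs"]) auto
  qed
qed auto

lemma path_elem_mult:
  "path_elem p \<otimes>\<^bsub>path_alg Q\<^esub> path_elem q =
    (if fst q = path_end Q p then path_elem (fst p, snd p @ snd q) else \<zero>\<^bsub>path_alg Q\<^esub>)"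
proof
  fix r
  have "(path_elem p \<otimes>\<^bsub>path_alg Q\<^esub> path_elem q) (fst r, snd r) =
      (\<Sum>z | fst z @ snd z = snd r. if z = (snd p, snd q)
        then (if fst r = fst p \<and> fst q = path_end Q p then 1 else 0) else 0)"
    unfolding path_alg_simps by (intro sum.cong) (auto simp: path_elem_def prod_eq_iff)
  also have "\<dots> = (if snd p @ snd q = snd r \<and> fst r = fst p \<and> fst q = path_end Q p then 1 else 0)"
    using finite_splits[of "snd r"] by (simp add: case_prod_beta' sum.delta)
  finally show "(path_elem p \<otimes>\<^bsub>path_alg Q\<^esub> path_elem q) r =
      (if fst q = path_end Q p then path_elem (fst p, snd p @ snd q) else \<zero>\<^bsub>path_alg Q\<^esub>) r"
    by (auto simp: path_elem_def path_alg_simps prod_eq_iff)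
qed

lemma path_smult_mult:
  "(\<lambda>p. c * f p) \<otimes>\<^bsub>path_alg Q\<^esub> g = (\<lambda>p. c * (f \<otimes>\<^bsub>path_alg Q\<^esub> g) p)"
  by (rule ext) (auto simp: path_alg_simps(2) sum_distrib_left mult.assoc split_def)

lemma path_end_simps [simp]:
  "path_end Q (u, []) = u" "path_end Q (u, a # es) = path_end Q (head Q a, es)"
  "path_end Q (u, es @ [a]) = head Q a"
  by (simp_all add: path_end_def path_verts_def pre_digraph.awalk_verts_conv pre_digraph.awalk_verts.simps)

lemma path_end_append: "path_end Q (u, xs @ ys) = path_end Q (path_end Q (u, xs), ys)"
  by (induction xs arbitrary: u) auto

lemma not_successively_ex:
  "\<not> successively P es \<Longrightarrow> \<exists>xs a b ys. es = xs @ [a, b] @ ys \<and> \<not> P a b"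
proof (induction es rule: induct_list012)
  case (3 a b es)
  show ?case
  proof (cases "P a b")
    case True
    then obtain xs c d ys where "b # es = xs @ [c, d] @ ys" "\<not> P c d"
      using 3 by auto
    then have "a # b # es = (a # xs) @ [c, d] @ ys"
      by simp
    then show ?thesis
      using \<open>\<not> P c d\<close> by blast
  next
    case False
    then have "a # b # es = [] @ [a, b] @ es"
      by simp
    then show ?thesis
      using False by blast
  qed
qed auto

locale quadratic_monomial = fin_digraph Q
  for Q :: "('v, 'e) pre_digraph" +
  fixes I :: "(('v, 'e) path \<Rightarrow> 'k::field) set" and R :: "('v, 'e) path set"
  assumes ideal_I: "ideal I (path_alg Q)"
    and R_sub: "R \<subseteq> {p \<in> paths Q. length (snd p) = 2}"
    and I_eq: "I = Idl\<^bsub>path_alg Q\<^esub> (path_elem ` R)"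
    and pow_sub: "\<exists>m. ideal_pow (path_alg Q) (arrow_ideal Q) m \<subseteq> I"
begin

abbreviation "KQ \<equiv> path_alg Q :: ('k, ('v, 'e) path \<Rightarrow> 'k) module"

definition step :: "'e \<Rightarrow> 'e \<Rightarrow> bool"
  where "step a b \<longleftrightarrow> a \<in> arcs Q \<and> b \<in> arcs Q \<and> head Q a = tail Q b \<and> (tail Q a, [a, b]) \<notin> R"

text \<open>The classes of these paths form a basis of the quotient (\<open>I_eq_vanishing\<close>,
  \<open>bound_quiver_alg_iso\<close>).\<close>

definition nz_paths :: "('v, 'e) path set"
  where "nz_paths = {p \<in> paths Q. successively step (snd p)}"

text \<open>The locale \<open>ideal\<close> includes the ring axioms, so those of the path algebra
  come with the hypothesis on \<open>I\<close>.\<close>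

sublocale KQ: ring KQ
  using ideal_I by (rule ideal.axioms)

lemma paths_simps [simp]:
  "(u, []) \<in> paths Q \<longleftrightarrow> u \<in> verts Q"
  "(u, a # es) \<in> paths Q \<longleftrightarrow> a \<in> arcs Q \<and> u = tail Q a \<and> (head Q a, es) \<in> paths Q"
  by (auto simp: paths_def awalk_Nil_iff awalk_Cons_iff)

lemma path_start_in_verts: "(u, es) \<in> paths Q \<Longrightarrow> u \<in> verts Q"
  by (auto simp: paths_def dest: awalk_hd_in_verts)

lemma paths_append:
  "(u, xs @ ys) \<in> paths Q \<longleftrightarrow> (u, xs) \<in> paths Q \<and> (path_end Q (u, xs), ys) \<in> paths Q"
  by (induction xs arbitrary: u) (auto dest: path_start_in_verts)

lemma path_end_in_verts: "p \<in> paths Q \<Longrightarrow> path_end Q p \<in> verts Q"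
  using paths_append[of "fst p" "snd p" "[]"] by simp

lemma nz_append:
  assumes "(u, xs @ ys) \<in> nz_paths"
  shows "(u, xs) \<in> nz_paths" "(path_end Q (u, xs), ys) \<in> nz_paths"
  using assms by (auto simp: nz_paths_def paths_append successively_append_iff)

lemma path_elem_carrier: "p \<in> paths Q \<Longrightarrow> path_elem p \<in> carrier KQ"
  by (auto simp: path_alg_simps path_elem_def)

lemma smult_path_elem_carrier: "p \<in> paths Q \<Longrightarrow> (\<lambda>q. c * path_elem p q) \<in> carrier KQ"
  by (auto simp: path_alg_simps path_elem_def)

text \<open>A description of \<open>I\<close> by coefficients: membership in a monomial ideal
  depends only on which paths occur in the support.\<close>

definition vanishing :: "(('v, 'e) path \<Rightarrow> 'k) set"
  where "vanishing = {f \<in> carrier KQ. \<forall>p \<in> nz_paths. f p = 0}"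

lemma minus_KQ: "f \<in> carrier KQ \<Longrightarrow> \<ominus>\<^bsub>KQ\<^esub> f = (\<lambda>p. - f p)"
  by (rule KQ.minus_equality) (auto simp: path_alg_simps)

text \<open>Both pieces of a cut nonzero path are nonzero paths, so in the coefficient of a product
  at a nonzero path every summand has a factor 0.\<close>

lemma ideal_vanishing: "ideal vanishing KQ"
proof (rule idealI)
  show "subgroup vanishing (add_monoid KQ)"
  proof
    show "vanishing \<subseteq> carrier (add_monoid KQ)"
      by (auto simp: vanishing_def)
  next
    fix f g assume "f \<in> vanishing" "g \<in> vanishing"
    then show "f \<otimes>\<^bsub>add_monoid KQ\<^esub> g \<in> vanishing"
      using KQ.a_closed[of f g] by (auto simp: vanishing_def path_alg_simps(5))
  next
    show "\<one>\<^bsub>add_monoid KQ\<^esub> \<in> vanishing"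
      using KQ.zero_closed by (auto simp: vanishing_def path_alg_simps(4))
  next
    fix f assume f: "f \<in> vanishing"
    then have "\<ominus>\<^bsub>KQ\<^esub> f \<in> carrier KQ"
      by (auto simp: vanishing_def)
    then show "inv\<^bsub>add_monoid KQ\<^esub> f \<in> vanishing"
      using f minus_KQ[of f] by (auto simp: vanishing_def a_inv_def[symmetric])
  qed
next
  fix f g assume f: "f \<in> vanishing" and g: "g \<in> carrier KQ"
  have *: "f (u, xs) = 0" "f (path_end Q (u, xs), ys) = 0" if "(u, xs @ ys) \<in> nz_paths" for u xs ys
    using f nz_append[OF that] by (auto simp: vanishing_def)
  have "(g \<otimes>\<^bsub>KQ\<^esub> f) (u, es) = 0" "(f \<otimes>\<^bsub>KQ\<^esub> g) (u, es) = 0" if "(u, es) \<in> nz_paths" for u es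
    unfolding path_alg_simps using that by (auto intro!: sum.neutral simp: *)
  then show "g \<otimes>\<^bsub>KQ\<^esub> f \<in> vanishing" "f \<otimes>\<^bsub>KQ\<^esub> g \<in> vanishing"
    using f g by (auto simp: vanishing_def)
qed (rule KQ.ring_axioms)

lemma R_disjoint: "p \<in> R \<Longrightarrow> p \<notin> nz_paths"
proof -
  assume p: "p \<in> R"
  then obtain a b where "p = (fst p, [a, b])" "p \<in> paths Q"
    using R_sub by (cases p) (auto simp: numeral_2_eq_2 length_Suc_conv)
  then have "p = (tail Q a, [a, b])"
    by (metis paths_simps(2))
  then show "p \<notin> nz_paths"
    using p by (auto simp: nz_paths_def step_def)
qed

lemma I_sub_vanishing: "I \<subseteq> vanishing"
  unfolding I_eq
proof (rule KQ.genideal_minimal[OF ideal_vanishing])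
  show "path_elem ` R \<subseteq> vanishing"
    using R_sub R_disjoint path_elem_carrier by (auto simp: vanishing_def path_elem_def)
qed

lemma path_elem_R: "p \<in> R \<Longrightarrow> path_elem p \<in> I"
  unfolding I_eq using R_sub path_elem_carrier by (intro KQ.genideal_self[THEN subsetD]) auto

text \<open>Some two consecutive arrows form a relation from \<open>R\<close>, and the path is this
  relation multiplied by what precedes and what follows it.\<close>

lemma path_elem_in_I:
  assumes "p \<in> paths Q" "p \<notin> nz_paths"
  shows "path_elem p \<in> I"
proof -
  have "\<not> successively step (snd p)"
    using assms by (auto simp: nz_paths_def)
  then obtain xs a b ys where es: "snd p = xs @ [a, b] @ ys" and ab: "\<not> step a b"
    using not_successively_ex by blast
  have p: "p = (fst p, xs @ a # b # ys)"
    using es by (simp add: prod_eq_iff)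
  have paths: "(fst p, xs) \<in> paths Q" "(path_end Q (fst p, xs), a # b # ys) \<in> paths Q"
    using assms(1) p paths_append by metis+
  have R: "(tail Q a, [a, b]) \<in> R"
    using ab paths(2) by (auto simp: step_def)
  have ys: "(head Q b, ys) \<in> paths Q"
    using paths(2) by simp
  have "path_elem (tail Q a, [a, b]) \<otimes>\<^bsub>KQ\<^esub> path_elem (head Q b, ys) \<in> I"
    by (intro ideal.I_r_closed[OF ideal_I] path_elem_R R path_elem_carrier ys)
  then have "path_elem (fst p, xs) \<otimes>\<^bsub>KQ\<^esub> path_elem (tail Q a, a # b # ys) \<in> I"
    by (intro ideal.I_l_closed[OF ideal_I] path_elem_carrier paths) (simp add: path_elem_mult)
  then show ?thesis
    using p paths(2) by (simp add: path_elem_mult)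
qed

lemma I_eq_vanishing: "I = vanishing"
proof
  show "vanishing \<subseteq> I"
  proof
    fix f assume f: "f \<in> vanishing"
    define S where "S = {p. f p \<noteq> 0}"
    have S: "finite S" "S \<subseteq> paths Q" "S \<inter> nz_paths = {}"
      using f by (auto simp: S_def vanishing_def path_alg_simps)
    have "(\<lambda>p. if p \<in> F then f p else 0) \<in> I" if "finite F" "F \<subseteq> S" for F
      using that
    proof (induction F rule: finite_induct)
      case empty
      then show ?case
        using additive_subgroup.zero_closed[OF ideal.axioms(1)[OF ideal_I]] by (simp add: path_alg_simps)
    next
      case (insert p F)
      have p: "p \<in> paths Q" "p \<notin> nz_paths"
        using insert.prems S by auto
      have fp: "(fst p, []) \<in> paths Q"
        using p(1) path_start_in_verts[of "fst p" "snd p"] by simp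
      \<comment> \<open>The ideal is closed under ring multiplication, not visibly under scalars;
        the scalar \<open>f p\<close> is therefore placed on the trivial path at the start of
        \<open>p\<close>, which is an element of the algebra.\<close>
      have "(\<lambda>q. f p * path_elem (fst p, []) q) \<otimes>\<^bsub>KQ\<^esub> path_elem p \<in> I"
        by (intro ideal.I_l_closed[OF ideal_I] path_elem_in_I p smult_path_elem_carrier fp)
      then have "(\<lambda>q. f p * path_elem p q) \<in> I"
        by (simp add: path_smult_mult path_elem_mult)
      then have "(\<lambda>q. f p * path_elem p q) \<oplus>\<^bsub>KQ\<^esub> (\<lambda>p. if p \<in> F then f p else 0) \<in> I"
        using insert by (intro additive_subgroup.a_closed[OF ideal.axioms(1)[OF ideal_I]]) auto
      moreover have "(\<lambda>q. f p * path_elem p q) \<oplus>\<^bsub>KQ\<^esub> (\<lambda>p. if p \<in> F then f p else 0) =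
          (\<lambda>q. if q \<in> insert p F then f q else 0)"
        using insert.hyps by (auto simp: path_alg_simps path_elem_def)
      ultimately show ?case
        by simp
    qed
    from this[OF S(1) order_refl] have "(\<lambda>p. if p \<in> S then f p else 0) \<in> I" .
    moreover have "(\<lambda>p. if p \<in> S then f p else 0) = f"
      by (auto simp: S_def)
    ultimately show "f \<in> I"
      by (simp only:)
  qed
qed (rule I_sub_vanishing)

lemma path_elem_in_I_iff: "p \<in> paths Q \<Longrightarrow> path_elem p \<in> I \<longleftrightarrow> p \<notin> nz_paths"
proof -
  have "path_elem p p = (1 :: 'k)"
    by (simp add: path_elem_def)
  then show "p \<in> paths Q \<Longrightarrow> path_elem p \<in> I \<longleftrightarrow> p \<notin> nz_paths"
    using path_elem_in_I[of p] I_sub_vanishing unfolding vanishing_def by fastforce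
qed

lemma zero_in_I: "\<zero>\<^bsub>KQ\<^esub> \<in> I"
  by (rule additive_subgroup.zero_closed[OF ideal.axioms(1)[OF ideal_I]])

lemma arrow_mult_in_I_iff:
  assumes "a \<in> arcs Q" "b \<in> arcs Q"
  shows "arrow_elem Q a \<otimes>\<^bsub>KQ\<^esub> arrow_elem Q b \<in> I \<longleftrightarrow> \<not> step a b"
  using assms zero_in_I path_elem_in_I_iff[of "(tail Q a, [a, b])"]
  by (auto simp: arrow_elem_def path_elem_mult nz_paths_def step_def)

lemma path_elem_in_ideal_pow:
  "(u, es) \<in> paths Q \<Longrightarrow> path_elem (u, es) \<in> ideal_pow KQ (arrow_ideal Q) (length es)"
proof (induction es arbitrary: u)
  case Nil
  then show ?case
    using path_elem_carrier by auto
next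
  case (Cons a es)
  have "arrow_elem Q a \<in> (arrow_ideal Q :: (('v, 'e) path \<Rightarrow> 'k) set)"
    unfolding arrow_ideal_def using Cons.prems path_elem_carrier
    by (intro KQ.genideal_self[THEN subsetD]) (auto simp: arrow_elem_def)
  moreover have "path_elem (head Q a, es) \<in> ideal_pow KQ (arrow_ideal Q) (length es)"
    using Cons by simp
  ultimately have "arrow_elem Q a \<otimes>\<^bsub>KQ\<^esub> path_elem (head Q a, es)
      \<in> ideal_pow KQ (arrow_ideal Q) (length (a # es))"
    by (simp add: ideal_prod.prod)
  then show ?case
    using Cons.prems by (simp add: arrow_elem_def path_elem_mult)
qed

text \<open>If the m-th power of the arrow ideal lies in \<open>I\<close>, then so does every path
  of length \<open>m\<close>, whereas all prefixes of a nonzero path are nonzero.\<close>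

lemma nz_paths_bounded: "\<exists>m. \<forall>p \<in> nz_paths. length (snd p) < m"
proof -
  obtain m where m: "ideal_pow KQ (arrow_ideal Q) m \<subseteq> I"
    using pow_sub by blast
  have "length es < m" if "(u, es) \<in> nz_paths" for u es
  proof (rule ccontr)
    assume "\<not> length es < m"
    then have len: "length (take m es) = m"
      by simp
    have nz: "(u, take m es) \<in> nz_paths"
      using nz_append(1)[of u "take m es" "drop m es"] that by simp
    then have "path_elem (u, take m es) \<in> ideal_pow KQ (arrow_ideal Q) m"
      using path_elem_in_ideal_pow[of u "take m es"] len by (auto simp: nz_paths_def)
    then show False
      using m nz path_elem_in_I_iff[of "(u, take m es)"] by (auto simp: nz_paths_def)
  qed
  then show ?thesis
    by (intro exI[of _ m]) auto
qed

lemma finite_nz_paths: "finite nz_paths"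
proof -
  obtain m where m: "\<forall>p \<in> nz_paths. length (snd p) < m"
    using nz_paths_bounded by blast
  have "nz_paths \<subseteq> verts Q \<times> {es. set es \<subseteq> arcs Q \<and> length es \<le> m}"
  proof
    fix p assume p: "p \<in> nz_paths"
    then have "length (snd p) \<le> m"
      using m by (simp add: less_imp_le)
    then show "p \<in> verts Q \<times> {es. set es \<subseteq> arcs Q \<and> length es \<le> m}"
      using p by (auto simp: nz_paths_def paths_def awalk_def)
  qed
  then show ?thesis
    by (rule finite_subset) (intro finite_cartesian_product finite_verts finite_lists_length_le finite_arcs)
qed

section \<open>The quotient algebra in terms of nonzero paths\<close>

lemma coset_eq:
  assumes "f \<in> carrier KQ"
  shows "I +>\<^bsub>KQ\<^esub> f = {g \<in> carrier KQ. \<forall>p \<in> nz_paths. g p = f p}" (is "_ = ?S")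
proof
  show "I +>\<^bsub>KQ\<^esub> f \<subseteq> ?S"
    using assms KQ.a_closed[of _ f] unfolding I_eq_vanishing
    by (auto simp: a_r_coset_def' vanishing_def path_alg_simps(5))
  show "?S \<subseteq> I +>\<^bsub>KQ\<^esub> f"
  proof
    fix g assume g: "g \<in> ?S"
    have "g \<oplus>\<^bsub>KQ\<^esub> (\<ominus>\<^bsub>KQ\<^esub> f) \<in> carrier KQ"
      using assms g by auto
    then have "(\<lambda>p. g p + - f p) \<in> vanishing"
      using g unfolding minus_KQ[OF assms] path_alg_simps(5) by (auto simp: vanishing_def)
    moreover have "g = (\<lambda>p. g p + - f p) \<oplus>\<^bsub>KQ\<^esub> f"
      by (simp add: path_alg_simps)
    ultimately show "g \<in> I +>\<^bsub>KQ\<^esub> f"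
      unfolding I_eq_vanishing a_r_coset_def' by blast
  qed
qed

lemma coset_eq_iff:
  assumes "f \<in> carrier KQ" "g \<in> carrier KQ"
  shows "I +>\<^bsub>KQ\<^esub> f = I +>\<^bsub>KQ\<^esub> g \<longleftrightarrow> (\<forall>p \<in> nz_paths. f p = g p)"
  using assms unfolding assms[THEN coset_eq] by auto

definition trivial_paths :: "('v, 'e) path set"
  where "trivial_paths = {(v, []) | v. v \<in> verts Q}"

text \<open>The sum over all cuts loses nothing when restricted to nonzero paths, since every cut of
  a nonzero path has nonzero pieces.\<close>

lemma mult_on_nz_paths:
  assumes "(u, es) \<in> nz_paths"
  shows "(f \<otimes>\<^bsub>basis_alg nz_paths (path_comp Q) U\<^esub> g) (u, es) = (f \<otimes>\<^bsub>KQ\<^esub> g) (u, es)"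
proof -
  have "(\<Sum>(p, q) | p \<in> nz_paths \<and> q \<in> nz_paths \<and> path_comp Q p q (u, es). f p * g q) =
      (\<Sum>(xs, ys) | xs @ ys = es. f (u, xs) * g (path_end Q (u, xs), ys))"
    using nz_append assms
    by (intro sum.reindex_bij_witness[of _ "\<lambda>(xs, ys). ((u, xs), (path_end Q (u, xs), ys))"
        "\<lambda>(p, q). (snd p, snd q)"]) (auto simp: path_comp_def)
  then show ?thesis
    using assms by (simp add: path_alg_simps)
qed

lemma bound_quiver_alg_iso:
  "basis_alg nz_paths (path_comp Q) trivial_paths \<simeq>\<^sub>K bound_quiver_alg Q I"
proof -
  let ?A = "basis_alg nz_paths (path_comp Q) trivial_paths :: ('k, ('v, 'e) path \<Rightarrow> 'k) module"
  have car: "f \<in> carrier KQ" if "f \<in> carrier ?A" for f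
  proof -
    have "{p. f p \<noteq> 0} \<subseteq> nz_paths"
      using that by auto
    then show ?thesis
      using finite_nz_paths unfolding path_alg_simps nz_paths_def
      by (auto intro: finite_subset)
  qed
  note hom = ring_hom_memE[OF ideal.rcos_ring_hom[OF ideal_I]]
  have car_quot: "I +>\<^bsub>KQ\<^esub> f \<in> carrier (KQ Quot I)" if "f \<in> carrier KQ" for f
    using hom(1) that .
  show ?thesis
  proof (rule alg_isoI[of _ "\<lambda>f. I +>\<^bsub>KQ\<^esub> f"])
    fix f assume "f \<in> carrier ?A"
    then show "I +>\<^bsub>KQ\<^esub> f \<in> carrier (bound_quiver_alg Q I)"
      using car car_quot by (simp add: quot_alg_def)
  next
    fix f g assume fg: "f \<in> carrier ?A" "g \<in> carrier ?A"
    have "f \<otimes>\<^bsub>?A\<^esub> g \<in> carrier ?A"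
      by simp
    then have "I +>\<^bsub>KQ\<^esub> (f \<otimes>\<^bsub>?A\<^esub> g) = I +>\<^bsub>KQ\<^esub> (f \<otimes>\<^bsub>KQ\<^esub> g)"
      using car[OF fg(1)] car[OF fg(2)] mult_on_nz_paths
      by (subst coset_eq_iff) (auto simp del: basis_alg_simps(2) intro: car)
    then show "I +>\<^bsub>KQ\<^esub> (f \<otimes>\<^bsub>?A\<^esub> g) =
        (I +>\<^bsub>KQ\<^esub> f) \<otimes>\<^bsub>bound_quiver_alg Q I\<^esub> (I +>\<^bsub>KQ\<^esub> g)"
      using hom(2) fg car by (simp add: quot_alg_def)
  next
    fix f g assume fg: "f \<in> carrier ?A" "g \<in> carrier ?A"
    then show "I +>\<^bsub>KQ\<^esub> (f \<oplus>\<^bsub>?A\<^esub> g) =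
        (I +>\<^bsub>KQ\<^esub> f) \<oplus>\<^bsub>bound_quiver_alg Q I\<^esub> (I +>\<^bsub>KQ\<^esub> g)"
      using hom(3)[OF car car] by (simp add: quot_alg_def path_alg_simps)
  next
    have "I +>\<^bsub>KQ\<^esub> \<one>\<^bsub>?A\<^esub> = I +>\<^bsub>KQ\<^esub> \<one>\<^bsub>KQ\<^esub>"
    proof (rule coset_eq_iff[THEN iffD2])
      show "\<one>\<^bsub>?A\<^esub> \<in> carrier KQ"
        by (rule car) (auto simp: trivial_paths_def nz_paths_def)
      show "\<forall>p\<in>nz_paths. \<one>\<^bsub>?A\<^esub> p = \<one>\<^bsub>KQ\<^esub> p"
        by (auto simp: trivial_paths_def path_alg_simps)
    qed simp
    then show "I +>\<^bsub>KQ\<^esub> \<one>\<^bsub>?A\<^esub> = \<one>\<^bsub>bound_quiver_alg Q I\<^esub>"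
      using hom(4) by (simp add: quot_alg_def)
  next
    fix c f assume f: "f \<in> carrier ?A"
    have smult: "(\<lambda>p. c * g p) \<in> carrier KQ" if "g \<in> carrier KQ" for g
      using that by (auto simp: path_alg_simps intro: finite_subset[rotated])
    \<comment> \<open>\<open>quot_alg\<close> defines scalar multiplication as a union over all
      representatives; here each of them is seen to give the same coset.\<close>
    have "I +>\<^bsub>KQ\<^esub> (\<lambda>p. c * g p) = I +>\<^bsub>KQ\<^esub> (\<lambda>p. c * f p)" if "g \<in> I +>\<^bsub>KQ\<^esub> f" for g
      using that f car[OF f] smult by (subst coset_eq_iff) (auto simp: coset_eq)
    then have "(\<Union>g \<in> I +>\<^bsub>KQ\<^esub> f. I +>\<^bsub>KQ\<^esub> (\<lambda>p. c * g p)) = (\<Union>g \<in> I +>\<^bsub>KQ\<^esub> f. I +>\<^bsub>KQ\<^esub> (\<lambda>p. c * f p))"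
      by (rule SUP_cong[OF refl])
    also have "\<dots> = I +>\<^bsub>KQ\<^esub> (\<lambda>p. c * f p)"
    proof -
      have "f \<in> I +>\<^bsub>KQ\<^esub> f"
        using car[OF f] by (simp add: coset_eq)
      then have "I +>\<^bsub>KQ\<^esub> f \<noteq> {}"
        by blast
      then show ?thesis
        by simp
    qed
    finally show "I +>\<^bsub>KQ\<^esub> (c \<odot>\<^bsub>?A\<^esub> f) = c \<odot>\<^bsub>bound_quiver_alg Q I\<^esub> (I +>\<^bsub>KQ\<^esub> f)"
      by (simp add: quot_alg_def path_alg_simps(6))
  next
    show "bij_betw (\<lambda>f. I +>\<^bsub>KQ\<^esub> f) (carrier ?A) (carrier (bound_quiver_alg Q I))"
      unfolding bij_betw_def
    proof
      show "inj_on (\<lambda>f. I +>\<^bsub>KQ\<^esub> f) (carrier ?A)"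
      proof (intro inj_onI ext)
        fix f g p
        assume f: "f \<in> carrier ?A" and g: "g \<in> carrier ?A" and "I +>\<^bsub>KQ\<^esub> f = I +>\<^bsub>KQ\<^esub> g"
        then have "\<forall>p \<in> nz_paths. f p = g p"
          using coset_eq_iff[OF car[OF f] car[OF g]] by simp
        then show "f p = g p"
          using f g by (cases p; cases "p \<in> nz_paths") auto
      qed
      show "(\<lambda>f. I +>\<^bsub>KQ\<^esub> f) ` carrier ?A = carrier (bound_quiver_alg Q I)"
      proof
        show "carrier (bound_quiver_alg Q I) \<subseteq> (\<lambda>f. I +>\<^bsub>KQ\<^esub> f) ` carrier ?A"
        proof
          fix X assume "X \<in> carrier (bound_quiver_alg Q I)"
          then obtain f where f: "f \<in> carrier KQ" "X = I +>\<^bsub>KQ\<^esub> f"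
            by (auto simp: quot_alg_def FactRing_def A_RCOSETS_def')
          let ?g = "\<lambda>p. if p \<in> nz_paths then f p else 0"
          have "?g \<in> carrier ?A"
            by simp
          moreover have "I +>\<^bsub>KQ\<^esub> ?g = I +>\<^bsub>KQ\<^esub> f"
            using f car[OF \<open>?g \<in> carrier ?A\<close>] by (subst coset_eq_iff) auto
          ultimately show "X \<in> (\<lambda>f. I +>\<^bsub>KQ\<^esub> f) ` carrier ?A"
            using f(2) \<open>?g \<in> carrier ?A\<close> by (intro image_eqI[of _ _ ?g]) simp_all
        qed
      qed (use car car_quot in \<open>auto simp: quot_alg_def\<close>)
    qed
  qed
qed

theorem trivial_ext_bound_quiver_alg_iso:
  "basis_alg (nz_paths <+> nz_paths) (trivial_mult (path_comp Q)) (Inl ` trivial_paths)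
    \<simeq>\<^sub>K trivial_ext (bound_quiver_alg Q I)"
proof (rule trivial_ext_basis_alg[OF finite_nz_paths _ bound_quiver_alg_iso])
  show "trivial_paths \<subseteq> nz_paths"
    by (auto simp: trivial_paths_def nz_paths_def)
next
  interpret quot: ring "KQ Quot I"
    using ideal_I by (rule ideal.quotient_is_ring)
  fix X assume "X \<in> carrier (bound_quiver_alg Q I)"
  then show "\<one>\<^bsub>bound_quiver_alg Q I\<^esub> \<otimes>\<^bsub>bound_quiver_alg Q I\<^esub> X = X"
    "X \<otimes>\<^bsub>bound_quiver_alg Q I\<^esub> \<one>\<^bsub>bound_quiver_alg Q I\<^esub> = X"
    by (simp_all add: quot_alg_def)
qed

end

section \<open>The algebra of a family of cyclic words\<close>

text \<open>
  Every word \<open>w x\<close> of length \<open>L\<close> is read as an oriented cycle of \<open>L\<close> arrows. \<open>Arc x i j\<close> is the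
  path of length \<open>j\<close> (with \<open>0 < j < L\<close>) starting at position \<open>i\<close> on the cycle of \<open>x\<close>; the
  full cycles starting at occurrences of the vertex \<open>v\<close> are all identified with \<open>Soc v\<close>.
\<close>

datatype ('x, 'v) cyc = Triv 'v | Arc 'x nat nat | Soc 'v

definition cyc_basis :: "'v set \<Rightarrow> 'x set \<Rightarrow> ('x \<Rightarrow> 'v list) \<Rightarrow> ('x, 'v) cyc set"
  where "cyc_basis V X w = Triv ` V \<union> Soc ` V \<union>
    {Arc x i j | x i j. x \<in> X \<and> i < length (w x) \<and> 0 < j \<and> j < length (w x)}"

fun cyc_src :: "('x \<Rightarrow> 'v list) \<Rightarrow> ('x, 'v) cyc \<Rightarrow> 'v"
  where
    "cyc_src w (Triv v) = v"
  | "cyc_src w (Soc v) = v"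
  | "cyc_src w (Arc x i j) = w x ! i"

text \<open>The complement of a path in the full cycle.\<close>

fun cyc_bar :: "('x \<Rightarrow> 'v list) \<Rightarrow> ('x, 'v) cyc \<Rightarrow> ('x, 'v) cyc"
  where
    "cyc_bar w (Triv v) = Soc v"
  | "cyc_bar w (Soc v) = Triv v"
  | "cyc_bar w (Arc x i j) = Arc x ((i + j) mod length (w x)) (length (w x) - j)"

text \<open>The complement of a path starts where the path ends.\<close>

abbreviation cyc_tgt :: "('x \<Rightarrow> 'v list) \<Rightarrow> ('x, 'v) cyc \<Rightarrow> 'v"
  where "cyc_tgt w s \<equiv> cyc_src w (cyc_bar w s)"

text \<open>Apart from trivial factors, a product is nonzero only if the second path continues the
  first at the same position of the same cycle and the total length does not exceed one turn;
  exactly one turn is the rule \<open>full\<close>. The rules overlap, but consistently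
  (\<open>cyc_mult_unique\<close>).\<close>

inductive cyc_mult :: "('x \<Rightarrow> 'v list) \<Rightarrow> ('x, 'v) cyc \<Rightarrow> ('x, 'v) cyc \<Rightarrow> ('x, 'v) cyc \<Rightarrow> bool"
  for w
  where
    Triv_left: "cyc_mult w (Triv (cyc_src w t)) t t"
  | Triv_right: "cyc_mult w s (Triv (cyc_tgt w s)) s"
  | full: "cyc_mult w s (cyc_bar w s) (Soc (cyc_src w s))"
  | Arc: "j + k < length (w x) \<Longrightarrow>
      cyc_mult w (Arc x i j) (Arc x ((i + j) mod length (w x)) k) (Arc x i (j + k))"

abbreviation cyc_alg :: "'v set \<Rightarrow> 'x set \<Rightarrow> ('x \<Rightarrow> 'v list) \<Rightarrow> ('k::field, ('x, 'v) cyc \<Rightarrow> 'k) module"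
  where "cyc_alg V X w \<equiv> basis_alg (cyc_basis V X w) (cyc_mult w) (Triv ` V)"

lemma cyc_basis_simps [simp]:
  "Triv v \<in> cyc_basis V X w \<longleftrightarrow> v \<in> V"
  "Soc v \<in> cyc_basis V X w \<longleftrightarrow> v \<in> V"
  "Arc x i j \<in> cyc_basis V X w \<longleftrightarrow> x \<in> X \<and> i < length (w x) \<and> 0 < j \<and> j < length (w x)"
  by (auto simp: cyc_basis_def)

lemma mod_complement:
  fixes i j n :: nat
  assumes "i < n" "j < n"
  shows "((i + j) mod n + (n - j)) mod n = i"
proof -
  have "((i + j) mod n + (n - j)) mod n = (i + j + (n - j)) mod n"
    by (rule mod_add_left_eq)
  also have "i + j + (n - j) = i + n"
    using assms by simp
  finally show ?thesis
    using assms by simp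
qed

lemma cyc_bar_bar: "t \<in> cyc_basis V X w \<Longrightarrow> cyc_bar w (cyc_bar w t) = t"
proof (cases t)
  case (Arc x i j)
  assume "t \<in> cyc_basis V X w"
  then show ?thesis
    using Arc mod_complement[of i "length (w x)" j] by simp
qed auto

lemma cyc_bar_basis: "t \<in> cyc_basis V X w \<Longrightarrow> cyc_bar w t \<in> cyc_basis V X w"
  by (cases t) (auto intro!: mod_less_divisor)


section \<open>Maximal paths\<close>

locale almost_gentle_quiver = quadratic_monomial Q I R
  for Q :: "('v, 'e) pre_digraph" and I :: "(('v, 'e) path \<Rightarrow> 'k::field) set" and R +
  assumes step_right_unique: "step a b \<Longrightarrow> step a b' \<Longrightarrow> b = b'"
    and step_left_unique: "step a b \<Longrightarrow> step a' b \<Longrightarrow> a = a'"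
begin

lemma nz_paths_Nil [simp]: "(u, []) \<in> nz_paths \<longleftrightarrow> u \<in> verts Q"
  by (simp add: nz_paths_def)

lemma nz_paths_Cons:
  "(u, a # es) \<in> nz_paths \<longleftrightarrow> u = tail Q a \<and> a \<in> arcs Q \<and> successively step (a # es)"
proof -
  have "a \<in> arcs Q \<Longrightarrow> successively step (a # es) \<Longrightarrow> (tail Q a, a # es) \<in> paths Q"
    by (induction es arbitrary: a) (auto simp: step_def)
  then show ?thesis
    by (auto simp: nz_paths_def)
qed

lemma nz_paths_ne:
  "es \<noteq> [] \<Longrightarrow> (u, es) \<in> nz_paths \<longleftrightarrow> u = tail Q (hd es) \<and> hd es \<in> arcs Q \<and> successively step es"
  by (cases es) (auto simp: nz_paths_Cons)

lemma nz_paths_fst: "p \<in> nz_paths \<Longrightarrow> snd p \<noteq> [] \<Longrightarrow> fst p = tail Q (hd (snd p))"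
  using nz_paths_ne[of "snd p" "fst p"] by simp

text \<open>The nontrivial maximal paths (\<open>maximal_path_iff\<close>), which are the words of
  length at least 2.\<close>

definition long_paths :: "('v, 'e) path set"
  where "long_paths = {p \<in> nz_paths. snd p \<noteq> [] \<and>
    (\<forall>b. \<not> step b (hd (snd p))) \<and> (\<forall>b. \<not> step (last (snd p)) b)}"

lemma step_nth: "p \<in> nz_paths \<Longrightarrow> Suc i < length (snd p) \<Longrightarrow> step (snd p ! i) (snd p ! Suc i)"
  by (simp add: nz_paths_def successively_conv_nth)

text \<open>By (S1) an arrow has at most one predecessor and one successor on nonzero paths, so two
  nonzero paths sharing an arrow agree as far as both of them reach. This is the backward half,
  \<open>forward\<close> the other one.\<close>

lemma backward:
  assumes "p \<in> nz_paths" "q \<in> nz_paths" "snd p ! i = snd q ! j"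
    and "i < length (snd p)" "j < length (snd q)" "k \<le> i" "k \<le> j"
  shows "snd p ! (i - k) = snd q ! (j - k)"
  using assms(6,7)
proof (induction k)
  case (Suc k)
  then have "step (snd p ! (i - Suc k)) (snd p ! (i - k))" "step (snd q ! (j - Suc k)) (snd q ! (j - k))"
    using step_nth[OF assms(1), of "i - Suc k"] step_nth[OF assms(2), of "j - Suc k"] assms(4,5)
    by (simp_all add: Suc_diff_Suc)
  then show ?case
    using Suc step_left_unique by auto
qed (use assms in simp)

lemma forward:
  assumes "p \<in> nz_paths" "q \<in> nz_paths" "snd p ! i = snd q ! j"
    and "i + k < length (snd p)" "j + k < length (snd q)"
  shows "snd p ! (i + k) = snd q ! (j + k)"
  using assms(4,5)
proof (induction k)
  case (Suc k)
  then show ?case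
    using step_nth[OF assms(1), of "i + k"] step_nth[OF assms(2), of "j + k"] step_right_unique by auto
qed (use assms in simp)

text \<open>Otherwise the first arrow of \<open>p\<close> is an inner arrow of \<open>q\<close>, and
  its predecessor on \<open>q\<close> would extend \<open>p\<close> to the left.\<close>

lemma long_path_start_le:
  assumes "p \<in> long_paths" "q \<in> long_paths" "snd p ! i = snd q ! j"
    and "i < length (snd p)" "j < length (snd q)"
  shows "j \<le> i"
proof (rule ccontr)
  assume "\<not> j \<le> i"
  moreover have "snd p ! 0 = snd q ! (j - i)"
    using backward[OF _ _ assms(3-5), of i] assms(1,2) calculation by (simp add: long_paths_def)
  ultimately have "step (snd q ! (j - i - 1)) (hd (snd p))"
    using step_nth[of q "j - i - 1"] assms by (auto simp: long_paths_def hd_conv_nth Suc_diff_Suc)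
  then show False
    using assms(1) by (simp add: long_paths_def)
qed

lemma long_path_length_le:
  assumes "p \<in> long_paths" "q \<in> long_paths" "snd p ! i = snd q ! i"
    and "i < length (snd p)" "i < length (snd q)"
  shows "length (snd q) \<le> length (snd p)"
proof (rule ccontr)
  assume "\<not> length (snd q) \<le> length (snd p)"
  moreover have "snd p ! (length (snd p) - 1) = snd q ! (length (snd p) - 1)"
    using forward[OF _ _ assms(3), of "length (snd p) - 1 - i"] assms calculation
    by (simp add: long_paths_def)
  ultimately have "step (last (snd p)) (snd q ! length (snd p))"
    using step_nth[of q "length (snd p) - 1"] assms by (auto simp: long_paths_def last_conv_nth)
  then show False
    using assms(1) by (simp add: long_paths_def)
qed

text \<open>An arrow has a single position on a single maximal path. This is what lets
  \<open>Arc x i j\<close> name a nonzero path without ambiguity.\<close>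

lemma long_path_unique:
  assumes "p \<in> long_paths" "q \<in> long_paths" "snd p ! i = snd q ! j"
    and "i < length (snd p)" "j < length (snd q)"
  shows "p = q" "i = j"
proof -
  show ij: "i = j"
    using long_path_start_le[OF assms] long_path_start_le[OF assms(2,1) assms(3)[symmetric] assms(5,4)] by simp
  have len: "length (snd p) = length (snd q)"
    using long_path_length_le[of p q i] long_path_length_le[of q p i] assms ij by simp
  have "snd p ! k = snd q ! k" if "k < length (snd p)" for k
  proof (cases "k \<le> i")
    case True
    then show ?thesis
      using backward[of p q i j "i - k"] assms ij by (simp add: long_paths_def)
  next
    case False
    then show ?thesis
      using forward[of p q i j "k - i"] assms ij that len by (simp add: long_paths_def)
  qed
  then have "snd p = snd q"
    using len by (simp add: nth_equalityI)
  then show "p = q"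
    using assms(1,2) nz_paths_fst[of p] nz_paths_fst[of q] by (simp add: long_paths_def prod_eq_iff)
qed

text \<open>Lengths of nonzero paths are bounded, so an extension of greatest length exists; a
  further \<open>step\<close> at either end would lengthen it.\<close>

lemma long_path_exists:
  assumes "(u, es) \<in> nz_paths" "es \<noteq> []"
  obtains v xs ys where "(v, xs @ es @ ys) \<in> long_paths"
proof -
  let ?P = "\<lambda>(v, xs, ys). (v, xs @ es @ ys) \<in> nz_paths"
  obtain m where m: "\<forall>p \<in> nz_paths. length (snd p) < m"
    using nz_paths_bounded by blast
  have "?P (u, [], [])"
    using assms by simp
  moreover have "length xs + length ys < m" if "?P (v, xs, ys)" for v xs ys
    using m that by fastforce
  ultimately obtain v xs ys where P: "?P (v, xs, ys)"
    and max: "\<And>v' xs' ys'. ?P (v', xs', ys') \<Longrightarrow> length xs' + length ys' \<le> length xs + length ys"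
    using ex_has_greatest_nat[of ?P "(u, [], [])" "\<lambda>(v, xs, ys). length xs + length ys" m] by auto
  let ?es = "xs @ es @ ys"
  have es: "v = tail Q (hd ?es)" "hd ?es \<in> arcs Q" "successively step ?es" "?es \<noteq> []"
    using nz_paths_ne[of ?es v] P assms(2) by auto
  have "\<not> step b (hd ?es)" for b
  proof
    assume "step b (hd ?es)"
    then have "(tail Q b, (b # xs) @ es @ ys) \<in> nz_paths"
      using es by (simp add: nz_paths_Cons successively_Cons step_def[of b])
    then show False
      using max[of "tail Q b" "b # xs" ys] by simp
  qed
  moreover have "\<not> step (last ?es) b" for b
  proof
    assume "step (last ?es) b"
    then have "successively step (?es @ [b])"
      using es(3,4) unfolding successively_append_iff[of step ?es] by simp
    moreover have "hd (?es @ [b]) = hd ?es"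
      using es(4) by (rule hd_append2)
    ultimately have "(v, ?es @ [b]) \<in> nz_paths"
      using es(1,2) nz_paths_ne[of "?es @ [b]" v] by simp
    then have "(v, xs @ es @ ys @ [b]) \<in> nz_paths"
      by simp
    then show False
      using max[of v xs "ys @ [b]"] by simp
  qed
  ultimately have "(v, ?es) \<in> long_paths"
    using P es(4) unfolding long_paths_def by simp
  then show ?thesis
    by (rule that)
qed

section \<open>Vertices and segments of nonzero paths\<close>

lemma length_path_verts: "length (path_verts Q p) = Suc (length (snd p))"
  by (simp add: path_verts_def length_awalk_verts)

lemma path_verts_nth:
  assumes "(u, es) \<in> paths Q" "i \<le> length es"
  shows "path_verts Q (u, es) ! i = path_end Q (u, take i es)"
  using assms
proof (induction es arbitrary: u i)
  case Nil
  then show ?case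
    by (simp add: path_verts_def)
next
  case (Cons a es)
  then show ?case
    by (cases i) (auto simp: path_verts_def)
qed

text \<open>Same conventions as for \<open>Arc\<close>: start position and length, with the vertex
  given explicitly so that length 0 makes sense.\<close>

definition subpath :: "('v, 'e) path \<Rightarrow> nat \<Rightarrow> nat \<Rightarrow> ('v, 'e) path"
  where "subpath p i j = (path_verts Q p ! i, take j (drop i (snd p)))"

lemma subpath_eq:
  assumes "p \<in> nz_paths" "i + j \<le> length (snd p)"
  shows "subpath p i j = (path_end Q (fst p, take i (snd p)), take j (drop i (snd p)))"
  using path_verts_nth[of "fst p" "snd p" i] assms by (simp add: subpath_def nz_paths_def)

lemma subpath_nz:
  assumes "p \<in> nz_paths" "i + j \<le> length (snd p)"
  shows "subpath p i j \<in> nz_paths"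
proof -
  have "(fst p, take i (snd p) @ take j (drop i (snd p)) @ drop (i + j) (snd p)) \<in> nz_paths"
    using assms by (metis append_take_drop_id drop_drop add.commute prod.collapse)
  then have "(path_end Q (fst p, take i (snd p)), take j (drop i (snd p)) @ drop (i + j) (snd p)) \<in> nz_paths"
    by (rule nz_append)
  then show ?thesis
    unfolding subpath_eq[OF assms] by (rule nz_append)
qed

lemma fst_subpath: "fst (subpath p i j) = path_verts Q p ! i"
  by (simp add: subpath_def)

lemma length_subpath: "i + j \<le> length (snd p) \<Longrightarrow> length (snd (subpath p i j)) = j"
  by (simp add: subpath_def)

lemma path_end_subpath:
  assumes "p \<in> nz_paths" "i + j \<le> length (snd p)"
  shows "path_end Q (subpath p i j) = path_verts Q p ! (i + j)"
proof -
  have "path_verts Q p ! (i + j) = path_end Q (fst p, take (i + j) (snd p))"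
    using path_verts_nth[of "fst p" "snd p" "i + j"] assms by (simp add: nz_paths_def)
  then show ?thesis
    unfolding subpath_eq[OF assms] by (simp add: take_add path_end_append)
qed

lemma path_comp_subpath:
  assumes "p \<in> nz_paths" "i + j + k \<le> length (snd p)"
  shows "path_comp Q (subpath p i j) (subpath p (i + j) k) (subpath p i (j + k))"
  using assms path_end_subpath[of p i j]
  by (simp add: path_comp_def fst_subpath) (simp add: subpath_def take_add add.commute)

text \<open>Positive length matters: a segment with an arrow has one position only, whereas a vertex
  may occur at several.\<close>

lemma subpath_inj:
  assumes "p \<in> long_paths" "q \<in> long_paths" "subpath p i j = subpath q k l" "0 < j"
    and "i + j \<le> length (snd p)" "k + l \<le> length (snd q)"
  shows "p = q" "i = k" "j = l"
proof -
  show "j = l"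
    using length_subpath[OF assms(5)] length_subpath[OF assms(6)] assms(3) by simp
  have "snd (subpath p i j) ! 0 = snd p ! i" "snd (subpath q k l) ! 0 = snd q ! k"
    using assms(4-6) \<open>j = l\<close> by (simp_all add: subpath_def)
  then have "snd p ! i = snd q ! k"
    using assms(3) by simp
  then show "p = q" "i = k"
    using long_path_unique[of p q i k] assms \<open>j = l\<close> by auto
qed

lemma subpath_exists:
  assumes "p \<in> nz_paths" "snd p \<noteq> []"
  obtains x i j where "x \<in> long_paths" "0 < j" "i + j \<le> length (snd x)" "p = subpath x i j"
proof -
  obtain v xs ys where x: "(v, xs @ snd p @ ys) \<in> long_paths"
    using long_path_exists[of "fst p" "snd p"] assms by auto
  let ?x = "(v, xs @ snd p @ ys)" and ?i = "length xs" and ?j = "length (snd p)"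
  have nz: "?x \<in> nz_paths"
    using x by (simp add: long_paths_def)
  have "subpath ?x ?i ?j \<in> nz_paths"
    by (rule subpath_nz[OF nz]) simp
  moreover have "snd (subpath ?x ?i ?j) = snd p"
    by (simp add: subpath_def)
  ultimately have "p = subpath ?x ?i ?j"
    using assms nz_paths_fst[of p] nz_paths_fst[of "subpath ?x ?i ?j"] by (simp add: prod_eq_iff)
  then show ?thesis
    using that[of ?x ?j ?i] x assms(2) by simp
qed

section \<open>Maximal paths and the vertices that carry a word of length 1\<close>

lemma arrow_path_mult_in_I_iff:
  assumes "p \<in> nz_paths" "snd p \<noteq> []" "a \<in> arcs Q"
  shows "arrow_elem Q a \<otimes>\<^bsub>KQ\<^esub> path_elem p \<in> I \<longleftrightarrow> \<not> step a (hd (snd p))"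
    and "path_elem p \<otimes>\<^bsub>KQ\<^esub> arrow_elem Q a \<in> I \<longleftrightarrow> \<not> step (last (snd p)) a"
proof -
  obtain b es where p: "p = (tail Q b, b # es)" "b \<in> arcs Q" "successively step (b # es)"
    using assms nz_paths_Cons by (cases p; cases "snd p") auto
  have "(tail Q a, a # b # es) \<in> paths Q" if "head Q a = tail Q b"
    using assms that p by (auto simp: nz_paths_def)
  then have "path_elem (tail Q a, a # b # es) \<in> I \<longleftrightarrow> \<not> step a b" if "head Q a = tail Q b"
    using that p assms(3) by (simp add: path_elem_in_I_iff nz_paths_Cons successively_Cons)
  then show "arrow_elem Q a \<otimes>\<^bsub>KQ\<^esub> path_elem p \<in> I \<longleftrightarrow> \<not> step a (hd (snd p))"
    using p zero_in_I by (auto simp: arrow_elem_def path_elem_mult step_def)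
  have end_p: "path_end Q p = head Q (last (snd p))"
    using assms(2) by (metis append_butlast_last_id path_end_simps(3) prod.collapse)
  have "(fst p, snd p @ [a]) \<in> paths Q" if "tail Q a = path_end Q p"
    using assms that by (simp add: paths_append nz_paths_def path_end_in_verts)
  moreover have "(fst p, snd p @ [a]) \<in> nz_paths \<longleftrightarrow> step (last (snd p)) a"
    if "(fst p, snd p @ [a]) \<in> paths Q"
    using that assms by (auto simp: nz_paths_def successively_append_iff)
  ultimately have "path_elem (fst p, snd p @ [a]) \<in> I \<longleftrightarrow> \<not> step (last (snd p)) a"
    if "tail Q a = path_end Q p"
    using that by (simp add: path_elem_in_I_iff)
  then show "path_elem p \<otimes>\<^bsub>KQ\<^esub> arrow_elem Q a \<in> I \<longleftrightarrow> \<not> step (last (snd p)) a"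
    using zero_in_I end_p by (auto simp: arrow_elem_def path_elem_mult step_def)
qed

lemma arrow_trivial_mult_in_I_iff:
  assumes "v \<in> verts Q" "a \<in> arcs Q"
  shows "arrow_elem Q a \<otimes>\<^bsub>KQ\<^esub> path_elem (v, []) \<in> I \<longleftrightarrow> head Q a \<noteq> v"
    and "path_elem (v, []) \<otimes>\<^bsub>KQ\<^esub> arrow_elem Q a \<in> I \<longleftrightarrow> tail Q a \<noteq> v"
  using assms zero_in_I path_elem_in_I_iff[of "(tail Q a, [a])"]
  by (auto simp: arrow_elem_def path_elem_mult nz_paths_Cons)

text \<open>The product of an arrow with a trivial path is the arrow or 0, and no arrow lies in
  \<open>I\<close>; so a trivial path is maximal only at an isolated vertex.\<close>

lemma maximal_path_iff:
  "p \<in> maximal_paths Q I \<longleftrightarrow> p \<in> long_paths \<or>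
    (\<exists>v. p = (v, []) \<and> v \<in> verts Q \<and> (\<forall>a \<in> arcs Q. head Q a \<noteq> v \<and> tail Q a \<noteq> v))"
proof (cases "snd p = []")
  case True
  then show ?thesis
    by (cases p) (auto simp: maximal_paths_def long_paths_def arrow_trivial_mult_in_I_iff path_elem_in_I_iff)
next
  case False
  have "p \<in> maximal_paths Q I \<longleftrightarrow> p \<in> nz_paths \<and>
      (\<forall>a \<in> arcs Q. \<not> step a (hd (snd p)) \<and> \<not> step (last (snd p)) a)"
  proof -
    have "p \<in> paths Q \<and> path_elem p \<notin> I \<longleftrightarrow> p \<in> nz_paths"
      using path_elem_in_I_iff[of p] by (auto simp: nz_paths_def)
    then show ?thesis
      using False arrow_path_mult_in_I_iff[of p] unfolding maximal_paths_def by blast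
  qed
  then show ?thesis
    using False by (auto simp: long_paths_def step_def)
qed

lemma extended_maximal_paths_long:
  "p \<in> extended_maximal_paths Q I \<and> snd p \<noteq> [] \<longleftrightarrow> p \<in> long_paths"
  by (auto simp: extended_maximal_paths_def maximal_path_iff long_paths_def)

lemma path_verts_tail: "x \<in> nz_paths \<Longrightarrow> i < length (snd x) \<Longrightarrow> path_verts Q x ! i = tail Q (snd x ! i)"
  by (auto simp: path_verts_def awalk_verts_conv nth_append)

lemma path_verts_head:
  assumes "x \<in> nz_paths" "i < length (snd x)"
  shows "path_verts Q x ! Suc i = head Q (snd x ! i)"
  using path_verts_nth[of "fst x" "snd x" "Suc i"] assms
  by (simp add: nz_paths_def take_Suc_conv_app_nth)

lemma arc_in_long_path:
  assumes "a \<in> arcs Q"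
  obtains x i where "x \<in> long_paths" "i < length (snd x)" "snd x ! i = a"
proof -
  have "(tail Q a, [a]) \<in> nz_paths"
    using assms by (simp add: nz_paths_Cons)
  then obtain v xs ys where "(v, xs @ [a] @ ys) \<in> long_paths"
    by (rule long_path_exists) auto
  then show ?thesis
    using that[of "(v, xs @ [a] @ ys)" "length xs"] by (simp add: nth_append)
qed

definition occurrences :: "'v \<Rightarrow> (('v, 'e) path \<times> nat) set"
  where "occurrences v = {(x, i). x \<in> long_paths \<and> i < length (path_verts Q x) \<and> path_verts Q x ! i = v}"

lemma long_pathD: "x \<in> long_paths \<Longrightarrow> x \<in> nz_paths" "x \<in> long_paths \<Longrightarrow> snd x \<noteq> []"
  by (auto simp: long_paths_def)

lemma arc_in_set: "x \<in> nz_paths \<Longrightarrow> i < length (snd x) \<Longrightarrow> snd x ! i \<in> arcs Q"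
  by (auto simp: nz_paths_def paths_def awalk_def dest!: nth_mem)

text \<open>
  Each vertex occurrence on a long path uses up the arrow before it and the arrow after it, so a
  vertex occurs at most once iff it has at most one arrow in and out, forming a nonzero path
  if both exist.
\<close>

lemma trivial_path_iff:
  "(v, []) \<in> extended_maximal_paths Q I \<longleftrightarrow>
    v \<in> verts Q \<and> (\<forall>o1 \<in> occurrences v. \<forall>o2 \<in> occurrences v. o1 = o2)"
  (is "?L \<longleftrightarrow> _ \<and> ?R")
proof -
  \<comment> \<open>The first case is the isolated vertex, whose trivial path is a maximal path; the
    other three are the cases of \<open>trivial_verts\<close>.\<close>
  let ?D = "in_arcs Q v = {} \<and> out_arcs Q v = {} \<or>
       (\<exists>a. out_arcs Q v = {a}) \<and> in_arcs Q v = {} \<or>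
       (\<exists>a. in_arcs Q v = {a}) \<and> out_arcs Q v = {} \<or>
       (\<exists>a b. in_arcs Q v = {a} \<and> out_arcs Q v = {b} \<and> step a b)"
  have L: "?L \<longleftrightarrow> v \<in> verts Q \<and> ?D"
  proof -
    have "in_arcs Q v = {} \<and> out_arcs Q v = {} \<longleftrightarrow> (\<forall>a \<in> arcs Q. head Q a \<noteq> v \<and> tail Q a \<noteq> v)"
      by (auto simp: in_arcs_def out_arcs_def)
    moreover have "arrow_elem Q a \<otimes>\<^bsub>KQ\<^esub> arrow_elem Q b \<notin> I \<longleftrightarrow> step a b"
      if "in_arcs Q v = {a}" "out_arcs Q v = {b}" for a b
      using that arrow_mult_in_I_iff[of a b] in_in_arcs_conv[of a Q v] in_out_arcs_conv[of b Q v] by auto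
    moreover have "?L \<longleftrightarrow> v \<in> verts Q \<and>
        ((\<forall>a \<in> arcs Q. head Q a \<noteq> v \<and> tail Q a \<noteq> v) \<or> v \<in> trivial_verts Q I)"
      by (auto simp: extended_maximal_paths_def maximal_path_iff long_paths_def trivial_verts_def)
    ultimately show ?thesis
      unfolding trivial_verts_def by blast
  qed
  have occ_in: "\<exists>x i. x \<in> long_paths \<and> i < length (snd x) \<and> snd x ! i = a \<and> (x, Suc i) \<in> occurrences v"
    if "a \<in> in_arcs Q v" for a
  proof -
    have "a \<in> arcs Q"
      using that by simp
    then obtain x i where x: "x \<in> long_paths" "i < length (snd x)" "snd x ! i = a"
      by (rule arc_in_long_path)
    then have "(x, Suc i) \<in> occurrences v"
      using that path_verts_head[of x i] by (simp add: occurrences_def length_path_verts long_pathD)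
    then show ?thesis
      using x by blast
  qed
  have occ_out: "\<exists>x i. x \<in> long_paths \<and> i < length (snd x) \<and> snd x ! i = a \<and> (x, i) \<in> occurrences v"
    if "a \<in> out_arcs Q v" for a
  proof -
    have "a \<in> arcs Q"
      using that by simp
    then obtain x i where x: "x \<in> long_paths" "i < length (snd x)" "snd x ! i = a"
      by (rule arc_in_long_path)
    then have "(x, i) \<in> occurrences v"
      using that path_verts_tail[of x i] by (simp add: occurrences_def length_path_verts long_pathD)
    then show ?thesis
      using x by blast
  qed
  have in_occ: "snd x ! (i - 1) \<in> in_arcs Q v" if "(x, i) \<in> occurrences v" "0 < i" for x i
    using that path_verts_head[of x "i - 1"] arc_in_set[of x "i - 1"]
    by (auto simp: occurrences_def length_path_verts long_pathD)
  have out_occ: "snd x ! i \<in> out_arcs Q v" if "(x, i) \<in> occurrences v" "i < length (snd x)" for x i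
    using that path_verts_tail[of x i] arc_in_set[of x i] by (auto simp: occurrences_def long_pathD)
  have R: ?R if "in_arcs Q v = {a}" and *: "out_arcs Q v = {} \<or> (\<exists>b. out_arcs Q v = {b} \<and> step a b)" for a
  proof -
    have "0 < i \<and> snd x ! (i - 1) = a" if occ: "(x, i) \<in> occurrences v" for x i
    proof -
      \<comment> \<open>A maximal path starting at \<open>v\<close> has the unique outgoing arrow as
        its first arrow, and \<open>a\<close> would extend it to the left.\<close>
      have "0 < i"
      proof (rule ccontr)
        assume "\<not> 0 < i"
        have x: "x \<in> long_paths" "snd x \<noteq> []"
          using occ by (auto simp: occurrences_def long_pathD)
        then have "hd (snd x) \<in> out_arcs Q v"
          using out_occ[OF occ] \<open>\<not> 0 < i\<close> by (simp add: hd_conv_nth)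
        then have "step a (hd (snd x))"
          using * by (metis empty_iff singletonD)
        then show False
          using x by (simp add: long_paths_def)
      qed
      then show ?thesis
        using in_occ[OF occ] \<open>in_arcs Q v = {a}\<close> by simp
    qed
    note pos = this
    have "x = y \<and> i = j" if "(x, i) \<in> occurrences v" "(y, j) \<in> occurrences v" for x i y j
    proof -
      have ij: "0 < i" "0 < j"
        using pos that by blast+
      moreover have "i - 1 < length (snd x)" "j - 1 < length (snd y)" "x \<in> long_paths" "y \<in> long_paths"
        using that ij by (auto simp: occurrences_def length_path_verts)
      ultimately have "x = y" "i - 1 = j - 1"
        using long_path_unique[of x y "i - 1" "j - 1"] pos[OF that(1)] pos[OF that(2)] by simp_all
      then show ?thesis
        using ij by linarith
    qed
    then show ?thesis
      by auto
  qed
  have R': ?R if "in_arcs Q v = {}" "\<And>b c. b \<in> out_arcs Q v \<Longrightarrow> c \<in> out_arcs Q v \<Longrightarrow> b = c"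
  proof -
    have "i = 0 \<and> 0 < length (snd x) \<and> snd x ! 0 \<in> out_arcs Q v" if occ: "(x, i) \<in> occurrences v" for x i
      using in_occ[OF occ] out_occ[OF occ] \<open>in_arcs Q v = {}\<close> occ
      by (cases "i = 0") (auto simp: occurrences_def long_pathD)
    then have "x = y \<and> i = j" if "(x, i) \<in> occurrences v" "(y, j) \<in> occurrences v" for x i y j
      using long_path_unique[of x y 0 0] that \<open>\<And>b c. b \<in> out_arcs Q v \<Longrightarrow> c \<in> out_arcs Q v \<Longrightarrow> b = c\<close>
      unfolding occurrences_def by blast
    then show ?thesis
      by auto
  qed
  have ?D if ?R
  proof -
    have in1: "a = b" if "a \<in> in_arcs Q v" "b \<in> in_arcs Q v" for a b
      using occ_in[OF that(1)] occ_in[OF that(2)] \<open>?R\<close> by fastforce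
    have out1: "a = b" if "a \<in> out_arcs Q v" "b \<in> out_arcs Q v" for a b
      using occ_out[OF that(1)] occ_out[OF that(2)] \<open>?R\<close> by fastforce
    \<comment> \<open>The occurrence right after \<open>a\<close> and the one right before
      \<open>b\<close> coincide, so the two arrows are consecutive on one maximal path.\<close>
    have "step a b" if ab: "a \<in> in_arcs Q v" "b \<in> out_arcs Q v" for a b
    proof -
      obtain x i where x: "x \<in> long_paths" "snd x ! i = a" "(x, Suc i) \<in> occurrences v"
        using occ_in[OF ab(1)] by blast
      obtain y j where y: "j < length (snd y)" "snd y ! j = b" "(y, j) \<in> occurrences v"
        using occ_out[OF ab(2)] by blast
      have "y = x" "j = Suc i"
        using \<open>?R\<close> x(3) y(3) by fastforce+
      then show ?thesis
        using step_nth[of x i] x y by (auto simp: long_pathD)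
    qed
    moreover have "in_arcs Q v = {} \<or> (\<exists>a. in_arcs Q v = {a})"
      using in1 by blast
    moreover have "out_arcs Q v = {} \<or> (\<exists>a. out_arcs Q v = {a})"
      using out1 by blast
    ultimately show ?thesis
      by (elim disjE exE) (simp_all del: in_in_arcs_conv in_out_arcs_conv)
  qed
  moreover have ?R if ?D
    using that R R' by (elim disjE exE conjE) auto
  ultimately show ?thesis
    unfolding L by blast
qed

section \<open>Segments of cycles as paths and dual paths\<close>

abbreviation "ext_paths \<equiv> extended_maximal_paths Q I"

abbreviation "cyc_index \<equiv> cyc_basis (verts Q) ext_paths (path_verts Q)"

text \<open>With \<open>n = Suc (length (snd x))\<close>, the cycle of \<open>x\<close> consists of
  the \<open>n - 1\<close> arrows of \<open>x\<close> and a closing arrow, the dual vector of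
  \<open>x\<close>. A segment that crosses the closing arrow is the dual vector of its complement,
  the subpath starting at \<open>i + j - n\<close> of length \<open>n - j\<close>.\<close>

fun cyc_path :: "(('v, 'e) path, 'v) cyc \<Rightarrow> ('v, 'e) path + ('v, 'e) path"
  where
    "cyc_path (Triv v) = Inl (v, [])"
  | "cyc_path (Soc v) = Inr (v, [])"
  | "cyc_path (Arc x i j) =
      (if i + j \<le> length (snd x) then Inl (subpath x i j)
       else Inr (subpath x (i + j - Suc (length (snd x))) (Suc (length (snd x)) - j)))"

lemma Arc_index_iff:
  "Arc x i j \<in> cyc_index \<longleftrightarrow> x \<in> long_paths \<and> i \<le> length (snd x) \<and> 0 < j \<and> j \<le> length (snd x)"
  using extended_maximal_paths_long[of x] by (auto simp: length_path_verts less_Suc_eq_le)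

text \<open>Collects everything used about the index \<open>t\<close> of a nonzero path
  \<open>p\<close>; in particular its complement is the index of the dual vector, so dualising
  becomes \<open>cyc_bar\<close>.\<close>

lemma lift_path:
  assumes "p \<in> nz_paths"
  obtains t where "t \<in> cyc_index" "cyc_path t = Inl p" "cyc_path (cyc_bar (path_verts Q) t) = Inr p"
    "cyc_src (path_verts Q) t = fst p" "cyc_tgt (path_verts Q) t = path_end Q p"
    "snd p = [] \<Longrightarrow> t = Triv (fst p)"
    "\<And>x i j. x \<in> long_paths \<Longrightarrow> i + j \<le> length (snd x) \<Longrightarrow> 0 < j \<Longrightarrow> p = subpath x i j \<Longrightarrow> t = Arc x i j"
proof (cases "snd p = []")
  case True
  then obtain v where p: "p = (v, [])" "v \<in> verts Q"
    using assms by (cases p) auto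
  have "subpath x i j \<noteq> (v, [])" if "i + j \<le> length (snd x)" "0 < j" for x i j
    using that length_subpath[of i j x] by (metis list.size(3) not_less_zero snd_conv)
  then show ?thesis
    using p by (intro that[of "Triv v"]) auto
next
  case False
  then obtain x i j where x: "x \<in> long_paths" "0 < j" "i + j \<le> length (snd x)" "p = subpath x i j"
    using subpath_exists assms by blast
  have wrap: "\<not> i + j + (Suc (length (snd x)) - j) \<le> length (snd x)"
    using x by simp
  have mod: "(i + j) mod Suc (length (snd x)) = i + j"
    using x by simp
  show ?thesis
  proof (rule that[of "Arc x i j"])
    show "Arc x i j \<in> cyc_index"
      unfolding Arc_index_iff using x by auto
    show "cyc_path (cyc_bar (path_verts Q) (Arc x i j)) = Inr p"
      using x wrap mod by (simp add: length_path_verts)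
    show "cyc_src (path_verts Q) (Arc x i j) = fst p"
      using x by (simp add: fst_subpath)
    show "cyc_tgt (path_verts Q) (Arc x i j) = path_end Q p"
      using x mod by (simp add: path_end_subpath long_pathD length_path_verts)
    show "Arc x i j = Arc y k l"
      if "y \<in> long_paths" "k + l \<le> length (snd y)" "0 < l" "p = subpath y k l" for y k l
    proof -
      have "subpath x i j = subpath y k l"
        using x(4) that(4) by simp
      then show ?thesis
        using subpath_inj[OF x(1) that(1) _ x(2,3) that(2)] by simp
    qed
  qed (use x False in auto)
qed

lemma cyc_index_cases:
  assumes "t \<in> cyc_index"
  obtains p where "p \<in> nz_paths" "cyc_path t = Inl p" | p where "p \<in> nz_paths" "cyc_path t = Inr p"
proof (cases t)
  case (Arc x i j)
  then have x: "x \<in> long_paths" "i \<le> length (snd x)" "0 < j" "j \<le> length (snd x)"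
    using assms Arc_index_iff by auto
  show ?thesis
  proof (cases "i + j \<le> length (snd x)")
    case True
    then show ?thesis
      using that(1)[of "subpath x i j"] Arc x subpath_nz[of x i j] by (simp add: long_pathD)
  next
    case False
    then show ?thesis
      using that(2)[of "subpath x (i + j - Suc (length (snd x))) (Suc (length (snd x)) - j)"] Arc x
        subpath_nz[of x "i + j - Suc (length (snd x))" "Suc (length (snd x)) - j"] by (simp add: long_pathD)
  qed
qed (use assms that nz_paths_Nil in auto)

lemma cyc_path_inj:
  assumes "s \<in> cyc_index" "t \<in> cyc_index" "cyc_path s = cyc_path t"
  shows "s = t"
proof -
  have ne: "snd (subpath x i j) \<noteq> []" if "0 < j" "i + j \<le> length (snd x)" for x i j
    using that length_subpath[of i j x] by auto
  have ne1: "subpath x i j \<noteq> (v, [])" if "Arc x i j \<in> cyc_index" "i + j \<le> length (snd x)" for x i j v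
    using ne[of j i x] that unfolding Arc_index_iff by auto
  have ne2: "subpath x (i + j - Suc (length (snd x))) (Suc (length (snd x)) - j) \<noteq> (v, [])"
    if "Arc x i j \<in> cyc_index" "\<not> i + j \<le> length (snd x)" for x i j v
    using ne[of "Suc (length (snd x)) - j" "i + j - Suc (length (snd x))" x] that
    unfolding Arc_index_iff by auto
  show ?thesis
  proof (cases s)
    case s: (Arc x i j)
    show ?thesis
    proof (cases t)
      case t: (Arc y k l)
      have x: "x \<in> long_paths" "i \<le> length (snd x)" "0 < j" "j \<le> length (snd x)"
        and y: "y \<in> long_paths" "k \<le> length (snd y)" "0 < l" "l \<le> length (snd y)"
        using assms(1,2) s t Arc_index_iff by auto
      show ?thesis
      proof (cases "i + j \<le> length (snd x)")
        case True
        then have "subpath x i j = subpath y k l" "k + l \<le> length (snd y)"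
          using assms(3) s t by (auto split: if_splits)
        then show ?thesis
          using subpath_inj[OF x(1) y(1), of i j k l] True x s t by simp
      next
        case False
        let ?i = "i + j - Suc (length (snd x))" and ?j = "Suc (length (snd x)) - j"
        let ?k = "k + l - Suc (length (snd y))" and ?l = "Suc (length (snd y)) - l"
        have "subpath x ?i ?j = subpath y ?k ?l" and l: "\<not> k + l \<le> length (snd y)"
          using False assms(3) s t by (auto split: if_splits)
        then have "x = y" "?i = ?k" "?j = ?l"
          using subpath_inj[OF x(1) y(1), of ?i ?j ?k ?l] False x y by auto
        then show ?thesis
          using False l x y s t by auto
      qed
    qed (use assms s ne1[of x i j] ne2[of x i j] in \<open>auto split: if_splits simp del: cyc_basis_simps\<close>)
  next
    case s: (Triv v)
    show ?thesis
      using assms s ne1 by (cases t) (auto split: if_splits simp del: cyc_basis_simps dest: sym)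
  next
    case s: (Soc v)
    show ?thesis
      using assms s ne2 by (cases t) (auto split: if_splits simp del: cyc_basis_simps dest: sym)
  qed
qed

lemma cyc_path_bij: "bij_betw cyc_path cyc_index (nz_paths <+> nz_paths)"
  unfolding bij_betw_def
proof
  show "inj_on cyc_path cyc_index"
    using cyc_path_inj by (intro inj_onI)
  show "cyc_path ` cyc_index = nz_paths <+> nz_paths"
  proof
    show "cyc_path ` cyc_index \<subseteq> nz_paths <+> nz_paths"
    proof
      fix y assume "y \<in> cyc_path ` cyc_index"
      then obtain t where "t \<in> cyc_index" "y = cyc_path t"
        by blast
      then show "y \<in> nz_paths <+> nz_paths"
        by (cases rule: cyc_index_cases[of t]) auto
    qed
    show "nz_paths <+> nz_paths \<subseteq> cyc_path ` cyc_index"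
    proof
      fix y assume "y \<in> nz_paths <+> nz_paths"
      then obtain p where p: "p \<in> nz_paths" "y = Inl p \<or> y = Inr p"
        by auto
      obtain t where "t \<in> cyc_index" "cyc_path t = Inl p" "cyc_path (cyc_bar (path_verts Q) t) = Inr p"
        using lift_path[OF p(1)] .
      then show "y \<in> cyc_path ` cyc_index"
        using p(2) cyc_bar_basis by (metis image_eqI)
    qed
  qed
qed

text \<open>The dual vector of \<open>p\<close> runs from the end of \<open>p\<close> to its start,
  which is why source and target change places in the \<open>Inr\<close> cases.\<close>

lemma cyc_path_bar:
  assumes "t \<in> cyc_index"
  shows "cyc_path t = Inl p \<Longrightarrow> cyc_path (cyc_bar (path_verts Q) t) = Inr p"
    and "cyc_path t = Inr p \<Longrightarrow> cyc_path (cyc_bar (path_verts Q) t) = Inl p"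
    and "cyc_path t = Inl p \<Longrightarrow> cyc_src (path_verts Q) t = fst p"
    and "cyc_path t = Inl p \<Longrightarrow> cyc_tgt (path_verts Q) t = path_end Q p"
    and "cyc_path t = Inr p \<Longrightarrow> cyc_src (path_verts Q) t = path_end Q p"
    and "cyc_path t = Inr p \<Longrightarrow> cyc_tgt (path_verts Q) t = fst p"
proof -
  assume t: "cyc_path t = Inl p"
  then have "p \<in> nz_paths"
    using cyc_index_cases[OF assms] by (metis old.sum.inject(1) sum.distinct(1))
  then obtain s where s: "s \<in> cyc_index" "cyc_path s = Inl p" "cyc_path (cyc_bar (path_verts Q) s) = Inr p"
    "cyc_src (path_verts Q) s = fst p" "cyc_tgt (path_verts Q) s = path_end Q p"
    by (rule lift_path)
  then show "cyc_path (cyc_bar (path_verts Q) t) = Inr p" "cyc_src (path_verts Q) t = fst p"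
    "cyc_tgt (path_verts Q) t = path_end Q p"
    using cyc_path_inj[OF s(1) assms] t by auto
next
  assume t: "cyc_path t = Inr p"
  then have "p \<in> nz_paths"
    using cyc_index_cases[OF assms] by (metis old.sum.inject(2) sum.distinct(1))
  then obtain s where s: "s \<in> cyc_index" "cyc_path s = Inl p" "cyc_path (cyc_bar (path_verts Q) s) = Inr p"
    "cyc_src (path_verts Q) s = fst p" "cyc_tgt (path_verts Q) s = path_end Q p"
    by (rule lift_path)
  have "t = cyc_bar (path_verts Q) s"
    using cyc_path_inj[OF assms cyc_bar_basis[OF s(1)]] t s(3) by simp
  then show "cyc_path (cyc_bar (path_verts Q) t) = Inl p" "cyc_src (path_verts Q) t = path_end Q p"
    "cyc_tgt (path_verts Q) t = fst p"
    using s cyc_bar_bar[OF s(1)] by auto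
qed

lemma trivial_comp: "path_comp Q (fst p, []) p p" "path_comp Q p (path_end Q p, []) p"
  by (auto simp: path_comp_def)

lemma trivial_mult_of_cyc_mult:
  assumes "s \<in> cyc_index" "t \<in> cyc_index" "u \<in> cyc_index" "cyc_mult (path_verts Q) s t u"
  shows "trivial_mult (path_comp Q) (cyc_path s) (cyc_path t) (cyc_path u)"
  using assms(4,1-3)
proof cases
  case Triv_left
  show ?thesis
    by (rule cyc_index_cases[OF assms(2)])
      (use Triv_left cyc_path_bar[OF assms(2)] trivial_comp in auto)
next
  case Triv_right
  show ?thesis
    by (rule cyc_index_cases[OF assms(1)])
      (use Triv_right cyc_path_bar[OF assms(1)] trivial_comp in auto)
next
  case full
  show ?thesis
    by (rule cyc_index_cases[OF assms(1)])
      (use full cyc_path_bar[OF assms(1)] trivial_comp in auto)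
next
  case (Arc j k x i)
  define n where "n = Suc (length (snd x))"
  have x: "x \<in> long_paths" "i < n" "0 < j" "0 < k" "j + k < n" "x \<in> nz_paths"
    using Arc assms Arc_index_iff by (auto simp: n_def long_pathD length_path_verts simp del: cyc_basis_simps)
  have len: "length (path_verts Q x) = n" "length (snd x) = n - 1"
    by (simp_all add: n_def length_path_verts)
  have cp: "cyc_path (Arc x k l) = (if k + l < n then Inl (subpath x k l) else Inr (subpath x (k + l - n) (n - l)))"
    for k l
    by (auto simp: n_def)
  have stu: "s = Arc x i j" "t = Arc x ((i + j) mod n) k" "u = Arc x i (j + k)"
    using Arc len by simp_all
  \<comment> \<open>The closing arrow is crossed by neither segment, by the second, or by the first;
    both cannot cross it because \<open>j + k < n\<close>. In the last two cases \<open>a\<close> is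
    the position, after wrapping around, where the product or the first segment ends,
    respectively.\<close>
  consider "i + j + k < n" | "i + j < n" "n \<le> i + j + k" | "n \<le> i + j"
    by linarith
  then show ?thesis
  proof cases
    case 1
    then show ?thesis
      using path_comp_subpath[OF x(6), of i j k] x len by (simp add: stu cp add.assoc del: cyc_path.simps)
  next
    case 2
    define a where "a = i + j + k - n"
    have a: "a + (n - j - k) = i" "i + j + k - n = a" "i + (j + k) - n = a" "\<not> i + j + k < n"
      using 2 x by (auto simp: a_def)
    have "path_comp Q (subpath x a (n - j - k)) (subpath x i j) (subpath x a (n - k))"
      using path_comp_subpath[OF x(6), of a "n - j - k" j] 2 x a(1,2) len by simp
    moreover have "cyc_path s = Inl (subpath x i j)" "cyc_path t = Inr (subpath x a (n - k))"
      "cyc_path u = Inr (subpath x a (n - j - k))"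
      using 2 a(2-4) by (simp_all add: stu cp add.assoc del: cyc_path.simps)
    ultimately show ?thesis
      by simp
  next
    case 3
    define a where "a = i + j - n"
    have a: "a + (n - j) = i" "(i + j) mod n = a" "i + (j + k) - n = a + k" "a + k < n"
      using 3 x by (auto simp: a_def mod_if)
    have "path_comp Q (subpath x a k) (subpath x (a + k) (n - j - k)) (subpath x a (n - j))"
      using path_comp_subpath[OF x(6), of a k "n - j - k"] 3 x a len by simp
    moreover have "cyc_path s = Inr (subpath x a (n - j))" "cyc_path t = Inl (subpath x a k)"
      "cyc_path u = Inr (subpath x (a + k) (n - j - k))"
      using 3 a(2-4) a_def by (simp_all add: stu cp del: cyc_path.simps)
    ultimately show ?thesis
      by simp
  qed
qed

text \<open>A factorisation \<open>r = p q\<close> accounts for three products in the trivial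
  extension: \<open>p q = r\<close>, \<open>q r* = p*\<close> and \<open>r* p = q*\<close>. On the
  cycle they are cyclic turns of one fact: \<open>p\<close>, \<open>q\<close> and the complement of
  \<open>r\<close> together make one full turn.\<close>

lemma cyc_mult_of_path_comp:
  assumes "P \<in> cyc_index" "T \<in> cyc_index" "R' \<in> cyc_index"
    and "cyc_path P = Inl p" "cyc_path T = Inl q" "cyc_path R' = Inl r" and pqr: "path_comp Q p q r"
    and nz: "p \<in> nz_paths" "q \<in> nz_paths" "r \<in> nz_paths"
  defines "bar \<equiv> cyc_bar (path_verts Q)"
  shows "cyc_mult (path_verts Q) P T R'"
    and "cyc_mult (path_verts Q) T (bar R') (bar P)"
    and "cyc_mult (path_verts Q) (bar R') P (bar T)"
proof -
  let ?w = "path_verts Q"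
  note P = cyc_path_bar(3,4)[OF assms(1,4)] and T = cyc_path_bar(3,4)[OF assms(2,5)]
    and R = cyc_path_bar(3,4)[OF assms(3,6)]
  have "cyc_mult ?w P T R' \<and> cyc_mult ?w T (bar R') (bar P) \<and> cyc_mult ?w (bar R') P (bar T)"
  proof (cases "snd p = []")
    case True
    then have "cyc_path P = cyc_path (Triv (fst p))" "Triv (fst p) \<in> cyc_index"
      using assms(4) nz(1) nz_paths_Nil[of "fst p"] by (cases p, simp)+
    then have P_eq: "P = Triv (fst p)"
      using cyc_path_inj[OF assms(1)] by blast
    have "q = r" "fst q = fst p"
      using pqr True by (cases p; cases q; auto simp: path_comp_def)+
    then have "T = R'"
      using cyc_path_inj[OF assms(2,3)] assms(5,6) by simp
    then show ?thesis
      using P_eq cyc_mult.Triv_left[of ?w T] cyc_mult.full[of ?w T] cyc_mult.Triv_right[of ?w "bar T"]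
        T(1) cyc_bar_bar[OF assms(2)] \<open>fst q = fst p\<close> by (simp add: bar_def)
  next
    case p_ne: False
    show ?thesis
    proof (cases "snd q = []")
      case True
      then have "cyc_path T = cyc_path (Triv (fst q))" "Triv (fst q) \<in> cyc_index"
        using assms(5) nz(2) nz_paths_Nil[of "fst q"] by (cases q, simp)+
      then have T_eq: "T = Triv (fst q)"
        using cyc_path_inj[OF assms(2)] by blast
      have "p = r" "fst q = path_end Q p"
        using pqr True by (cases p; cases q; auto simp: path_comp_def)+
      then have "P = R'"
        using cyc_path_inj[OF assms(1,3)] assms(4,6) by simp
      then show ?thesis
        using T_eq cyc_mult.Triv_right[of ?w P] cyc_mult.full[of ?w "bar P"] cyc_mult.Triv_left[of ?w "bar P"]
          P(2) cyc_bar_bar[OF assms(1)] \<open>fst q = path_end Q p\<close> by (simp add: bar_def)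
    next
      case q_ne: False
      have r: "r = (fst p, snd p @ snd q)" "fst q = path_end Q p"
        using pqr by (auto simp: path_comp_def)
      have "snd r \<noteq> []"
        using r p_ne by simp
      then obtain x i m where x: "x \<in> long_paths" "0 < m" "i + m \<le> length (snd x)" "r = subpath x i m"
        using subpath_exists[OF nz(3)] by blast
      define j k where "j = length (snd p)" "k = length (snd q)"
      have m: "m = j + k" "0 < j" "0 < k"
      proof -
        have "length (snd r) = m"
          using length_subpath[OF x(3)] x(4) by simp
        then show "m = j + k" "0 < j" "0 < k"
          using r(1) p_ne q_ne by (auto simp: j_k_def)
      qed
      have "p = (fst r, take j (snd r))"
        using r(1) by (simp add: j_k_def prod_eq_iff)
      then have p_eq: "p = subpath x i j"
        unfolding x(4) using m(1) by (simp add: subpath_def)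
      have "path_end Q p = path_verts Q x ! (i + j)"
        unfolding p_eq using x(1,3) m(1) by (intro path_end_subpath) (auto simp: long_pathD)
      then have "q = (path_verts Q x ! (i + j), drop j (snd r))"
        using r by (simp add: j_k_def prod_eq_iff)
      then have q_eq: "q = subpath x (i + j) k"
        unfolding x(4) using m(1) by (simp add: subpath_def drop_take add.commute)
      define n where "n = Suc (length (snd x))"
      have n: "i + j + k < n" "length (path_verts Q x) = n"
        using x(3) m by (simp_all add: n_def length_path_verts)
      have mem: "Arc x i j \<in> cyc_index" "Arc x (i + j) k \<in> cyc_index" "Arc x i (j + k) \<in> cyc_index"
        using x m unfolding Arc_index_iff by auto
      have "P = Arc x i j" "T = Arc x (i + j) k" "R' = Arc x i (j + k)"
        using cyc_path_inj[OF assms(1) mem(1)] cyc_path_inj[OF assms(2) mem(2)]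
          cyc_path_inj[OF assms(3) mem(3)] assms(4-6) p_eq q_eq x m by auto
      moreover have "cyc_mult ?w (Arc x i j) (Arc x ((i + j) mod n) k) (Arc x i (j + k))"
        using cyc_mult.Arc[of j k ?w x i] n by simp
      moreover have "cyc_mult ?w (Arc x (i + j) k) (Arc x ((i + j + k) mod n) (n - (j + k)))
          (Arc x (i + j) (k + (n - (j + k))))"
        using cyc_mult.Arc[of k "n - (j + k)" ?w x "i + j"] n m by simp
      moreover have "cyc_mult ?w (Arc x (i + (j + k)) (n - (j + k))) (Arc x ((i + (j + k) + (n - (j + k))) mod n) j)
          (Arc x (i + (j + k)) (n - (j + k) + j))"
        using cyc_mult.Arc[of "n - (j + k)" j ?w x "i + (j + k)"] n m by simp
      moreover have "(i + (j + k) + (n - (j + k))) mod n = i" "k + (n - (j + k)) = n - j"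
        "n - (j + k) + j = n - k"
        using n m by auto
      ultimately show ?thesis
        using n by (simp add: bar_def add.assoc)
    qed
  qed
  then show "cyc_mult ?w P T R'" "cyc_mult ?w T (bar R') (bar P)" "cyc_mult ?w (bar R') P (bar T)"
    by auto
qed

lemma cyc_mult_of_trivial_mult:
  assumes stu: "s \<in> cyc_index" "t \<in> cyc_index" "u \<in> cyc_index"
    and m: "trivial_mult (path_comp Q) (cyc_path s) (cyc_path t) (cyc_path u)"
  shows "cyc_mult (path_verts Q) s t u"
proof -
  let ?bar = "cyc_bar (path_verts Q)"
  have nzl: "p \<in> nz_paths" if "z \<in> cyc_index" "cyc_path z = Inl p" for p z
    using cyc_index_cases[OF that(1)] that(2) by (metis old.sum.inject(1) sum.distinct(1))
  have nzr: "p \<in> nz_paths" if "z \<in> cyc_index" "cyc_path z = Inr p" for p z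
    using cyc_index_cases[OF that(1)] that(2) by (metis old.sum.inject(2) sum.distinct(1))
  note bars = stu[THEN cyc_bar_basis] stu[THEN cyc_bar_bar]
  consider
    (1) p q r where "cyc_path s = Inl p" "cyc_path t = Inl q" "cyc_path u = Inl r" "path_comp Q p q r"
  | (2) p q r where "cyc_path s = Inl q" "cyc_path t = Inr r" "cyc_path u = Inr p" "path_comp Q p q r"
  | (3) p q r where "cyc_path s = Inr r" "cyc_path t = Inl p" "cyc_path u = Inr q" "path_comp Q p q r"
    using m by (cases "cyc_path s"; cases "cyc_path t"; cases "cyc_path u") auto
  then show ?thesis
  proof cases
    case (1 p q r)
    show ?thesis
      by (rule cyc_mult_of_path_comp(1)[OF stu 1 nzl[OF stu(1) 1(1)] nzl[OF stu(2) 1(2)] nzl[OF stu(3) 1(3)]])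
  next
    case (2 p q r)
    show ?thesis
      using cyc_mult_of_path_comp(2)[OF bars(3) stu(1) bars(2) cyc_path_bar(2)[OF stu(3) 2(3)] 2(1)
          cyc_path_bar(2)[OF stu(2) 2(2)] 2(4) nzr[OF stu(3) 2(3)] nzl[OF stu(1) 2(1)] nzr[OF stu(2) 2(2)]]
      by (simp only: bars)
  next
    case (3 p q r)
    show ?thesis
      using cyc_mult_of_path_comp(3)[OF stu(2) bars(3) bars(1) 3(2) cyc_path_bar(2)[OF stu(3) 3(3)]
          cyc_path_bar(2)[OF stu(1) 3(1)] 3(4) nzl[OF stu(2) 3(2)] nzr[OF stu(3) 3(3)] nzr[OF stu(1) 3(1)]]
      by (simp only: bars)
  qed
qed

theorem trivial_ext_cyc_alg:
  "cyc_alg (verts Q) ext_paths (path_verts Q) \<simeq>\<^sub>K trivial_ext (bound_quiver_alg Q I)"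
proof (rule alg_iso_trans[OF basis_alg_reindex trivial_ext_bound_quiver_alg_iso])
  show "bij_betw cyc_path cyc_index (nz_paths <+> nz_paths)"
    by (rule cyc_path_bij)
  show "Triv ` verts Q \<subseteq> cyc_index"
    by auto
  show "Inl ` trivial_paths = cyc_path ` Triv ` verts Q"
    by (auto simp: trivial_paths_def image_image)
  show "trivial_mult (path_comp Q) (cyc_path s) (cyc_path t) (cyc_path u) \<longleftrightarrow> cyc_mult (path_verts Q) s t u"
    if "s \<in> cyc_index" "t \<in> cyc_index" "u \<in> cyc_index" for s t u
    using trivial_mult_of_cyc_mult cyc_mult_of_trivial_mult that by blast
qed

end

section \<open>Recovering the cyclic words from the algebra\<close>

text \<open>Elimination: equation \<open>t\<close> is solved for one unknown \<open>s0\<close>,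
  which leaves fewer equations in the remaining unknowns. The result serves as the dimension
  argument in \<open>card_le\<close>.\<close>

lemma homogeneous_system:
  fixes M :: "'a \<Rightarrow> 'b \<Rightarrow> 'k::field"
  assumes "finite T" "finite S" "card T < card S"
  shows "\<exists>c. (\<exists>s\<in>S. c s \<noteq> 0) \<and> (\<forall>s. s \<notin> S \<longrightarrow> c s = 0) \<and> (\<forall>t\<in>T. (\<Sum>s\<in>S. c s * M s t) = 0)"
  using assms
proof (induction T arbitrary: S M rule: finite_induct)
  case empty
  then obtain s where "s \<in> S"
    by fastforce
  then show ?case
    by (intro exI[of _ "basis_vec s"]) (auto simp: basis_vec_def)
next
  case (insert t T)
  show ?case
  proof (cases "\<forall>s\<in>S. M s t = 0")
    case True
    then show ?thesis
      using insert.IH[of S M] insert.prems insert.hyps by simp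
  next
    case False
    then obtain s0 where s0: "s0 \<in> S" "M s0 t \<noteq> 0"
      by blast
    define S' where "S' = S - {s0}"
    define M' where "M' s t' = M s t' - M s t / M s0 t * M s0 t'" for s t'
    have "card T < card S'"
      using insert.prems insert.hyps s0 by (simp add: S'_def)
    then obtain c where c: "\<exists>s\<in>S'. c s \<noteq> 0" "\<forall>s. s \<notin> S' \<longrightarrow> c s = 0"
      "\<forall>t'\<in>T. (\<Sum>s\<in>S'. c s * M' s t') = 0"
      using insert.IH[of S' M'] insert.prems by (auto simp: S'_def)
    \<comment> \<open>The value that equation \<open>t\<close> forces on the eliminated unknown
      \<open>s0\<close>.\<close>
    define r where "r = - (\<Sum>s\<in>S'. c s * M s t) / M s0 t"
    define d where "d s = (if s = s0 then r else c s)" for s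
    have sum: "(\<Sum>s\<in>S. d s * M s t') = r * M s0 t' + (\<Sum>s\<in>S'. c s * M s t')" for t'
    proof -
      have "(\<Sum>s\<in>S'. d s * M s t') = (\<Sum>s\<in>S'. c s * M s t')"
        by (rule sum.cong) (auto simp: d_def S'_def)
      then show ?thesis
        using sum.remove[OF insert.prems(1) s0(1), of "\<lambda>s. d s * M s t'"]
        by (simp add: S'_def d_def)
    qed
    have "(\<Sum>s\<in>S. d s * M s t) = 0"
      unfolding sum using s0(2) by (simp add: r_def)
    moreover have "(\<Sum>s\<in>S. d s * M s t') = 0" if "t' \<in> T" for t'
    proof -
      have "(\<Sum>s\<in>S'. c s * M' s t') = (\<Sum>s\<in>S'. c s * M s t') - (\<Sum>s\<in>S'. c s * M s t) / M s0 t * M s0 t'"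
        by (simp add: M'_def algebra_simps sum_subtractf sum_distrib_left sum_distrib_right sum_divide_distrib)
      then show ?thesis
        unfolding sum using c(3) that by (simp add: r_def)
    qed
    moreover have "\<exists>s\<in>S. d s \<noteq> 0" "\<forall>s. s \<notin> S \<longrightarrow> d s = 0"
      using c(1,2) s0(1) by (auto simp: S'_def d_def)
    ultimately show ?thesis
      by (intro exI[of _ d]) auto
  qed
qed

lemma basis_mult_nonzeroE:
  assumes "(f \<otimes>\<^bsub>basis_alg B m U\<^esub> g) u \<noteq> 0"
  obtains s t where "s \<in> B" "t \<in> B" "m s t u" "f s \<noteq> 0" "g t \<noteq> 0"
proof -
  have "(\<Sum>(s, t) | s \<in> B \<and> t \<in> B \<and> m s t u. f s * g t) \<noteq> 0"
    using assms by (auto split: if_splits)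
  then obtain p where "p \<in> {(s, t). s \<in> B \<and> t \<in> B \<and> m s t u}" "(case p of (s, t) \<Rightarrow> f s * g t) \<noteq> 0"
    by (rule sum.not_neutral_contains_not_neutral)
  then show ?thesis
    using that by auto
qed

lemma basis_vec_mult:
  assumes "finite B" "s \<in> B" "t \<in> B"
  shows "basis_vec s \<otimes>\<^bsub>basis_alg B m U\<^esub> basis_vec t = (\<lambda>u. if u \<in> B \<and> m s t u then 1 else 0)"
proof
  fix u
  have "(\<Sum>s'\<in>B. \<Sum>t'\<in>B. if m s' t' u then basis_vec s s' * basis_vec t t' else 0) =
      (\<Sum>s'\<in>B. \<Sum>t'\<in>B. if t' = t then if s' = s then if m s t u then 1 else 0 else 0 else 0)"
    by (intro sum.cong) (auto simp: basis_vec_def)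
  also have "\<dots> = (if m s t u then 1 else 0)"
    using assms by simp
  finally show "(basis_vec s \<otimes>\<^bsub>basis_alg B m U\<^esub> basis_vec t) u = (if u \<in> B \<and> m s t u then 1 else 0)"
    using assms(1) by (cases "u \<in> B") (simp_all add: basis_mult_eq del: basis_alg_simps, simp)
qed

section \<open>Filtration, characters and the pairing with complements\<close>

locale cyclic_words =
  fixes V :: "'v set" and X :: "'x set" and w :: "'x \<Rightarrow> 'v list"
  assumes finite_V: "finite V" and finite_X: "finite X"
    and word_subset: "x \<in> X \<Longrightarrow> set (w x) \<subseteq> V"
begin

abbreviation "B \<equiv> cyc_basis V X w"

lemma finite_basis: "finite B"
proof (rule finite_subset)
  show "B \<subseteq> Triv ` V \<union> Soc ` V \<union> (\<Union>x\<in>X. (\<lambda>(i, j). Arc x i j) ` ({..<length (w x)} \<times> {..<length (w x)}))"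
    by (auto simp: cyc_basis_def)
qed (use finite_V finite_X in auto)

lemma cyc_src_in: "t \<in> B \<Longrightarrow> cyc_src w t \<in> V"
  by (cases t) (auto intro: subsetD[OF word_subset nth_mem])

lemma cyc_mult_unique:
  "s \<in> B \<Longrightarrow> t \<in> B \<Longrightarrow> u \<in> B \<Longrightarrow> u' \<in> B \<Longrightarrow> cyc_mult w s t u \<Longrightarrow> cyc_mult w s t u' \<Longrightarrow> u = u'"
  by (cases s; cases t) (auto elim!: cyc_mult.cases)

text \<open>For \<open>k \<ge> 1\<close> these indices span the k-th power of the radical plus the
  socle. \<open>Soc v\<close> belongs to every layer because it has no length of its own.\<close>

definition filtration :: "nat \<Rightarrow> ('x, 'v) cyc set"
  where "filtration k = Soc ` V \<union> {t \<in> B. \<exists>x i j. t = Arc x i j \<and> k \<le> j}"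

lemma filtration_simps [simp]:
  "Triv v \<notin> filtration k" "Soc v \<in> filtration k \<longleftrightarrow> v \<in> V"
  "Arc x i j \<in> filtration k \<longleftrightarrow> Arc x i j \<in> B \<and> k \<le> j"
  by (auto simp: filtration_def)

lemma filtration_sub: "filtration k \<subseteq> B"
  by (auto simp: filtration_def)

lemma filtration_1: "filtration (Suc 0) = B - Triv ` V"
  by (auto simp: filtration_def cyc_basis_def)

lemma filtration_mult:
  assumes "s \<in> filtration k" "t \<in> filtration l" "cyc_mult w s t u" "u \<in> B"
  shows "u \<in> filtration (k + l)"
  using assms(3)
proof cases
  case Triv_left
  then show ?thesis
    using assms by auto
next
  case Triv_right
  then show ?thesis
    using assms by auto
next
  case full
  then show ?thesis
    using assms by simp
next
  case (Arc j k x i)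
  then show ?thesis
    using assms by (simp add: add_mono)
qed

text \<open>A character vanishes on the radical indices. Its values \<open>a v\<close> on the
  orthogonal idempotents \<open>Triv v\<close> are orthogonal idempotents of a field with sum 1, so
  exactly one of them is 1 and the others are 0.\<close>

lemma character_unique:
  fixes \<phi> :: "(('x, 'v) cyc \<Rightarrow> 'k::field) \<Rightarrow> 'k"
  defines "A \<equiv> cyc_alg V X w :: ('k, ('x, 'v) cyc \<Rightarrow> 'k) module"
  assumes add: "\<And>f g. f \<in> carrier A \<Longrightarrow> g \<in> carrier A \<Longrightarrow> \<phi> (f \<oplus>\<^bsub>A\<^esub> g) = \<phi> f + \<phi> g"
    and smult: "\<And>c f. f \<in> carrier A \<Longrightarrow> \<phi> (c \<odot>\<^bsub>A\<^esub> f) = c * \<phi> f"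
    and mult: "\<And>f g. f \<in> carrier A \<Longrightarrow> g \<in> carrier A \<Longrightarrow> \<phi> (f \<otimes>\<^bsub>A\<^esub> g) = \<phi> f * \<phi> g"
    and one: "\<phi> \<one>\<^bsub>A\<^esub> = 1"
  shows "\<exists>v \<in> V. \<forall>f \<in> carrier A. \<phi> f = f (Triv v)"
proof -
  have expand: "\<phi> f = (\<Sum>p\<in>B. f p * \<phi> (basis_vec p))" if "f \<in> carrier A" for f
    using that add smult by (intro basis_expansion finite_basis) (simp_all add: A_def)
  have vec: "basis_vec p \<in> carrier A" if "p \<in> B" for p
    using that by (auto simp: A_def basis_vec_def)
  have zero: "\<phi> (\<lambda>i. 0) = 0"
    using smult[of "\<lambda>i. 0" 0] by (simp add: A_def)
  have nil: "\<phi> (basis_vec t) = 0" if "t \<in> filtration (Suc 0)" for t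
  proof -
    obtain N where N: "\<And>x i j. Arc x i j \<in> B \<Longrightarrow> j \<le> N"
    proof (rule that)
      fix x i j assume "Arc x i j \<in> B"
      then have "x \<in> X" "j \<le> length (w x)"
        by auto
      then show "j \<le> Max (insert 0 ((\<lambda>x. length (w x)) ` X))"
        using finite_X by (intro Max.coboundedI order.trans[OF \<open>j \<le> length (w x)\<close>]) auto
    qed
    \<comment> \<open>The square of \<open>\<phi> (basis_vec t)\<close> is the value of
      \<open>\<phi>\<close> on a square that is zero or a basis vector of smaller \<open>d\<close>.
      With \<open>Suc N\<close> instead of \<open>N\<close> every \<open>Arc\<close> stays strictly
      above the value 0 of \<open>Soc\<close>.\<close>
    define d where "d t = (case t of Arc x i j \<Rightarrow> Suc N - j | _ \<Rightarrow> 0)" for t :: "('x, 'v) cyc"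
    show ?thesis
      using that
    proof (induction "d t" arbitrary: t rule: less_induct)
      case less
      have t: "t \<in> B"
        using less.prems filtration_sub by blast
      have "\<phi> (basis_vec t) * \<phi> (basis_vec t) = \<phi> (\<lambda>u. if u \<in> B \<and> cyc_mult w t t u then 1 else 0)"
        unfolding mult[OF vec[OF t] vec[OF t], symmetric]
        unfolding A_def basis_vec_mult[OF finite_basis t t] by (rule refl)
      also have "\<dots> = 0"
      proof (cases "\<exists>u \<in> B. cyc_mult w t t u")
        case True
        then obtain u where u: "u \<in> B" "cyc_mult w t t u"
          by blast
        then have "(\<lambda>u. if u \<in> B \<and> cyc_mult w t t u then 1 else 0) = (basis_vec u :: _ \<Rightarrow> 'k)"
          using cyc_mult_unique[OF t t] by (auto simp: fun_eq_iff basis_vec_def)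
        moreover have "u \<in> filtration (Suc 0)"
          using filtration_mult[OF less.prems less.prems u(2,1)] by (cases u) auto
        moreover have "d u < d t"
          using u(2) less.prems
        proof cases
          case (Arc j k x i)
          then show ?thesis
            using N[of x i j] t by (auto simp: d_def)
        next
          case full
          then show ?thesis
            using N[of _ _] t less.prems by (cases t) (auto simp: d_def less_Suc_eq_le)
        next
          case Triv_left
          then show ?thesis
            using less.prems filtration_simps(1) by metis
        next
          case Triv_right
          then show ?thesis
            using less.prems filtration_simps(1) by metis
        qed
        ultimately show ?thesis
          using less.hyps by simp
      next
        case False
        then have "(\<lambda>u. if u \<in> B \<and> cyc_mult w t t u then 1 else 0) = (\<lambda>i. 0 :: 'k)"
          by auto
        then show ?thesis
          by (simp only: zero)
      qed
      finally show ?case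
        by simp
    qed
  qed
  define a where "a v = \<phi> (basis_vec (Triv v))" for v
  have expand': "\<phi> f = (\<Sum>v\<in>V. f (Triv v) * a v)" if "f \<in> carrier A" for f
  proof -
    have "\<phi> f = (\<Sum>p \<in> Triv ` V. f p * \<phi> (basis_vec p))"
      unfolding expand[OF that] using nil filtration_1 finite_basis
      by (intro sum.mono_neutral_right) auto
    also have "\<dots> = (\<Sum>v\<in>V. f (Triv v) * a v)"
      by (subst sum.reindex) (auto simp: a_def inj_on_def)
    finally show ?thesis .
  qed
  have idem: "a u * a v = (if u = v then a u else 0)" if "u \<in> V" "v \<in> V" for u v
  proof -
    have "cyc_mult w (Triv u) (Triv v) p \<longleftrightarrow> u = v \<and> p = Triv u" if "p \<in> B" for p
      using cyc_mult.Triv_left[of w "Triv u"] by (auto elim: cyc_mult.cases)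
    then have "(\<lambda>p. if p \<in> B \<and> cyc_mult w (Triv u) (Triv v) p then 1 else 0) =
        (if u = v then basis_vec (Triv u) else (\<lambda>i. 0 :: 'k))"
      using that by (auto simp: fun_eq_iff basis_vec_def)
    moreover have "a u * a v = \<phi> (\<lambda>p. if p \<in> B \<and> cyc_mult w (Triv u) (Triv v) p then 1 else 0)"
    proof -
      have B: "Triv u \<in> B" "Triv v \<in> B"
        using that by auto
      show ?thesis
        unfolding a_def mult[OF vec[OF B(1)] vec[OF B(2)], symmetric]
        unfolding A_def basis_vec_mult[OF finite_basis B] by (rule refl)
    qed
    ultimately show ?thesis
      using zero by (simp add: a_def)
  qed
  have "(\<Sum>v\<in>V. a v) = 1"
  proof -
    have "\<one>\<^bsub>A\<^esub> \<in> carrier A"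
      by (auto simp: A_def)
    from expand'[OF this] one show ?thesis
      by (simp add: A_def)
  qed
  then obtain v where v: "v \<in> V" "a v \<noteq> 0"
    by (metis sum.neutral zero_neq_one)
  have "a v = 1"
    using idem[OF v(1) v(1)] v(2) by simp
  moreover have "a u = 0" if "u \<in> V" "u \<noteq> v" for u
    using idem[OF that(1) v(1)] v(2) that(2) by simp
  ultimately have "\<phi> f = f (Triv v)" if "f \<in> carrier A" for f
  proof -
    have "\<phi> f = (\<Sum>u\<in>V. if u = v then f (Triv v) else 0)"
      unfolding expand'[OF that] using \<open>a v = 1\<close> \<open>\<And>u. u \<in> V \<Longrightarrow> u \<noteq> v \<Longrightarrow> a u = 0\<close>
      by (intro sum.cong) auto
    then show ?thesis
      using v(1) finite_V by simp
  qed
  then show ?thesis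
    using v(1) by blast
qed

lemma mult_at_Triv:
  assumes "v \<in> V"
  shows "(f \<otimes>\<^bsub>cyc_alg V X w\<^esub> g) (Triv v) = f (Triv v) * g (Triv v)"
proof -
  have "cyc_mult w s t (Triv v) \<longleftrightarrow> s = Triv v \<and> t = Triv v" for s t
    using cyc_mult.Triv_left[of w "Triv v"] by (auto elim: cyc_mult.cases)
  then have "{(s, t). s \<in> B \<and> t \<in> B \<and> cyc_mult w s t (Triv v)} = {(Triv v, Triv v)}"
    using assms by auto
  then show ?thesis
    using assms by simp
qed

text \<open>Nondegeneracy of the duality: among the radical indices only \<open>t\<close> itself is
  completed by \<open>cyc_bar w t\<close> to this socle element, so multiplication by the complement
  reads off the coefficient of \<open>f\<close> at \<open>t\<close>.\<close>

lemma mult_bar_at_Soc: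
  assumes "t \<in> B" "\<forall>v. t \<noteq> Triv v" "\<forall>i. i \<notin> filtration (Suc 0) \<longrightarrow> f i = 0"
  shows "(f \<otimes>\<^bsub>cyc_alg V X w\<^esub> basis_vec (cyc_bar w t)) (Soc (cyc_src w t)) = f t"
proof -
  have *: "s = t" if "cyc_mult w s (cyc_bar w t) (Soc (cyc_src w t))" "s \<in> filtration (Suc 0)" for s
    using that(1)
  proof cases
    case full
    then have "cyc_bar w (cyc_bar w s) = cyc_bar w (cyc_bar w t)"
      by simp
    then show ?thesis
      using cyc_bar_bar assms(1) that(2) filtration_sub by (metis subsetD)
  next
    case Triv_right
    then show ?thesis
      using assms(2) by (cases t) auto
  qed (use that(2) in auto)
  have bar: "cyc_bar w t \<in> B" "Soc (cyc_src w t) \<in> B"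
    using assms(1) cyc_bar_basis cyc_src_in by auto
  have "(f \<otimes>\<^bsub>cyc_alg V X w\<^esub> basis_vec (cyc_bar w t)) (Soc (cyc_src w t)) =
      (\<Sum>s\<in>B. \<Sum>r\<in>B. if cyc_mult w s r (Soc (cyc_src w t)) then f s * basis_vec (cyc_bar w t) r else 0)"
    using bar by (intro basis_mult_eq finite_basis)
  also have "\<dots> = (\<Sum>s\<in>B. \<Sum>r\<in>B. if r = cyc_bar w t then if s = t then f t else 0 else 0)"
    using * assms(3) cyc_mult.full[of w t] by (intro sum.cong) (auto simp: basis_vec_def)
  also have "\<dots> = f t"
    using assms(1) bar finite_basis by simp
  finally show ?thesis .
qed

end

text \<open>With the inverse \<open>g\<close> as a parameter the situation is symmetric, and every
  statement about \<open>h\<close> can be turned around by \<open>cyc_iso_swap\<close>.\<close>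

locale cyc_iso = A: cyclic_words V X w + B: cyclic_words V' X' w'
  for V :: "'v set" and X :: "'x set" and w :: "'x \<Rightarrow> 'v list"
    and V' :: "'u set" and X' :: "'y set" and w' :: "'y \<Rightarrow> 'u list" +
  fixes h :: "(('x, 'v) cyc \<Rightarrow> 'k::field) \<Rightarrow> (('y, 'u) cyc \<Rightarrow> 'k)"
    and g :: "(('y, 'u) cyc \<Rightarrow> 'k) \<Rightarrow> (('x, 'v) cyc \<Rightarrow> 'k)"
  assumes h: "alg_hom (cyc_alg V X w) (cyc_alg V' X' w') h"
    and g: "alg_hom (cyc_alg V' X' w') (cyc_alg V X w) g"
    and gh: "f \<in> carrier (cyc_alg V X w) \<Longrightarrow> g (h f) = f"
    and hg: "f' \<in> carrier (cyc_alg V' X' w') \<Longrightarrow> h (g f') = f'"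
begin

lemma cyc_iso_swap: "cyc_iso V' X' w' V X w g h"
  using A.cyclic_words_axioms B.cyclic_words_axioms h g gh hg
  by (simp add: cyc_iso_def cyc_iso_axioms_def del: basis_alg_simps)

abbreviation "CA \<equiv> cyc_alg V X w :: ('k, ('x, 'v) cyc \<Rightarrow> 'k) module"
abbreviation "CB \<equiv> cyc_alg V' X' w' :: ('k, ('y, 'u) cyc \<Rightarrow> 'k) module"

text \<open>The coefficient at \<open>Triv v'\<close> is a character of the second algebra, and its
  composition with \<open>h\<close> is a character of the first.\<close>

lemma pull_back_character:
  assumes "v' \<in> V'"
  shows "\<exists>v \<in> V. \<forall>f \<in> carrier CA. h f (Triv v') = f (Triv v)"
proof (rule A.character_unique)
  show "h \<one>\<^bsub>CA\<^esub> (Triv v') = 1"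
    using alg_homD(4)[OF h] assms by simp
next
  fix f1 f2 assume f: "f1 \<in> carrier CA" "f2 \<in> carrier CA"
  show "h (f1 \<oplus>\<^bsub>CA\<^esub> f2) (Triv v') = h f1 (Triv v') + h f2 (Triv v')"
    unfolding alg_homD(3)[OF h f] by simp
  show "h (f1 \<otimes>\<^bsub>CA\<^esub> f2) (Triv v') = h f1 (Triv v') * h f2 (Triv v')"
    unfolding alg_homD(2)[OF h f] by (rule B.mult_at_Triv[OF assms])
next
  fix c f assume f: "f \<in> carrier CA"
  show "h (c \<odot>\<^bsub>CA\<^esub> f) (Triv v') = c * h f (Triv v')"
    unfolding alg_homD(5)[OF h f] by simp
qed

end

lemma (in cyclic_words) basis_vec_carrier: "t \<in> B \<Longrightarrow> basis_vec t \<in> carrier (cyc_alg V X w)"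
  by (auto simp: basis_vec_def)

text \<open>Characters are pulled back along \<open>h\<close> and along \<open>g\<close>; evaluating
  on the idempotents shows that the two resulting maps of vertices are inverse to each
  other.\<close>

lemma (in cyc_iso) vertex_bijection:
  obtains \<psi> where "bij_betw \<psi> V V'"
    "\<And>v f. v \<in> V \<Longrightarrow> f \<in> carrier CA \<Longrightarrow> h f (Triv (\<psi> v)) = f (Triv v)"
proof -
  interpret swap: cyc_iso V' X' w' V X w g h
    by (rule cyc_iso_swap)
  obtain \<theta> where \<theta>: "\<And>v'. v' \<in> V' \<Longrightarrow> \<theta> v' \<in> V"
    "\<And>v' f. v' \<in> V' \<Longrightarrow> f \<in> carrier CA \<Longrightarrow> h f (Triv v') = f (Triv (\<theta> v'))"
    using pull_back_character by metis
  obtain \<psi> where \<psi>: "\<And>v. v \<in> V \<Longrightarrow> \<psi> v \<in> V'"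
    "\<And>v f. v \<in> V \<Longrightarrow> f \<in> carrier CB \<Longrightarrow> g f (Triv v) = f (Triv (\<psi> v))"
    using swap.pull_back_character by metis
  have "\<theta> (\<psi> v) = v" if "v \<in> V" for v
  proof -
    let ?e = "basis_vec (Triv v) :: ('x, 'v) cyc \<Rightarrow> 'k"
    have e: "?e \<in> carrier CA"
      using that by (intro A.basis_vec_carrier) simp
    have "g (h ?e) (Triv v) = h ?e (Triv (\<psi> v))"
      using \<psi>(2)[OF that alg_homD(1)[OF h e]] .
    also have "\<dots> = ?e (Triv (\<theta> (\<psi> v)))"
      using \<theta>(2)[OF \<psi>(1)[OF that] e] .
    finally show ?thesis
      using gh[OF e] by (auto simp: basis_vec_def split: if_splits)
  qed
  moreover have "\<psi> (\<theta> v) = v" if "v \<in> V'" for v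
  proof -
    let ?e = "basis_vec (Triv v) :: ('y, 'u) cyc \<Rightarrow> 'k"
    have e: "?e \<in> carrier CB"
      using that by (intro B.basis_vec_carrier) simp
    have "h (g ?e) (Triv v) = g ?e (Triv (\<theta> v))"
      using \<theta>(2)[OF that alg_homD(1)[OF g e]] .
    also have "\<dots> = ?e (Triv (\<psi> (\<theta> v)))"
      using \<psi>(2)[OF \<theta>(1)[OF that] e] .
    finally show ?thesis
      using hg[OF e] by (auto simp: basis_vec_def split: if_splits)
  qed
  ultimately have "bij_betw \<psi> V V'"
    using \<theta>(1) \<psi>(1) by (intro bij_betwI[where g = \<theta>]) auto
  moreover have "h f (Triv (\<psi> v)) = f (Triv v)" if "v \<in> V" "f \<in> carrier CA" for v f
    using \<theta>(2)[OF \<psi>(1)[OF that(1)] that(2)] \<open>\<And>v. v \<in> V \<Longrightarrow> \<theta> (\<psi> v) = v\<close>[OF that(1)] by simp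
  ultimately show ?thesis
    by (rule that)
qed

section \<open>Subspaces spanned by sets of indices and their dimensions\<close>

definition supported :: "'i set \<Rightarrow> ('i \<Rightarrow> 'k::field) \<Rightarrow> bool"
  where "supported S f \<longleftrightarrow> (\<forall>i. i \<notin> S \<longrightarrow> f i = 0)"

lemma supported_mono: "supported S f \<Longrightarrow> S \<subseteq> T \<Longrightarrow> supported T f"
  by (auto simp: supported_def)

lemma supported_basis_vec [simp]: "supported S (basis_vec t) \<longleftrightarrow> t \<in> S"
  by (auto simp: supported_def basis_vec_def)

lemma supported_mult:
  assumes "supported S f" "supported T g" "\<And>s t u. s \<in> S \<Longrightarrow> t \<in> T \<Longrightarrow> m s t u \<Longrightarrow> u \<in> B \<Longrightarrow> u \<in> R"
  shows "supported R (f \<otimes>\<^bsub>basis_alg B m U\<^esub> g)"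
  unfolding supported_def
proof (intro allI impI, rule ccontr)
  fix u assume u: "u \<notin> R" "(f \<otimes>\<^bsub>basis_alg B m U\<^esub> g) u \<noteq> 0"
  from u(2) obtain s t where "m s t u" "f s \<noteq> 0" "g t \<noteq> 0"
    by (rule basis_mult_nonzeroE)
  moreover have "s \<in> S" "t \<in> T"
    using assms(1,2) calculation unfolding supported_def by blast+
  moreover have "u \<in> B"
    using u(2) by (auto split: if_splits)
  ultimately show False
    using assms(3) u(1) by blast
qed

lemma cyc_alg_carrier: "f \<in> carrier (cyc_alg V X w) \<longleftrightarrow> supported (cyc_basis V X w) f"
  by (simp add: supported_def)

context cyc_iso
begin

lemma h_expand:
  assumes "supported S f" "S \<subseteq> A.B"
  shows "h f u = (\<Sum>p\<in>S. f p * h (basis_vec p) u)"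
proof -
  have "h f u = (\<Sum>p\<in>A.B. f p * h (basis_vec p) u)"
  proof (rule basis_expansion[OF A.finite_basis, of "\<lambda>f. h f u"])
    show "h (\<lambda>i. f1 i + f2 i) u = h f1 u + h f2 u"
      if "\<forall>i. i \<notin> A.B \<longrightarrow> f1 i = 0" "\<forall>i. i \<notin> A.B \<longrightarrow> f2 i = 0" for f1 f2
      using alg_homD(3)[OF h, of f1 f2] that by simp
    show "h (\<lambda>i. c * f1 i) u = c * h f1 u" if "\<forall>i. i \<notin> A.B \<longrightarrow> f1 i = 0" for c f1
      using alg_homD(5)[OF h, of f1 c] that by simp
  qed (use assms in \<open>auto simp: supported_def\<close>)
  also have "\<dots> = (\<Sum>p\<in>S. f p * h (basis_vec p) u)"
    using assms A.finite_basis by (intro sum.mono_neutral_right) (auto simp: supported_def)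
  finally show ?thesis .
qed

lemma h_supportedI:
  assumes "S \<subseteq> A.B" "\<And>t. t \<in> S \<Longrightarrow> supported S' (h (basis_vec t))" "supported S f"
  shows "supported S' (h f)"
  using assms(2) h_expand[OF assms(3,1)] by (auto simp: supported_def intro!: sum.neutral)

text \<open>Were \<open>S\<close> larger, \<open>homogeneous_system\<close> would give a nonzero
  vector supported in \<open>S\<close> and killed by \<open>h\<close>, contradicting
  injectivity.\<close>

lemma card_le:
  assumes S: "S \<subseteq> A.B" and S': "S' \<subseteq> B.B" and hS: "\<And>f. supported S f \<Longrightarrow> supported S' (h f)"
  shows "card S \<le> card S'"
proof (rule ccontr)
  assume "\<not> card S \<le> card S'"
  moreover have fin: "finite S" "finite S'"
    using S S' A.finite_basis B.finite_basis by (auto intro: finite_subset)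
  ultimately obtain c where c: "\<exists>s\<in>S. c s \<noteq> 0" "supported S c"
    "\<forall>t\<in>S'. (\<Sum>s\<in>S. c s * h (basis_vec s) t) = 0"
    using homogeneous_system[of S' S "\<lambda>s. h (basis_vec s)"] by (auto simp: supported_def)
  have "h c = (\<lambda>i. 0)"
    using hS[OF c(2)] c(3) h_expand[OF c(2) S] by (auto simp: supported_def fun_eq_iff)
  moreover have "c \<in> carrier CA"
    using c(2) S by (simp add: cyc_alg_carrier supported_mono del: basis_alg_simps)
  moreover have "g (\<lambda>i. 0) = (\<lambda>i. 0)"
    using alg_homD(5)[OF g, of "\<lambda>i. 0" 0] by simp
  ultimately have "c = (\<lambda>i. 0)"
    using gh by metis
  then show False
    using c(1) by simp
qed

end

locale cyc_iso_verts = cyc_iso V X w V' X' w' h g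
  for V :: "'v set" and X :: "'x set" and w :: "'x \<Rightarrow> 'v list"
    and V' :: "'u set" and X' :: "'y set" and w' :: "'y \<Rightarrow> 'u list"
    and h :: "(('x, 'v) cyc \<Rightarrow> 'k::field) \<Rightarrow> (('y, 'u) cyc \<Rightarrow> 'k)" and g +
  fixes \<psi> :: "'v \<Rightarrow> 'u" and \<psi>' :: "'u \<Rightarrow> 'v"
  assumes \<psi>: "v \<in> V \<Longrightarrow> \<psi> v \<in> V'" "v' \<in> V' \<Longrightarrow> \<psi>' v' \<in> V"
    and \<psi>_inverse: "v \<in> V \<Longrightarrow> \<psi>' (\<psi> v) = v" "v' \<in> V' \<Longrightarrow> \<psi> (\<psi>' v') = v'"
    and h_Triv: "v \<in> V \<Longrightarrow> f \<in> carrier CA \<Longrightarrow> h f (Triv (\<psi> v)) = f (Triv v)"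
begin

lemma g_Triv:
  assumes "v' \<in> V'" "f' \<in> carrier CB"
  shows "g f' (Triv (\<psi>' v')) = f' (Triv v')"
  using h_Triv[OF \<psi>(2)[OF assms(1)] alg_homD(1)[OF g assms(2)]] hg[OF assms(2)] \<psi>_inverse(2)[OF assms(1)]
  by simp

lemma cyc_iso_verts_swap: "cyc_iso_verts V' X' w' V X w g h \<psi>' \<psi>"
  unfolding cyc_iso_verts_def cyc_iso_verts_axioms_def
  using cyc_iso_swap \<psi> \<psi>_inverse g_Triv by blast

lemma carrier_filtration: "supported (A.filtration k) f \<Longrightarrow> f \<in> carrier CA"
  unfolding cyc_alg_carrier by (rule supported_mono[OF _ A.filtration_sub])

text \<open>The radical is the common kernel of the characters, and \<open>h\<close> matches the
  characters along \<open>\<psi>\<close>.\<close>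

lemma h_radical:
  assumes "supported (A.filtration (Suc 0)) f"
  shows "supported (B.filtration (Suc 0)) (h f)"
proof -
  have f: "f \<in> carrier CA"
    using assms by (rule carrier_filtration)
  have "h f (Triv v') = 0" if "v' \<in> V'" for v'
    using h_Triv[OF \<psi>(2)[OF that] f] \<psi>_inverse(2)[OF that] assms by (simp add: supported_def)
  moreover have "supported B.B (h f)"
    using alg_homD(1)[OF h f] by (simp add: cyc_alg_carrier del: basis_alg_simps)
  ultimately show ?thesis
    unfolding B.filtration_1 supported_def by auto
qed

end

text \<open>A radical index outside the socle has its complement in the radical too, and multiplying
  by this complement reads off the coefficient. With \<open>Soc_ann\<close> this describes the socle
  as the part of the radical that the radical annihilates from the right, hence invariantly.\<close>

lemma (in cyclic_words) supported_SocI: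
  fixes f :: "('x, 'v) cyc \<Rightarrow> 'k::field"
  assumes f: "supported (filtration (Suc 0)) f"
    and ann: "\<And>y. supported (filtration (Suc 0)) y \<Longrightarrow> f \<otimes>\<^bsub>cyc_alg V X w\<^esub> y = (\<lambda>i. 0)"
  shows "supported (Soc ` V) f"
  unfolding supported_def
proof (intro allI impI)
  fix t :: "('x, 'v) cyc" assume t: "t \<notin> Soc ` V"
  show "f t = 0"
  proof (cases "t \<in> filtration (Suc 0)")
    case True
    then have B: "t \<in> B" "\<forall>v. t \<noteq> Triv v"
      using filtration_sub by auto
    then have "cyc_bar w t \<in> filtration (Suc 0)"
      using t cyc_bar_basis[OF B(1)] by (cases t) auto
    then have "f \<otimes>\<^bsub>cyc_alg V X w\<^esub> basis_vec (cyc_bar w t) = (\<lambda>i. 0)"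
      by (intro ann) simp
    then show ?thesis
      using mult_bar_at_Soc[OF B, of f] f by (simp add: supported_def del: basis_alg_simps)
  next
    case False
    then show ?thesis
      using f by (simp add: supported_def)
  qed
qed

lemma (in cyclic_words) Soc_ann:
  assumes "supported (Soc ` V) f" "supported (filtration (Suc 0)) y"
  shows "f \<otimes>\<^bsub>cyc_alg V X w\<^esub> y = (\<lambda>i. 0)"
proof -
  have "supported {} (f \<otimes>\<^bsub>cyc_alg V X w\<^esub> y)"
    using assms by (rule supported_mult) (auto elim!: cyc_mult.cases)
  then show ?thesis
    by (auto simp: supported_def)
qed

text \<open>
  With \<open>k = length l\<close>, the indices in \<open>run_space l\<close> span
  \<open>e\<^bsub>l ! 0\<^esub> r e\<^bsub>l ! 1\<^esub> r \<dots> r e\<^bsub>l ! (k - 1)\<^esub> + r\<^sup>k + soc\<close> for the radical \<open>r\<close>. Modulo \<open>r\<^sup>k\<close> this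
  depends on the idempotents only modulo \<open>r\<close>, which makes it invariant under isomorphisms
  without conjugating idempotents.
\<close>

definition (in cyclic_words) runs :: "'v list \<Rightarrow> ('x, 'v) cyc set"
  where "runs l = {t \<in> B. \<exists>x i. t = Arc x i (length l - 1) \<and>
    (\<forall>m < length l. w x ! ((i + m) mod length (w x)) = l ! m)}"

definition (in cyclic_words) run_space :: "'v list \<Rightarrow> ('x, 'v) cyc set"
  where "run_space l = runs l \<union> filtration (length l)"

lemma (in cyclic_words) run_space_sub: "run_space l \<subseteq> B"
  using filtration_sub by (auto simp: run_space_def runs_def)

lemma (in cyclic_words) run_space_filtration: "2 \<le> length l \<Longrightarrow> run_space l \<subseteq> filtration (length l - 1)"
  by (auto simp: run_space_def runs_def filtration_def)

text \<open>Splitting off the last arrow is the induction step for \<open>h_filtration\<close> and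
  \<open>h_run_space\<close>.\<close>

lemma (in cyclic_words) Arc_split:
  assumes "Arc x i (Suc j) \<in> B" "0 < j"
  shows "Arc x i j \<in> B" "Arc x ((i + j) mod length (w x)) 1 \<in> B"
    and "(basis_vec (Arc x i (Suc j)) :: ('x, 'v) cyc \<Rightarrow> 'k::field) =
      basis_vec (Arc x i j) \<otimes>\<^bsub>cyc_alg V X w\<^esub> basis_vec (Arc x ((i + j) mod length (w x)) 1)"
proof -
  show B: "Arc x i j \<in> B" "Arc x ((i + j) mod length (w x)) 1 \<in> B"
    using assms by (auto intro!: mod_less_divisor)
  have "cyc_mult w (Arc x i j) (Arc x ((i + j) mod length (w x)) 1) (Arc x i (Suc j))"
    using cyc_mult.Arc[of j 1 w x i] assms by simp
  then have eq: "(\<lambda>u. if u \<in> B \<and> cyc_mult w (Arc x i j) (Arc x ((i + j) mod length (w x)) 1) u then 1 else 0) =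
      (basis_vec (Arc x i (Suc j)) :: ('x, 'v) cyc \<Rightarrow> 'k)"
    using cyc_mult_unique[OF B] assms(1)
    by (auto simp: fun_eq_iff basis_vec_def simp del: One_nat_def cyc_basis_simps)
  show "(basis_vec (Arc x i (Suc j)) :: ('x, 'v) cyc \<Rightarrow> 'k) =
      basis_vec (Arc x i j) \<otimes>\<^bsub>cyc_alg V X w\<^esub> basis_vec (Arc x ((i + j) mod length (w x)) 1)"
    unfolding basis_vec_mult[OF finite_basis B] eq by (rule refl)
qed

text \<open>A run along \<open>l'\<close> has \<open>length l' - 1\<close> arrows. If one factor
  lies a layer deeper than a run, the product lies in \<open>filtration (length l)\<close>;
  otherwise two runs are concatenated.\<close>

lemma (in cyclic_words) run_space_mult:
  assumes l: "l = l' @ [v]" "l' \<noteq> []" "2 \<le> length l'"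
    and s: "s \<in> run_space l'" and t: "t \<in> run_space [last l', v]"
    and m: "cyc_mult w s t u" "u \<in> B"
  shows "u \<in> run_space l"
proof -
  have len: "length l = Suc (length l')"
    using l by simp
  consider "s \<in> filtration (length l')" | "t \<in> filtration 2" | "s \<in> runs l'" "t \<in> runs [last l', v]"
    using s t by (auto simp: run_space_def numeral_2_eq_2)
  then show ?thesis
  proof cases
    case 1
    have "t \<in> filtration (Suc 0)"
      using run_space_filtration[of "[last l', v]"] t by auto
    then show ?thesis
      using filtration_mult[OF 1 _ m, of "Suc 0"] len by (simp add: run_space_def)
  next
    case 2
    have "s \<in> filtration (length l' - 1)"
      using run_space_filtration[OF l(3)] s by auto
    then have "u \<in> filtration (length l' - 1 + 2)"
      using 2 m by (rule filtration_mult)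
    moreover have "length l' - 1 + 2 = length l"
      using len l(3) by simp
    ultimately have "u \<in> filtration (length l)"
      by simp
    then show ?thesis
      unfolding run_space_def by blast
  next
    case 3
    obtain x i where x: "s = Arc x i (length l' - 1)" "s \<in> B"
      "\<And>m. m < length l' \<Longrightarrow> w x ! ((i + m) mod length (w x)) = l' ! m"
      using 3(1) by (auto simp: runs_def)
    obtain y j where y: "t = Arc y j 1" "t \<in> B"
      "\<And>m. m < 2 \<Longrightarrow> w y ! ((j + m) mod length (w y)) = [last l', v] ! m"
      using 3(2) by (auto simp: runs_def)
    show ?thesis
      using m(1)
    proof cases
      case (Arc j' k' x' i')
      then have eq: "x' = x" "i' = i" "j' = length l' - 1" "y = x" "j = (i + (length l' - 1)) mod length (w x)"
        "k' = 1" "u = Arc x i (length l')"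
        using x(1) y(1) l(3) by auto
      have "w x ! ((i + m) mod length (w x)) = l ! m" if "m < length l" for m
      proof (cases "m < length l'")
        case True
        then show ?thesis
          using x(3) by (simp add: l(1) nth_append)
      next
        case False
        then have m: "m = length l'"
          using that len by simp
        have "(j + 1) mod length (w x) = (i + (length l' - 1) + 1) mod length (w x)"
          unfolding eq(5) by (rule mod_add_left_eq)
        also have "i + (length l' - 1) + 1 = i + m"
          using l(3) m by simp
        finally show ?thesis
          using y(3)[of 1] eq(4) m by (simp add: l(1))
      qed
      then show ?thesis
        using eq(7) m(2) len by (auto simp: run_space_def runs_def)
    next
      case full
      then show ?thesis
        using m(2) by (auto simp: run_space_def)
    qed (use x(1) y(1) in auto)
  qed
qed

text \<open>Modulo the radical, \<open>a\<close> and \<open>c\<close> are multiples of the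
  idempotents at \<open>u\<close> and \<open>v\<close>. Multiplied with the radical element
  \<open>y\<close>, the deviations contribute only to \<open>filtration 2\<close>, which
  \<open>run_space [u, v]\<close> contains; so images of idempotents may replace the idempotents
  themselves.\<close>

lemma (in cyclic_words) run_space_pairI:
  fixes a y c :: "('x, 'v) cyc \<Rightarrow> 'k::field"
  assumes a: "\<And>v'. a (Triv v') \<noteq> 0 \<Longrightarrow> v' = u" and c: "\<And>v'. c (Triv v') \<noteq> 0 \<Longrightarrow> v' = v"
    and car: "supported B a" "supported B c" and y: "supported (filtration (Suc 0)) y"
  shows "supported (run_space [u, v]) ((a \<otimes>\<^bsub>cyc_alg V X w\<^esub> y) \<otimes>\<^bsub>cyc_alg V X w\<^esub> c)"
proof -
  \<comment> \<open>The indices of \<open>e_u r + r^2 + soc\<close>, where the left factor has been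
    taken care of.\<close>
  define S where "S = {t \<in> filtration (Suc 0). cyc_src w t = u} \<union> filtration 2"
  have Ba: "supported (insert (Triv u) (filtration (Suc 0))) a"
    using car(1) a unfolding supported_def filtration_1 by auto
  have Bc: "supported (insert (Triv v) (filtration (Suc 0))) c"
    using car(2) c unfolding supported_def filtration_1 by auto
  have "supported S (a \<otimes>\<^bsub>cyc_alg V X w\<^esub> y)"
  proof (rule supported_mult[OF Ba y])
    fix s t p assume st: "s \<in> insert (Triv u) (filtration (Suc 0))" "t \<in> filtration (Suc 0)"
      "cyc_mult w s t p" "p \<in> B"
    show "p \<in> S"
    proof (cases "s = Triv u")
      case True
      then have "p = t" "cyc_src w t = u"
        using st(2,3) by (auto elim: cyc_mult.cases)
      then show ?thesis
        using st by (simp add: S_def)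
    next
      case False
      then show ?thesis
        using st filtration_mult[of s "Suc 0" t "Suc 0" p] by (simp add: S_def numeral_2_eq_2)
    qed
  qed
  then show ?thesis
  proof (rule supported_mult[OF _ Bc])
    fix s t p assume st: "s \<in> S" "t \<in> insert (Triv v) (filtration (Suc 0))" "cyc_mult w s t p" "p \<in> B"
    have s: "s \<in> filtration (Suc 0)"
      using st(1) by (auto simp: S_def filtration_def)
    show "p \<in> run_space [u, v]"
    proof (cases "t = Triv v")
      case True
      then have p: "p = s" "cyc_tgt w s = v"
        using s st(3) by (cases s; auto elim: cyc_mult.cases)+
      show ?thesis
      proof (cases "p \<in> filtration 2")
        case False
        then obtain x i where x: "p = Arc x i 1" "cyc_src w p = u"
          using st(1,4) p s by (cases p) (auto simp: S_def)
        moreover have "w x ! ((i + m) mod length (w x)) = [u, v] ! m" if "m < 2" for m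
        proof -
          have "m = 0 \<or> m = 1"
            using that by auto
          then show ?thesis
            using x p(2) st(4) unfolding p(1)[symmetric] by auto
        qed
        ultimately show ?thesis
          using st(4) by (auto simp: run_space_def runs_def)
      qed (simp add: run_space_def numeral_2_eq_2)
    next
      case False
      then show ?thesis
        using filtration_mult[OF s _ st(3,4), of "Suc 0"] st(2) by (simp add: run_space_def)
    qed
  qed
qed

section \<open>Invariance of the socle, the filtration and the run spaces\<close>

context cyc_iso_verts
begin

lemma h_socle:
  assumes "supported (Soc ` V) f"
  shows "supported (Soc ` V') (h f)"
proof (rule B.supported_SocI)
  interpret swap: cyc_iso_verts V' X' w' V X w g h \<psi>' \<psi>
    by (rule cyc_iso_verts_swap)
  have f1: "supported (A.filtration (Suc 0)) f"
    using assms by (rule supported_mono) auto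
  then show "supported (B.filtration (Suc 0)) (h f)"
    by (rule h_radical)
  fix y :: "('y, 'u) cyc \<Rightarrow> 'k" assume y: "supported (B.filtration (Suc 0)) y"
  then have gy: "supported (A.filtration (Suc 0)) (g y)" and y_car: "y \<in> carrier CB"
    by (rule swap.h_radical, rule swap.carrier_filtration)
  have "h f \<otimes>\<^bsub>CB\<^esub> h (g y) = h (f \<otimes>\<^bsub>CA\<^esub> g y)"
    using alg_homD(2)[OF h carrier_filtration[OF f1] carrier_filtration[OF gy]] by simp
  also have "\<dots> = h (\<lambda>i. 0)"
    unfolding A.Soc_ann[OF assms gy] by (rule refl)
  also have "\<dots> = (\<lambda>i. 0)"
    using alg_homD(5)[OF h, of "\<lambda>i. 0" 0] by simp
  finally show "h f \<otimes>\<^bsub>CB\<^esub> y = (\<lambda>i. 0)"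
    unfolding hg[OF y_car] .
qed

text \<open>An \<open>Arc\<close> of length at least 2 is a shorter one times an arrow, so powers of
  the radical are respected; the \<open>Soc\<close> indices need \<open>h_socle\<close>, as they lie
  in every layer.\<close>

lemma h_filtration:
  "supported (A.filtration (Suc k)) f \<Longrightarrow> supported (B.filtration (Suc k)) (h f)"
proof (induction k arbitrary: f)
  case 0
  then show ?case
    by (rule h_radical)
next
  case (Suc k)
  show ?case
  proof (rule h_supportedI[OF A.filtration_sub _ Suc.prems])
    fix t assume t: "t \<in> A.filtration (Suc (Suc k))"
    show "supported (B.filtration (Suc (Suc k))) (h (basis_vec t))"
    proof (cases t)
      case (Arc x i j)
      then obtain j' where j: "j = Suc j'" "Suc k \<le> j'" "Arc x i (Suc j') \<in> A.B"
        using t by (cases j) auto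
      then have s: "0 < j'" "Arc x i j' \<in> A.B" "Arc x ((i + j') mod length (w x)) 1 \<in> A.B"
        using A.Arc_split[OF j(3)] by auto
      have "h (basis_vec t) = h (basis_vec (Arc x i j')) \<otimes>\<^bsub>CB\<^esub> h (basis_vec (Arc x ((i + j') mod length (w x)) 1))"
        unfolding Arc j(1) A.Arc_split(3)[OF j(3) s(1)]
        by (rule alg_homD(2)[OF h]) (use s(2,3) in \<open>auto intro!: A.basis_vec_carrier simp del: basis_alg_simps cyc_basis_simps\<close>)
      moreover have "supported (B.filtration (Suc k)) (h (basis_vec (Arc x i j')))"
        using j s by (intro Suc.IH) simp
      moreover have "supported (B.filtration (Suc 0)) (h (basis_vec (Arc x ((i + j') mod length (w x)) 1)))"
        using s by (intro h_radical) simp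
      ultimately show ?thesis
        using B.filtration_mult[of _ "Suc k" _ "Suc 0"] by (auto intro!: supported_mult simp del: basis_alg_simps)
    next
      case (Soc v)
      then have "supported (Soc ` V') (h (basis_vec t))"
        using t by (intro h_socle) auto
      then show ?thesis
        by (rule supported_mono) auto
    qed (use t in auto)
  qed
qed

text \<open>Induction on the word, removing its last letter and starting from pairs. The deeper
  layer is covered by \<open>h_filtration\<close>; a genuine run is a shorter run times an arrow,
  and the images are multiplied by \<open>B.run_space_mult\<close>.\<close>

lemma h_run_space:
  assumes "2 \<le> length l" "set l \<subseteq> V" "supported (A.run_space l) f"
  shows "supported (B.run_space (map \<psi> l)) (h f)"
  using assms
proof (induction l arbitrary: f rule: rev_induct)
  case (snoc v l)
  have long: "supported (B.run_space (map \<psi> (l @ [v]))) (h (basis_vec t))"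
    if "t \<in> A.filtration (length (l @ [v]))" for t
  proof -
    have "supported (B.filtration (Suc (length l))) (h (basis_vec t))"
      using that by (intro h_filtration) simp
    then show ?thesis
      by (rule supported_mono) (simp add: B.run_space_def)
  qed
  show ?case
  proof (rule h_supportedI[OF A.run_space_sub _ snoc.prems(3)])
    fix t assume t: "t \<in> A.run_space (l @ [v])"
    show "supported (B.run_space (map \<psi> (l @ [v]))) (h (basis_vec t))"
    proof (cases "t \<in> A.filtration (length (l @ [v]))")
      case True
      then show ?thesis
        by (rule long)
    next
      case False
      then obtain x i where x: "t = Arc x i (length l)" "t \<in> A.B"
        "\<And>m. m < Suc (length l) \<Longrightarrow> w x ! ((i + m) mod length (w x)) = (l @ [v]) ! m"
        using t by (auto simp: A.run_space_def A.runs_def)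
      \<comment> \<open>An arrow \<open>s\<close> from \<open>a\<close> to \<open>b\<close>
        satisfies \<open>s = e_a s e_b\<close>. The image of \<open>e_c\<close> has its only
        coefficient among the \<open>Triv\<close> indices at \<open>\<psi> c\<close>, so
        \<open>B.run_space_pairI\<close> applies to the image of this product.\<close>
      have pair: "supported (B.run_space [\<psi> a, \<psi> b]) (h (basis_vec s))"
        if s: "s \<in> A.B" "s = Arc y j 1" "cyc_src w s = a" "cyc_tgt w s = b" for s y j a b
      proof -
        have V: "a \<in> V" "b \<in> V"
          using A.cyc_src_in[OF s(1)] A.cyc_src_in[OF cyc_bar_basis[OF s(1)]] s(3,4) by simp_all
        let ?a = "basis_vec (Triv a) :: ('x, 'v) cyc \<Rightarrow> 'k" and ?b = "basis_vec (Triv b) :: ('x, 'v) cyc \<Rightarrow> 'k"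
          and ?s = "basis_vec s :: ('x, 'v) cyc \<Rightarrow> 'k"
        have B: "Triv a \<in> A.B" "Triv b \<in> A.B"
          using V by auto
        have as: "?a \<otimes>\<^bsub>CA\<^esub> ?s = ?s"
          unfolding basis_vec_mult[OF A.finite_basis B(1) s(1)]
          using cyc_mult.Triv_left[of w s] A.cyc_mult_unique[OF B(1) s(1)] s
          by (auto simp: fun_eq_iff basis_vec_def simp del: cyc_basis_simps)
        have sb: "?s \<otimes>\<^bsub>CA\<^esub> ?b = ?s"
          unfolding basis_vec_mult[OF A.finite_basis s(1) B(2)]
          using cyc_mult.Triv_right[of w s] A.cyc_mult_unique[OF s(1) B(2)] s
          by (auto simp: fun_eq_iff basis_vec_def simp del: cyc_basis_simps)
        note car = B(1)[THEN A.basis_vec_carrier] s(1)[THEN A.basis_vec_carrier] B(2)[THEN A.basis_vec_carrier]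
        have hb: "h ?s = h ?s \<otimes>\<^bsub>CB\<^esub> h ?b"
          unfolding alg_homD(2)[OF h car(2,3), symmetric] sb by (rule refl)
        have ha: "h ?s = h ?a \<otimes>\<^bsub>CB\<^esub> h ?s"
          unfolding alg_homD(2)[OF h car(1,2), symmetric] as by (rule refl)
        have hs: "h ?s = (h ?a \<otimes>\<^bsub>CB\<^esub> h ?s) \<otimes>\<^bsub>CB\<^esub> h ?b"
          unfolding ha[symmetric] by (rule hb)
        have triv: "v' = \<psi> c" if "h (basis_vec (Triv c)) (Triv v') \<noteq> 0" "c \<in> V" for v' c
        proof -
          have e: "basis_vec (Triv c) \<in> carrier CA"
            using that(2) by (intro A.basis_vec_carrier) simp
          have "Triv v' \<in> B.B"
            using alg_homD(1)[OF h e] that(1) unfolding basis_alg_simps(1) by blast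
          then have "v' \<in> V'"
            by simp
          then have "h (basis_vec (Triv c)) (Triv v') = basis_vec (Triv c) (Triv (\<psi>' v') :: ('x, 'v) cyc)"
            using h_Triv[OF \<psi>(2) e, of v'] \<psi>_inverse(2) by simp
          then show ?thesis
            using that(1) \<psi>_inverse(2)[OF \<open>v' \<in> V'\<close>] by (auto simp: basis_vec_def split: if_splits)
        qed
        show ?thesis
        proof (subst hs, rule B.run_space_pairI)
          show "supported B.B (h ?a)" "supported B.B (h ?b)"
            using alg_homD(1)[OF h car(1)] alg_homD(1)[OF h car(3)] by (simp_all only: cyc_alg_carrier)
          show "supported (B.filtration (Suc 0)) (h ?s)"
            using s by (intro h_radical) simp
        qed (use triv V in auto)
      qed
      show ?thesis
      proof (cases "length l = 1")
        case True
        then obtain a where l: "l = [a]"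
          by (auto simp: length_Suc_conv)
        have "cyc_src w t = a" "cyc_tgt w t = v"
          using x(1,2) x(3)[of 0] x(3)[of 1] l by auto
        then show ?thesis
          using pair[OF x(2)] x(1) True l by simp
      next
        case False
        then have len: "2 \<le> length l"
          using snoc.prems(1) by simp
        define j where "j = length l - 1"
        have j: "length l = Suc j" "0 < j"
          using len by (auto simp: j_def)
        have t_eq: "t = Arc x i (Suc j)" "Arc x i (Suc j) \<in> A.B"
          using x(1,2) j by auto
        note split = A.Arc_split[OF t_eq(2) j(2)]
        let ?s = "Arc x i j" and ?r = "Arc x ((i + j) mod length (w x)) 1"
        have "h (basis_vec t) = h (basis_vec ?s) \<otimes>\<^bsub>CB\<^esub> h (basis_vec ?r)"
          unfolding t_eq(1) split(3) by (rule alg_homD(2)[OF h split(1,2)[THEN A.basis_vec_carrier]])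
        moreover have "supported (B.run_space (map \<psi> l)) (h (basis_vec ?s))"
        proof (rule snoc.IH[OF len])
          have "w x ! ((i + m) mod length (w x)) = l ! m" if "m < length l" for m
            using x(3)[of m] that by (simp add: nth_append)
          then have "?s \<in> A.runs l"
            using split(1) j by (auto simp: A.runs_def simp del: cyc_basis_simps)
          then show "supported (A.run_space l) (basis_vec ?s)"
            by (simp add: A.run_space_def)
        qed (use snoc.prems in auto)
        moreover have "supported (B.run_space [last (map \<psi> l), \<psi> v]) (h (basis_vec ?r))"
        proof -
          have "cyc_src w ?r = last l"
            using x(3)[of j] j last_conv_nth[of l] by (cases "l = []") (auto simp: nth_append)
          moreover have "cyc_tgt w ?r = v"
            using x(3)[of "Suc j"] j by (simp add: nth_append mod_simps)
          moreover have "last (map \<psi> l) = \<psi> (last l)"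
            using j by (cases "l = []") (auto simp: last_map)
          ultimately show ?thesis
            using pair[OF split(2)] by simp
        qed
        moreover have "l \<noteq> []"
          using j by auto
        ultimately show ?thesis
          using B.run_space_mult[of "map \<psi> (l @ [v])" "map \<psi> l" "\<psi> v"] len
          by (auto intro!: supported_mult simp del: basis_alg_simps)
      qed
    qed
  qed
qed simp

lemma card_filtration_le: "card (A.filtration (Suc k)) \<le> card (B.filtration (Suc k))"
  using A.filtration_sub B.filtration_sub h_filtration by (rule card_le)

lemma card_run_space_le:
  "2 \<le> length l \<Longrightarrow> set l \<subseteq> V \<Longrightarrow> card (A.run_space l) \<le> card (B.run_space (map \<psi> l))"
  using A.run_space_sub B.run_space_sub h_run_space by (rule card_le)

end

lemma (in cyclic_words) card_run_space: "card (run_space l) = card (runs l) + card (filtration (length l))"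
  unfolding run_space_def
proof (rule card_Un_disjoint)
  show "finite (runs l)" "finite (filtration (length l))"
    using finite_basis filtration_sub by (auto simp: runs_def intro: finite_subset)
  show "runs l \<inter> filtration (length l) = {}"
    by (auto simp: runs_def)
qed

text \<open>By \<open>card_run_space\<close> the number of runs is a difference of two dimensions,
  and each is invariant by the inequality for \<open>h\<close> together with the one for its
  inverse.\<close>

lemma (in cyc_iso_verts) card_runs:
  assumes "2 \<le> length l" "set l \<subseteq> V"
  shows "card (A.runs l) = card (B.runs (map \<psi> l))"
proof -
  interpret swap: cyc_iso_verts V' X' w' V X w g h \<psi>' \<psi>
    by (rule cyc_iso_verts_swap)
  have "map \<psi>' (map \<psi> l) = l" "set (map \<psi> l) \<subseteq> V'"
    using assms(2) \<psi> \<psi>_inverse by (auto intro!: map_idI)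
  then have "card (B.run_space (map \<psi> l)) = card (A.run_space l)"
    using card_run_space_le[OF assms] swap.card_run_space_le[of "map \<psi> l"] assms(1) by simp
  moreover obtain k where "length l = Suc k"
    using assms(1) by (cases l) auto
  then have "card (B.filtration (length l)) = card (A.filtration (length l))"
    using card_filtration_le[of k] swap.card_filtration_le[of k] by simp
  ultimately show ?thesis
    using A.card_run_space[of l] B.card_run_space[of "map \<psi> l"] by simp
qed

section \<open>Counting cyclic words\<close>

lemma rotate_complement: "rotate (length xs - n mod length xs) (rotate n xs) = xs"
proof (cases "xs = []")
  case False
  then have "(length xs - n mod length xs + n) mod length xs = 0"
    by (metis le_add_diff_inverse2 length_greater_0_conv mod_add_right_eq mod_le_divisor mod_self)
  then show ?thesis
    by (metis rotate_rotate rotate_conv_mod rotate0 id_apply)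
qed simp

lemma rotations_rotate [simp]: "rotations (rotate n xs) = rotations xs"
proof
  show "rotations (rotate n xs) \<subseteq> rotations xs"
    by (auto simp: rotations_def rotate_rotate)
  have "rotate m xs = rotate (m + (length xs - n mod length xs)) (rotate n xs)" for m
    by (simp only: rotate_rotate[symmetric] rotate_complement)
  then show "rotations xs \<subseteq> rotations (rotate n xs)"
    unfolding rotations_def by blast
qed

lemma self_in_rotations: "xs \<in> rotations xs"
  unfolding rotations_def by (rule range_eqI[of _ _ 0]) simp

lemma rotations_eq_ex: "rotations xs = rotations ys \<Longrightarrow> \<exists>n. xs = rotate n ys"
  using self_in_rotations[of xs] unfolding rotations_def by blast

lemma map_rotations: "map f ` rotations xs = rotations (map f xs)"
  by (auto simp: rotations_def rotate_map)

lemma rotations_length: "rotations xs = rotations ys \<Longrightarrow> length xs = length ys"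
  by (auto dest!: rotations_eq_ex)

lemma rotations_count_list: "rotations xs = rotations ys \<Longrightarrow> count_list xs a = count_list ys a"
proof -
  have "mset (rotate n ys) = mset ys" for n
  proof -
    have "mset (rotate n ys) = mset (drop (n mod length ys) ys @ take (n mod length ys) ys)"
      by (simp add: rotate_drop_take)
    also have "\<dots> = mset (take (n mod length ys) ys @ drop (n mod length ys) ys)"
      by (simp only: mset_append add.commute)
    finally show ?thesis
      by simp
  qed
  then have "count_list (rotate n ys) a = count_list ys a" for n
    by (simp flip: count_mset)
  then show "rotations xs = rotations ys \<Longrightarrow> count_list xs a = count_list ys a"
    by (auto dest!: rotations_eq_ex)
qed

text \<open>Each start position on the cycle is counted once and at most one turn is read; a word
  \<open>l\<close> longer than \<open>u\<close> has no occurrence.\<close>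

definition cyc_occ :: "'a list \<Rightarrow> 'a list \<Rightarrow> nat"
  where "cyc_occ u l = card {i. i < length u \<and> take (length l) (rotate i u) = l}"

lemma cyc_occ_rotate: "cyc_occ (rotate n u) l = cyc_occ u l"
proof (cases "u = []")
  case False
  let ?L = "length u"
  have L: "0 < ?L"
    using False by simp
  \<comment> \<open>\<open>?g\<close> shifts backwards; it adds the complement of
    \<open>n mod ?L\<close> in order to avoid truncated subtraction.\<close>
  let ?f = "\<lambda>i. (i + n) mod ?L" and ?g = "\<lambda>i. (i + (?L - n mod ?L)) mod ?L"
  have rot: "rotate (?f i) u = rotate i (rotate n u)" for i
    by (metis rotate_rotate rotate_conv_mod)
  have rot': "rotate (?g i) (rotate n u) = rotate i u" for i
    by (metis rotate_rotate rotate_conv_mod length_rotate rotate_complement)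
  have "?g (?f i) = i \<and> ?f (?g i) = i" if "i < ?L" for i
  proof -
    have "i + n + (?L - n mod ?L) = i + (n - n mod ?L) + ?L"
      using mod_le_divisor[OF L, of n] mod_less_eq_dividend[of n ?L] by linarith
    then have "(i + n + (?L - n mod ?L)) mod ?L = (i + (n - n mod ?L) + ?L) mod ?L"
      by (simp only:)
    also have "\<dots> = i"
      using that by (simp add: minus_mod_eq_mult_div)
    finally have "(i + n + (?L - n mod ?L)) mod ?L = i" .
    moreover have "?g (?f i) = (i + n + (?L - n mod ?L)) mod ?L"
      by (rule mod_add_left_eq)
    moreover have "?f (?g i) = (i + (?L - n mod ?L) + n) mod ?L"
      by (rule mod_add_left_eq)
    ultimately show ?thesis
      by (simp add: add.commute add.left_commute add.assoc)
  qed
  then have "bij_betw ?f {i. i < length (rotate n u) \<and> take (length l) (rotate i (rotate n u)) = l}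
      {i. i < ?L \<and> take (length l) (rotate i u) = l}"
    using L rot rot' by (intro bij_betwI[where g = ?g]) auto
  then show ?thesis
    unfolding cyc_occ_def by (rule bij_betw_same_card)
qed simp

lemma rotations_cyc_occ: "rotations u = rotations u' \<Longrightarrow> cyc_occ u l = cyc_occ u' l"
  using rotations_eq_ex[of u u'] by (auto simp: cyc_occ_rotate)

lemma cyc_occ_eq_0:
  assumes "length u = length l" "rotations u \<noteq> rotations l"
  shows "cyc_occ u l = 0"
proof -
  have "rotations u = rotations l" if "rotate i u = l" for i
    using that by (metis rotations_rotate)
  then have "{i. i < length u \<and> take (length l) (rotate i u) = l} = {}"
    using assms by auto
  then show ?thesis
    unfolding cyc_occ_def by (simp only: card.empty)
qed

text \<open>For a periodic word the number exceeds 1; being positive, it can be cancelled in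
  \<open>card_rotation_class_eq\<close>.\<close>

lemma cyc_occ_self: "l \<noteq> [] \<Longrightarrow> 0 < cyc_occ l l"
proof -
  assume "l \<noteq> []"
  then have "0 \<in> {i. i < length l \<and> take (length l) (rotate i l) = l}"
    by simp
  then show ?thesis
    unfolding cyc_occ_def by (subst card_gt_0_iff) auto
qed

lemma bij_of_card_fibers:
  assumes "finite S" "finite S'" "\<And>c. card {x \<in> S. f x = c} = card {x \<in> S'. f' x = c}"
  obtains \<phi> where "bij_betw \<phi> S S'" "\<And>x. x \<in> S \<Longrightarrow> f' (\<phi> x) = f x"
proof -
  have "\<exists>h. bij_betw h {x \<in> S. f x = c} {x \<in> S'. f' x = c}" for c
    using assms by (intro finite_same_card_bij) auto
  then obtain h where h: "\<And>c. bij_betw (h c) {x \<in> S. f x = c} {x \<in> S'. f' x = c}"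
    by metis
  define \<phi> where "\<phi> x = h (f x) x" for x
  have \<phi>: "\<phi> x \<in> S'" "f' (\<phi> x) = f x" if "x \<in> S" for x
    using bij_betwE[OF h[of "f x"]] that by (auto simp: \<phi>_def)
  moreover have "inj_on \<phi> S"
  proof (rule inj_onI)
    fix x y assume xy: "x \<in> S" "y \<in> S" "\<phi> x = \<phi> y"
    then have "f x = f y"
      using \<phi>(2) by metis
    then show "x = y"
      using bij_betw_imp_inj_on[OF h[of "f x"]] xy by (auto simp: \<phi>_def dest: inj_onD)
  qed
  moreover have "S' \<subseteq> \<phi> ` S"
  proof
    fix y assume "y \<in> S'"
    then obtain x where "x \<in> S" "f x = f' y" "y = h (f' y) x"
      using bij_betw_imp_surj_on[OF h[of "f' y"]] by (auto simp: image_def set_eq_iff)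
    then show "y \<in> \<phi> ` S"
      by (intro image_eqI[of _ _ x]) (simp_all add: \<phi>_def)
  qed
  ultimately show ?thesis
    by (intro that[of \<phi>]) (auto simp: bij_betw_def)
qed

text \<open>
  Words longer than \<open>l\<close> contribute equally to both sums by the induction hypothesis, and words of the
  same length contribute only if they are rotations of \<open>l\<close>.
\<close>

lemma card_rotation_class_eq:
  fixes u :: "'x \<Rightarrow> 'a list" and u' :: "'y \<Rightarrow> 'a list"
  assumes fin: "finite X" "finite X'"
    and occ: "\<And>l. 2 \<le> length l \<Longrightarrow> (\<Sum>x | x \<in> X \<and> length l \<le> length (u x). cyc_occ (u x) l) =
      (\<Sum>x | x \<in> X' \<and> length l \<le> length (u' x). cyc_occ (u' x) l)"
    and "2 \<le> length l"
  shows "card {x \<in> X. rotations (u x) = rotations l} = card {x \<in> X'. rotations (u' x) = rotations l}"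
proof -
  \<comment> \<open>\<open>N\<close> exceeds the lengths of all words, which turns the descending
    induction on \<open>length l\<close> into induction on \<open>N - length l\<close>.\<close>
  define N where "N = Suc (Max (insert 0 ((\<lambda>x. length (u x)) ` X \<union> (\<lambda>x. length (u' x)) ` X')))"
  have N: "length (u x) < N" if "x \<in> X" for x
    using fin that unfolding N_def less_Suc_eq_le by (intro Max_ge) auto
  have N': "length (u' x) < N" if "x \<in> X'" for x
    using fin that unfolding N_def less_Suc_eq_le by (intro Max_ge) auto
  show ?thesis
    using assms(4)
  proof (induction "N - length l" arbitrary: l rule: less_induct)
    case less
    define S where "S = {x \<in> X. length l < length (u x)}"
    define S' where "S' = {x \<in> X'. length l < length (u' x)}"
    have fibers: "card {x \<in> S. rotations (u x) = c} = card {x \<in> S'. rotations (u' x) = c}" for c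
    proof (cases "\<exists>m. c = rotations m \<and> length l < length m \<and> length m < N")
      case True
      then obtain m where m: "c = rotations m" "length l < length m" "length m < N"
        by blast
      have "{x \<in> S. rotations (u x) = c} = {x \<in> X. rotations (u x) = rotations m}"
        "{x \<in> S'. rotations (u' x) = c} = {x \<in> X'. rotations (u' x) = rotations m}"
        using m(2) unfolding S_def S'_def m(1) by (auto dest: rotations_length)
      then show ?thesis
        using less.hyps[of m] m less.prems by simp
    next
      case False
      have "{x \<in> S. rotations (u x) = c} = {}" "{x \<in> S'. rotations (u' x) = c} = {}"
        using False N N' unfolding S_def S'_def by blast+
      then show ?thesis
        by (simp only: card.empty)
    qed
    have finS: "finite S" "finite S'"
      using fin by (auto simp: S_def S'_def)
    obtain \<phi> where \<phi>: "bij_betw \<phi> S S'" "\<And>x. x \<in> S \<Longrightarrow> rotations (u' (\<phi> x)) = rotations (u x)"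
      using bij_of_card_fibers[OF finS fibers] by blast
    have long: "(\<Sum>x\<in>S. cyc_occ (u x) l) = (\<Sum>x\<in>S'. cyc_occ (u' x) l)"
      using sum.reindex_bij_betw[OF \<phi>(1), of "\<lambda>x. cyc_occ (u' x) l"] rotations_cyc_occ[OF \<phi>(2), of _ l] by simp
    have split: "(\<Sum>x | x \<in> Y \<and> length l \<le> length (v x). cyc_occ (v x) l) =
        (\<Sum>x | x \<in> Y \<and> length l < length (v x). cyc_occ (v x) l) +
        card {x \<in> Y. rotations (v x) = rotations l} * cyc_occ l l"
      if "finite Y" for Y :: "'z set" and v :: "'z \<Rightarrow> 'a list"
    proof -
      have "{x. x \<in> Y \<and> length l \<le> length (v x)} =
          {x. x \<in> Y \<and> length l < length (v x)} \<union> {x. x \<in> Y \<and> length (v x) = length l}"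
        by auto
      then have "(\<Sum>x | x \<in> Y \<and> length l \<le> length (v x). cyc_occ (v x) l) =
          (\<Sum>x | x \<in> Y \<and> length l < length (v x). cyc_occ (v x) l) +
          (\<Sum>x | x \<in> Y \<and> length (v x) = length l. cyc_occ (v x) l)"
        using that by (simp only:) (rule sum.union_disjoint; auto)
      also have "(\<Sum>x | x \<in> Y \<and> length (v x) = length l. cyc_occ (v x) l) =
          (\<Sum>x | x \<in> Y \<and> rotations (v x) = rotations l. cyc_occ l l)"
      proof (rule sum.mono_neutral_cong_right)
        show "{x. x \<in> Y \<and> rotations (v x) = rotations l} \<subseteq> {x. x \<in> Y \<and> length (v x) = length l}"
          using rotations_length by blast
      next
        show "\<forall>x \<in> {x. x \<in> Y \<and> length (v x) = length l} - {x. x \<in> Y \<and> rotations (v x) = rotations l}.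
            cyc_occ (v x) l = 0"
          by (intro ballI cyc_occ_eq_0) simp_all
        show "cyc_occ (v x) l = cyc_occ l l" if "x \<in> {x. x \<in> Y \<and> rotations (v x) = rotations l}" for x
          using that by (intro rotations_cyc_occ) simp
      qed (use that in simp)
      finally show ?thesis
        by (simp only: sum_constant of_nat_id)
    qed
    have "card {x \<in> X. rotations (u x) = rotations l} * cyc_occ l l =
        card {x \<in> X'. rotations (u' x) = rotations l} * cyc_occ l l"
      using occ[OF less.prems] long unfolding split[OF fin(1)] split[OF fin(2)] S_def S'_def by linarith
    moreover have "0 < cyc_occ l l"
      using less.prems by (intro cyc_occ_self) auto
    ultimately show ?case
      by simp
  qed
qed

lemma cyclic_words_determined:
  fixes u :: "'x \<Rightarrow> 'a list" and u' :: "'y \<Rightarrow> 'a list"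
  assumes fin: "finite X" "finite X'"
    and occ: "\<And>l. 2 \<le> length l \<Longrightarrow> (\<Sum>x | x \<in> X \<and> length l \<le> length (u x). cyc_occ (u x) l) =
      (\<Sum>x | x \<in> X' \<and> length l \<le> length (u' x). cyc_occ (u' x) l)"
  obtains \<phi> where "bij_betw \<phi> {x \<in> X. 2 \<le> length (u x)} {x \<in> X'. 2 \<le> length (u' x)}"
    "\<And>x. x \<in> X \<Longrightarrow> 2 \<le> length (u x) \<Longrightarrow> rotations (u' (\<phi> x)) = rotations (u x)"
proof -
  let ?S = "{x \<in> X. 2 \<le> length (u x)}" and ?S' = "{x \<in> X'. 2 \<le> length (u' x)}"
  have fibers: "card {x \<in> ?S. rotations (u x) = c} = card {x \<in> ?S'. rotations (u' x) = c}" for c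
  proof (cases "\<exists>m. c = rotations m \<and> 2 \<le> length m")
    case True
    then obtain m where m: "c = rotations m" "2 \<le> length m"
      by blast
    have "{x \<in> ?S. rotations (u x) = c} = {x \<in> X. rotations (u x) = rotations m}"
      "{x \<in> ?S'. rotations (u' x) = c} = {x \<in> X'. rotations (u' x) = rotations m}"
      using m(2) unfolding m(1) by (auto dest: rotations_length)
    then show ?thesis
      using card_rotation_class_eq[OF fin occ m(2)] by simp
  next
    case False
    have "{x \<in> ?S. rotations (u x) = c} = {}" "{x \<in> ?S'. rotations (u' x) = c} = {}"
      using False by blast+
    then show ?thesis
      by (simp only: card.empty)
  qed
  have "finite ?S" "finite ?S'"
    using fin by auto
  then obtain \<phi> where "bij_betw \<phi> ?S ?S'" "\<And>x. x \<in> ?S \<Longrightarrow> rotations (u' (\<phi> x)) = rotations (u x)"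
    using bij_of_card_fibers[OF _ _ fibers] by blast
  then show ?thesis
    by (intro that[of \<phi>]) auto
qed

section \<open>Isomorphic hypergraphs have isomorphic algebras\<close>

text \<open>\<open>r x\<close> is the offset at which the word of \<open>x\<close>, relabelled by
  \<open>\<psi>\<close>, is read on the cycle of \<open>\<phi> x\<close>.\<close>

definition cyc_map :: "('v \<Rightarrow> 'u) \<Rightarrow> ('x \<Rightarrow> 'y) \<Rightarrow> ('x \<Rightarrow> nat) \<Rightarrow> ('y \<Rightarrow> 'u list) \<Rightarrow> ('x, 'v) cyc \<Rightarrow> ('y, 'u) cyc"
  where "cyc_map \<psi> \<phi> r w' t = (case t of Triv v \<Rightarrow> Triv (\<psi> v) | Soc v \<Rightarrow> Soc (\<psi> v)
    | Arc x i j \<Rightarrow> Arc (\<phi> x) ((r x + i) mod length (w' (\<phi> x))) j)"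

lemma cyc_map_simps [simp]:
  "cyc_map \<psi> \<phi> r w' (Triv v) = Triv (\<psi> v)"
  "cyc_map \<psi> \<phi> r w' (Soc v) = Soc (\<psi> v)"
  "cyc_map \<psi> \<phi> r w' (Arc x i j) = Arc (\<phi> x) ((r x + i) mod length (w' (\<phi> x))) j"
  by (simp_all add: cyc_map_def)

definition word_shift :: "'x set \<Rightarrow> ('x \<Rightarrow> 'v list) \<Rightarrow> 'y set \<Rightarrow> ('y \<Rightarrow> 'u list) \<Rightarrow>
    ('v \<Rightarrow> 'u) \<Rightarrow> ('x \<Rightarrow> 'y) \<Rightarrow> ('x \<Rightarrow> nat) \<Rightarrow> bool"
  where "word_shift X w X' w' \<psi> \<phi> r \<longleftrightarrow>
    (\<forall>x \<in> X. \<phi> x \<in> X' \<and> map \<psi> (w x) = rotate (r x) (w' (\<phi> x)))"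

lemma word_shiftD:
  assumes "word_shift X w X' w' \<psi> \<phi> r" "x \<in> X"
  shows "\<phi> x \<in> X'" "length (w' (\<phi> x)) = length (w x)"
    and "i < length (w x) \<Longrightarrow> w' (\<phi> x) ! ((r x + i) mod length (w x)) = \<psi> (w x ! i)"
proof -
  have eq: "map \<psi> (w x) = rotate (r x) (w' (\<phi> x))"
    using assms by (simp add: word_shift_def)
  show "\<phi> x \<in> X'"
    using assms by (simp add: word_shift_def)
  show len: "length (w' (\<phi> x)) = length (w x)"
    using arg_cong[OF eq, of length] by simp
  show "w' (\<phi> x) ! ((r x + i) mod length (w x)) = \<psi> (w x ! i)" if "i < length (w x)"
    using arg_cong[OF eq, of "\<lambda>xs. xs ! i"] that len by (simp add: nth_rotate)
qed

lemma cyc_map_basis: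
  assumes "word_shift X w X' w' \<psi> \<phi> r" "\<psi> ` V \<subseteq> V'" "t \<in> cyc_basis V X w"
  shows "cyc_map \<psi> \<phi> r w' t \<in> cyc_basis V' X' w'"
proof (cases t)
  case (Arc x i j)
  then show ?thesis
    using word_shiftD[OF assms(1), of x] assms(3) by (auto intro!: mod_less_divisor)
qed (use assms in auto)

lemma cyc_map_src:
  assumes "word_shift X w X' w' \<psi> \<phi> r" "t \<in> cyc_basis V X w"
  shows "cyc_src w' (cyc_map \<psi> \<phi> r w' t) = \<psi> (cyc_src w t)"
proof (cases t)
  case (Arc x i j)
  then show ?thesis
    using word_shiftD[OF assms(1), of x] assms(2) by simp
qed auto

lemma cyc_map_bar:
  assumes "word_shift X w X' w' \<psi> \<phi> r" "t \<in> cyc_basis V X w"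
  shows "cyc_bar w' (cyc_map \<psi> \<phi> r w' t) = cyc_map \<psi> \<phi> r w' (cyc_bar w t)"
proof (cases t)
  case (Arc x i j)
  then show ?thesis
    using word_shiftD(2)[OF assms(1), of x] assms(2) by (simp add: mod_simps add.assoc)
qed auto

lemma cyc_map_mult:
  assumes shift: "word_shift X w X' w' \<psi> \<phi> r"
    and B: "s \<in> cyc_basis V X w" "t \<in> cyc_basis V X w" and m: "cyc_mult w s t u"
  shows "cyc_mult w' (cyc_map \<psi> \<phi> r w' s) (cyc_map \<psi> \<phi> r w' t) (cyc_map \<psi> \<phi> r w' u)"
  using m
proof cases
  case Triv_left
  then show ?thesis
    using cyc_mult.Triv_left[of w' "cyc_map \<psi> \<phi> r w' t"] cyc_map_src[OF shift B(2)] by simp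
next
  case Triv_right
  then show ?thesis
    using cyc_mult.Triv_right[of w' "cyc_map \<psi> \<phi> r w' s"]
      cyc_map_src[OF shift cyc_bar_basis[OF B(1)]] cyc_map_bar[OF shift B(1)] by simp
next
  case full
  then show ?thesis
    using cyc_mult.full[of w' "cyc_map \<psi> \<phi> r w' s"] cyc_map_src[OF shift B(1)] cyc_map_bar[OF shift B(1)]
    by simp
next
  case (Arc j k x i)
  then have "x \<in> X"
    using B(1) by simp
  then have len: "length (w' (\<phi> x)) = length (w x)"
    by (rule word_shiftD(2)[OF shift])
  then show ?thesis
    using cyc_mult.Arc[of j k w' "\<phi> x" "(r x + i) mod length (w x)"] Arc
    by (simp add: mod_simps add.assoc)
qed

lemma cyc_map_inverse:
  assumes "t \<in> cyc_basis V X w" "word_shift X w X' w' \<psi> \<phi> r" "word_shift X' w' X w \<psi>' \<phi>' r'"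
    and "\<And>v. v \<in> V \<Longrightarrow> \<psi>' (\<psi> v) = v" "\<And>x. x \<in> X \<Longrightarrow> \<phi>' (\<phi> x) = x"
    and "\<And>x. x \<in> X \<Longrightarrow> w x \<noteq> [] \<Longrightarrow> (r' (\<phi> x) + r x) mod length (w x) = 0"
  shows "cyc_map \<psi>' \<phi>' r' w (cyc_map \<psi> \<phi> r w' t) = t"
proof (cases t)
  case (Arc x i j)
  then have x: "x \<in> X" "i < length (w x)"
    using assms(1) by auto
  then have len: "length (w' (\<phi> x)) = length (w x)"
    using word_shiftD(2)[OF assms(2)] by blast
  have "(r' (\<phi> x) + (r x + i) mod length (w x)) mod length (w x) = (r' (\<phi> x) + r x + i) mod length (w x)"
    by (simp add: mod_simps add.assoc)
  also have "\<dots> = ((r' (\<phi> x) + r x) mod length (w x) + i) mod length (w x)"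
    by (rule mod_add_left_eq[symmetric])
  also have "\<dots> = i"
    using assms(6)[of x] x by (cases "w x = []") auto
  finally show ?thesis
    using Arc assms(5)[OF x(1)] len by simp
qed (use assms(1,4) in auto)

lemma cyc_alg_iso:
  fixes w :: "'x \<Rightarrow> 'v list" and w' :: "'y \<Rightarrow> 'u list"
  assumes \<psi>: "bij_betw \<psi> V V'" and \<phi>: "bij_betw \<phi> X X'"
    and words: "\<And>x. x \<in> X \<Longrightarrow> set (w x) \<subseteq> V"
    and rot: "\<And>x. x \<in> X \<Longrightarrow> rotations (map \<psi> (w x)) = rotations (w' (\<phi> x))"
  shows "(cyc_alg V X w :: ('k::field, ('x, 'v) cyc \<Rightarrow> 'k) module) \<simeq>\<^sub>K cyc_alg V' X' w'"
proof -
  have "\<exists>n. map \<psi> (w x) = rotate n (w' (\<phi> x))" if "x \<in> X" for x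
    using rot[OF that] by (rule rotations_eq_ex)
  then obtain r where r: "\<And>x. x \<in> X \<Longrightarrow> map \<psi> (w x) = rotate (r x) (w' (\<phi> x))"
    by metis
  define \<psi>' where "\<psi>' = inv_into V \<psi>"
  define \<phi>' where "\<phi>' = inv_into X \<phi>"
  \<comment> \<open>The opposite offset, for the map in the other direction.\<close>
  define r' where "r' y = length (w' y) - r (\<phi>' y) mod length (w' y)" for y
  have \<psi>': "\<psi>' (\<psi> v) = v" if "v \<in> V" for v
    using bij_betw_inv_into_left[OF \<psi> that] by (simp add: \<psi>'_def)
  have \<psi>'_V: "v \<in> V' \<Longrightarrow> \<psi> (\<psi>' v) = v" "v \<in> V' \<Longrightarrow> \<psi>' v \<in> V" for v
    using bij_betw_inv_into_right[OF \<psi>, of v] bij_betwE[OF bij_betw_inv_into[OF \<psi>]] by (simp_all add: \<psi>'_def)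
  have \<phi>': "\<phi>' (\<phi> x) = x" if "x \<in> X" for x
    using bij_betw_inv_into_left[OF \<phi> that] by (simp add: \<phi>'_def)
  have \<phi>'_X: "y \<in> X' \<Longrightarrow> \<phi> (\<phi>' y) = y" "y \<in> X' \<Longrightarrow> \<phi>' y \<in> X" for y
    using bij_betw_inv_into_right[OF \<phi>, of y] bij_betwE[OF bij_betw_inv_into[OF \<phi>]] by (simp_all add: \<phi>'_def)
  have shift: "word_shift X w X' w' \<psi> \<phi> r"
    using r bij_betwE[OF \<phi>] by (simp add: word_shift_def)
  have shift': "word_shift X' w' X w \<psi>' \<phi>' r'"
    unfolding word_shift_def
  proof (intro ballI conjI)
    fix y assume y: "y \<in> X'"
    show x: "\<phi>' y \<in> X"
      using \<phi>'_X(2)[OF y] .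
    have eq: "map \<psi> (w (\<phi>' y)) = rotate (r (\<phi>' y)) (w' y)"
      using r[OF x] \<phi>'_X(1)[OF y] by simp
    have "map \<psi>' (map \<psi> (w (\<phi>' y))) = w (\<phi>' y)"
      using words[OF x] \<psi>' by (auto intro!: map_idI)
    then have "w (\<phi>' y) = rotate (r (\<phi>' y)) (map \<psi>' (w' y))"
      unfolding eq by (simp add: rotate_map)
    then show "map \<psi>' (w' y) = rotate (r' y) (w (\<phi>' y))"
      using rotate_complement[of "map \<psi>' (w' y)" "r (\<phi>' y)"] by (simp add: r'_def)
  qed
  have zero: "(r' (\<phi> x) + r x) mod length (w x) = 0" if "x \<in> X" and False: "w x \<noteq> []" for x
  proof -
    let ?L = "length (w x)"
    have "r' (\<phi> x) = ?L - r x mod ?L"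
      using \<phi>'[OF that(1)] word_shiftD(2)[OF shift that(1)] by (simp add: r'_def)
    then have "(r' (\<phi> x) + r x) mod ?L = (?L - r x mod ?L + r x mod ?L) mod ?L"
      by (simp add: mod_simps)
    also have "?L - r x mod ?L + r x mod ?L = ?L"
      using False by (intro le_add_diff_inverse2 mod_le_divisor) simp
    finally show ?thesis
      by simp
  qed
  let ?h = "cyc_map \<psi> \<phi> r w'" and ?g = "cyc_map \<psi>' \<phi>' r' w"
  have hB: "?h t \<in> cyc_basis V' X' w'" if "t \<in> cyc_basis V X w" for t
    using cyc_map_basis[OF shift _ that, of V'] bij_betwE[OF \<psi>] by blast
  have gB: "?g t \<in> cyc_basis V X w" if "t \<in> cyc_basis V' X' w'" for t
    using cyc_map_basis[OF shift' _ that, of V] \<psi>'_V(2) by blast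
  have gh: "?g (?h t) = t" if "t \<in> cyc_basis V X w" for t
    using that shift shift' \<psi>' \<phi>' zero by (rule cyc_map_inverse)
  have hg: "?h (?g t) = t" if "t \<in> cyc_basis V' X' w'" for t
    using that shift' shift \<psi>'_V(1) \<phi>'_X(1)
  proof (rule cyc_map_inverse)
    fix y assume y: "y \<in> X'" "w' y \<noteq> []"
    then have "w (\<phi>' y) \<noteq> []"
      using word_shiftD(2)[OF shift' y(1)] by auto
    then show "(r (\<phi>' y) + r' y) mod length (w' y) = 0"
      using zero[OF \<phi>'_X(2)[OF y(1)]] \<phi>'_X(1)[OF y(1)] word_shiftD(2)[OF shift' y(1)] by (simp add: add.commute)
  qed
  show ?thesis
  proof (rule basis_alg_reindex)
    show "bij_betw ?h (cyc_basis V X w) (cyc_basis V' X' w')"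
      using hB gB gh hg by (intro bij_betwI[where g = ?g]) auto
    show "Triv ` V \<subseteq> cyc_basis V X w"
      by auto
    show "Triv ` V' = ?h ` Triv ` V"
      using bij_betw_imp_surj_on[OF \<psi>] by (auto simp: image_image)
    \<comment> \<open>The implication from left to right is the other one for the inverse map
      \<open>?g\<close>.\<close>
    show "cyc_mult w' (?h s) (?h t) (?h u) \<longleftrightarrow> cyc_mult w s t u"
      if "s \<in> cyc_basis V X w" "t \<in> cyc_basis V X w" "u \<in> cyc_basis V X w" for s t u
      using cyc_map_mult[OF shift that(1,2)] cyc_map_mult[OF shift' hB[OF that(1)] hB[OF that(2)], of "?h u"]
        gh that by auto
  qed
qed

section \<open>Hypergraphs and trivial extensions\<close>

text \<open>An \<open>Arc\<close> of length \<open>length l - 1\<close> must be shorter than its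
  cycle, which means \<open>length l \<le> length (w x)\<close>; this explains the range of the
  sum.\<close>

lemma (in cyclic_words) card_runs_eq:
  assumes "2 \<le> length l"
  shows "card (runs l) = (\<Sum>x | x \<in> X \<and> length l \<le> length (w x). cyc_occ (w x) l)"
proof -
  let ?S = "{x. x \<in> X \<and> length l \<le> length (w x)}"
  let ?I = "\<lambda>x. {i. i < length (w x) \<and> take (length l) (rotate i (w x)) = l}"
  have "(\<forall>m < length l. w x ! ((i + m) mod length (w x)) = l ! m) \<longleftrightarrow> take (length l) (rotate i (w x)) = l"
    if "length l \<le> length (w x)" for x i
    using that by (auto simp: list_eq_iff_nth_eq nth_rotate)
  then have "runs l = (\<lambda>(x, i). Arc x i (length l - 1)) ` Sigma ?S ?I"
    using assms unfolding runs_def by (fastforce simp: image_iff)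
  moreover have "inj_on (\<lambda>(x, i). Arc x i (length l - 1) :: ('x, 'v) cyc) (Sigma ?S ?I)"
    by (auto simp: inj_on_def)
  moreover have "card (Sigma ?S ?I) = (\<Sum>x\<in>?S. card (?I x))"
    using finite_X by (intro card_SigmaI) auto
  ultimately show ?thesis
    by (simp only: card_image cyc_occ_def)
qed

lemma cyc_occ_map:
  assumes "inj_on \<psi> V" "set u \<subseteq> V" "set l \<subseteq> V"
  shows "cyc_occ (map \<psi> u) (map \<psi> l) = cyc_occ u l"
proof -
  have "take (length l) (rotate i (map \<psi> u)) = map \<psi> l \<longleftrightarrow> take (length l) (rotate i u) = l" for i
  proof -
    have "set (take (length l) (rotate i u)) \<union> set l \<subseteq> V"
      using assms(2,3) set_take_subset[of "length l" "rotate i u"] by auto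
    then show ?thesis
      unfolding rotate_map take_map using inj_on_map_eq_map[OF inj_on_subset[OF assms(1)]] by blast
  qed
  then show ?thesis
    by (simp add: cyc_occ_def)
qed

lemma cyc_occ_outside:
  assumes "\<not> set l \<subseteq> set u"
  shows "cyc_occ u l = 0"
proof -
  have "take (length l) (rotate i u) \<noteq> l" for i
    using assms set_take_subset[of "length l" "rotate i u"] by auto
  then show ?thesis
    by (simp add: cyc_occ_def)
qed

lemma (in cyc_iso_verts) word_bijection:
  obtains \<phi> where "bij_betw \<phi> {x \<in> X. 2 \<le> length (w x)} {x \<in> X'. 2 \<le> length (w' x)}"
    "\<And>x. x \<in> X \<Longrightarrow> 2 \<le> length (w x) \<Longrightarrow> rotations (w' (\<phi> x)) = rotations (map \<psi> (w x))"
proof -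
  have inj: "inj_on \<psi> V"
    using \<psi>_inverse(1) by (rule inj_on_inverseI)
  have occ: "(\<Sum>x | x \<in> X \<and> length l \<le> length (map \<psi> (w x)). cyc_occ (map \<psi> (w x)) l) =
      (\<Sum>x | x \<in> X' \<and> length l \<le> length (w' x). cyc_occ (w' x) l)" if l: "2 \<le> length l" for l
  proof (cases "set l \<subseteq> V'")
    case True
    define k where "k = map \<psi>' l"
    have k: "l = map \<psi> k" "set k \<subseteq> V" "length k = length l"
      using True \<psi> \<psi>_inverse by (auto simp: k_def map_idI[symmetric] intro!: map_idI[symmetric])
    have "(\<Sum>x | x \<in> X \<and> length l \<le> length (map \<psi> (w x)). cyc_occ (map \<psi> (w x)) l) =
        (\<Sum>x | x \<in> X \<and> length k \<le> length (w x). cyc_occ (w x) k)"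
      using k A.word_subset by (intro sum.cong) (auto intro!: cyc_occ_map[OF inj])
    also have "\<dots> = card (A.runs k)"
      using A.card_runs_eq[of k] l k(3) by simp
    also have "\<dots> = card (B.runs l)"
      unfolding k(1) using l k(2,3) by (intro card_runs) simp_all
    finally show ?thesis
      using B.card_runs_eq[OF l] by simp
  next
    case False
    \<comment> \<open>A pattern with a letter outside \<open>V'\<close> occurs in no word on either
      side.\<close>
    have "cyc_occ (map \<psi> (w x)) l = 0" if "x \<in> X" for x
    proof (rule cyc_occ_outside)
      have "set (map \<psi> (w x)) \<subseteq> V'"
        using A.word_subset[OF that] \<psi>(1) by auto
      then show "\<not> set l \<subseteq> set (map \<psi> (w x))"
        using False by blast
    qed
    moreover have "cyc_occ (w' x) l = 0" if "x \<in> X'" for x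
      using False B.word_subset[OF that] by (intro cyc_occ_outside) auto
    ultimately show ?thesis
      by simp
  qed
  obtain \<phi> where "bij_betw \<phi> {x \<in> X. 2 \<le> length (map \<psi> (w x))} {x \<in> X'. 2 \<le> length (w' x)}"
    "\<And>x. x \<in> X \<Longrightarrow> 2 \<le> length (map \<psi> (w x)) \<Longrightarrow> rotations (w' (\<phi> x)) = rotations (map \<psi> (w x))"
    using cyclic_words_determined[OF A.finite_X B.finite_X occ] by blast
  then show ?thesis
    by (intro that[of \<phi>]) simp_all
qed

lemma words_of_cyc_alg_iso:
  fixes w :: "'x \<Rightarrow> 'v list" and w' :: "'y \<Rightarrow> 'u list"
  assumes "cyclic_words V X w" "cyclic_words V' X' w'"
    and iso: "(cyc_alg V X w :: ('k::field, ('x, 'v) cyc \<Rightarrow> 'k) module) \<simeq>\<^sub>K cyc_alg V' X' w'"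
  obtains \<psi> \<phi> where "bij_betw \<psi> V V'"
    "bij_betw \<phi> {x \<in> X. 2 \<le> length (w x)} {x \<in> X'. 2 \<le> length (w' x)}"
    "\<And>x. x \<in> X \<Longrightarrow> 2 \<le> length (w x) \<Longrightarrow> rotations (w' (\<phi> x)) = rotations (map \<psi> (w x))"
proof -
  obtain h :: "(('x, 'v) cyc \<Rightarrow> 'k) \<Rightarrow> (('y, 'u) cyc \<Rightarrow> 'k)" and g where
    hg: "alg_hom (cyc_alg V X w) (cyc_alg V' X' w') h" "alg_hom (cyc_alg V' X' w') (cyc_alg V X w) g"
    "\<And>x. x \<in> carrier (cyc_alg V X w) \<Longrightarrow> g (h x) = x" "\<And>y. y \<in> carrier (cyc_alg V' X' w') \<Longrightarrow> h (g y) = y"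
  proof -
    have "Triv ` V \<subseteq> cyc_basis V X w"
      by auto
    then show thesis
      using basis_alg_iso_inverse[OF iso] that by blast
  qed
  interpret cyc_iso V X w V' X' w' h g
    using assms(1,2) hg by (simp add: cyc_iso_def cyc_iso_axioms_def del: basis_alg_simps)
  obtain \<psi> where bij: "bij_betw \<psi> V V'"
    and Triv: "\<And>v f. v \<in> V \<Longrightarrow> f \<in> carrier CA \<Longrightarrow> h f (Triv (\<psi> v)) = f (Triv v)"
    using vertex_bijection by blast
  define \<psi>' where "\<psi>' = inv_into V \<psi>"
  interpret cyc_iso_verts V X w V' X' w' h g \<psi> \<psi>'
  proof
    show "\<psi> v \<in> V'" if "v \<in> V" for v
      using bij_betwE[OF bij] that by blast
    show "\<psi>' v' \<in> V" if "v' \<in> V'" for v'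
      using bij_betwE[OF bij_betw_inv_into[OF bij]] that by (simp add: \<psi>'_def)
    show "\<psi>' (\<psi> v) = v" if "v \<in> V" for v
      using bij_betw_inv_into_left[OF bij that] by (simp add: \<psi>'_def)
    show "\<psi> (\<psi>' v') = v'" if "v' \<in> V'" for v'
      using bij_betw_inv_into_right[OF bij that] by (simp add: \<psi>'_def)
  qed (rule Triv)
  obtain \<phi> where "bij_betw \<phi> {x \<in> X. 2 \<le> length (w x)} {x \<in> X'. 2 \<le> length (w' x)}"
    "\<And>x. x \<in> X \<Longrightarrow> 2 \<le> length (w x) \<Longrightarrow> rotations (w' (\<phi> x)) = rotations (map \<psi> (w x))"
    using word_bijection by blast
  with bij show ?thesis
    using that by blast
qed

section \<open>From almost gentle algebras to families of cyclic words\<close>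

lemma almost_gentle_quiver_ex:
  assumes "almost_gentle Q I"
  shows "\<exists>R. almost_gentle_quiver Q I R"
proof -
  obtain R where R: "R \<subseteq> {p \<in> paths Q. length (snd p) = 2}" "I = Idl\<^bsub>path_alg Q\<^esub> (path_elem ` R)"
    using assms unfolding almost_gentle_def by blast
  have Q: "fin_digraph Q"
    using assms by (simp add: almost_gentle_def)
  interpret quadratic_monomial Q I R
  proof (intro quadratic_monomial.intro quadratic_monomial_axioms.intro Q R)
    have "admissible Q I"
      using assms by (simp add: almost_gentle_def)
    then show "ideal I (path_alg Q)" "\<exists>m. ideal_pow (path_alg Q) (arrow_ideal Q) m \<subseteq> I"
      unfolding admissible_def by blast+
  qed
  have uniq: "(\<exists>\<^sub>\<le>\<^sub>1b. b \<in> arcs Q \<and> arrow_elem Q a \<otimes>\<^bsub>path_alg Q\<^esub> arrow_elem Q b \<notin> I) \<and>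
      (\<exists>\<^sub>\<le>\<^sub>1c. c \<in> arcs Q \<and> arrow_elem Q c \<otimes>\<^bsub>path_alg Q\<^esub> arrow_elem Q a \<notin> I)" if "a \<in> arcs Q" for a
    using assms that unfolding almost_gentle_def by blast
  have "almost_gentle_quiver Q I R"
  proof
    show "b = b'" if "step a b" "step a b'" for a b b'
    proof -
      have "a \<in> arcs Q" "b \<in> arcs Q" "b' \<in> arcs Q"
        using that by (auto simp: step_def)
      then show ?thesis
        using uniq[of a] that arrow_mult_in_I_iff unfolding Uniq_def by blast
    qed
    show "a = a'" if "step a b" "step a' b" for a a' b
    proof -
      have "a \<in> arcs Q" "b \<in> arcs Q" "a' \<in> arcs Q"
        using that by (auto simp: step_def)
      then show ?thesis
        using uniq[of b] that arrow_mult_in_I_iff unfolding Uniq_def by blast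
    qed
  qed
  then show ?thesis
    by blast
qed

context almost_gentle_quiver
begin

lemma ext_paths_nz: "ext_paths \<subseteq> nz_paths"
  by (auto simp: extended_maximal_paths_def maximal_path_iff trivial_verts_def dest: long_pathD)

lemma path_verts_subset: "p \<in> nz_paths \<Longrightarrow> set (path_verts Q p) \<subseteq> verts Q"
  unfolding nz_paths_def paths_def path_verts_def by (auto elim!: awalkE)

lemma cyclic_words: "cyclic_words (verts Q) ext_paths (path_verts Q)"
proof
  show "finite (verts Q)"
    by (rule finite_verts)
  show "finite ext_paths"
    using ext_paths_nz finite_nz_paths by (rule finite_subset)
  show "set (path_verts Q x) \<subseteq> verts Q" if "x \<in> ext_paths" for x
    using that ext_paths_nz by (intro path_verts_subset) blast
qed

lemma long_words: "{x \<in> ext_paths. 2 \<le> length (path_verts Q x)} = long_paths"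
proof -
  have "2 \<le> length (path_verts Q x) \<longleftrightarrow> snd x \<noteq> []" for x
    by (cases "snd x") (simp_all add: length_path_verts)
  then show ?thesis
    using extended_maximal_paths_long by blast
qed

text \<open>In this form the condition refers to the words of length at least 2 only, so it can be
  carried along a bijection of those words.\<close>

lemma trivial_path_iff_count:
  "(v, []) \<in> ext_paths \<longleftrightarrow> v \<in> verts Q \<and> (\<Sum>x\<in>long_paths. count_list (path_verts Q x) v) \<le> 1"
proof -
  have fin: "finite long_paths"
    using finite_nz_paths by (rule finite_subset[rotated]) (auto simp: long_paths_def)
  have occ: "occurrences v = (SIGMA x:long_paths. {i. i < length (path_verts Q x) \<and> path_verts Q x ! i = v})"
    by (auto simp: occurrences_def)
  have "card (occurrences v) = (\<Sum>x\<in>long_paths. card {i. i < length (path_verts Q x) \<and> path_verts Q x ! i = v})"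
    unfolding occ using fin by (intro card_SigmaI) auto
  also have "\<dots> = (\<Sum>x\<in>long_paths. count_list (path_verts Q x) v)"
    by (intro sum.cong refl) (simp add: count_list_eq_length_filter length_filter_conv_card eq_commute)
  finally have "card (occurrences v) = (\<Sum>x\<in>long_paths. count_list (path_verts Q x) v)" .
  moreover have "finite (occurrences v)"
    unfolding occ using fin by auto
  ultimately show ?thesis
    unfolding trivial_path_iff using card_le_Suc0_iff_eq[of "occurrences v"] by simp
qed

end

lemma count_list_map:
  assumes "inj_on \<psi> V" "set xs \<subseteq> V" "v \<in> V"
  shows "count_list (map \<psi> xs) (\<psi> v) = count_list xs v"
  using assms(2) by (induction xs) (auto simp: inj_on_eq_iff[OF assms(1)] assms(3))

theorem theorem7p4:
  fixes Q\<^sub>A :: "('v, 'e) pre_digraph" and I\<^sub>A :: "(('v, 'e) path \<Rightarrow> 'k::field) set"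
    and Q\<^sub>B :: "('w, 'f) pre_digraph" and I\<^sub>B :: "(('w, 'f) path \<Rightarrow> 'k) set"
  assumes "almost_gentle Q\<^sub>A I\<^sub>A" and "almost_gentle Q\<^sub>B I\<^sub>B"
  shows "hypergraph_iso (hypergraph_of Q\<^sub>A I\<^sub>A) (hypergraph_of Q\<^sub>B I\<^sub>B) \<longleftrightarrow>
    trivial_ext (bound_quiver_alg Q\<^sub>A I\<^sub>A) \<simeq>\<^sub>K trivial_ext (bound_quiver_alg Q\<^sub>B I\<^sub>B)"
proof -
  obtain R\<^sub>A R\<^sub>B where "almost_gentle_quiver Q\<^sub>A I\<^sub>A R\<^sub>A" "almost_gentle_quiver Q\<^sub>B I\<^sub>B R\<^sub>B"
    using assms[THEN almost_gentle_quiver_ex] by blast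
  then interpret A: almost_gentle_quiver Q\<^sub>A I\<^sub>A R\<^sub>A + B: almost_gentle_quiver Q\<^sub>B I\<^sub>B R\<^sub>B .
  let ?A = "cyc_alg (verts Q\<^sub>A) A.ext_paths (path_verts Q\<^sub>A) :: ('k, (('v, 'e) path, 'v) cyc \<Rightarrow> 'k) module"
  let ?B = "cyc_alg (verts Q\<^sub>B) B.ext_paths (path_verts Q\<^sub>B) :: ('k, (('w, 'f) path, 'w) cyc \<Rightarrow> 'k) module"
  have A_iso: "trivial_ext (bound_quiver_alg Q\<^sub>A I\<^sub>A) \<simeq>\<^sub>K ?A"
    using A.trivial_ext_cyc_alg by (rule basis_alg_iso_sym) auto
  have B_iso: "trivial_ext (bound_quiver_alg Q\<^sub>B I\<^sub>B) \<simeq>\<^sub>K ?B"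
    using B.trivial_ext_cyc_alg by (rule basis_alg_iso_sym) auto
  show ?thesis
  proof
    assume "hypergraph_iso (hypergraph_of Q\<^sub>A I\<^sub>A) (hypergraph_of Q\<^sub>B I\<^sub>B)"
    then obtain \<phi> \<psi> where \<phi>: "bij_betw \<phi> A.ext_paths B.ext_paths" and \<psi>: "bij_betw \<psi> (verts Q\<^sub>A) (verts Q\<^sub>B)"
      and orient: "\<And>x. x \<in> A.ext_paths \<Longrightarrow>
        rotations (path_verts Q\<^sub>B (\<phi> x)) = map \<psi> ` rotations (path_verts Q\<^sub>A x)"
      unfolding hypergraph_iso_def hypergraph_of_def by auto
    have "?A \<simeq>\<^sub>K ?B"
    proof (rule cyc_alg_iso[OF \<psi> \<phi>])
      fix x assume x: "x \<in> A.ext_paths"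
      then show "set (path_verts Q\<^sub>A x) \<subseteq> verts Q\<^sub>A"
        using A.path_verts_subset A.ext_paths_nz by blast
      show "rotations (map \<psi> (path_verts Q\<^sub>A x)) = rotations (path_verts Q\<^sub>B (\<phi> x))"
        using orient[OF x] by (simp add: map_rotations)
    qed
    then show "trivial_ext (bound_quiver_alg Q\<^sub>A I\<^sub>A) \<simeq>\<^sub>K trivial_ext (bound_quiver_alg Q\<^sub>B I\<^sub>B)"
      using A_iso B.trivial_ext_cyc_alg by (blast intro: alg_iso_trans)
  next
    assume "trivial_ext (bound_quiver_alg Q\<^sub>A I\<^sub>A) \<simeq>\<^sub>K trivial_ext (bound_quiver_alg Q\<^sub>B I\<^sub>B)"
    then have "?A \<simeq>\<^sub>K ?B"
      using A.trivial_ext_cyc_alg B_iso by (blast intro: alg_iso_trans)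
    then obtain \<psi> \<phi> where \<psi>: "bij_betw \<psi> (verts Q\<^sub>A) (verts Q\<^sub>B)"
      and \<phi>: "bij_betw \<phi> {x \<in> A.ext_paths. 2 \<le> length (path_verts Q\<^sub>A x)}
        {x \<in> B.ext_paths. 2 \<le> length (path_verts Q\<^sub>B x)}"
      and rot: "\<And>x. x \<in> A.ext_paths \<Longrightarrow> 2 \<le> length (path_verts Q\<^sub>A x) \<Longrightarrow>
        rotations (path_verts Q\<^sub>B (\<phi> x)) = rotations (map \<psi> (path_verts Q\<^sub>A x))"
      using words_of_cyc_alg_iso[OF A.cyclic_words B.cyclic_words] by blast
    have rot: "rotations (path_verts Q\<^sub>B (\<phi> x)) = rotations (map \<psi> (path_verts Q\<^sub>A x))"
      if "x \<in> A.long_paths" for x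
      using rot[of x] that A.long_words by blast
    note \<phi> = \<phi>[unfolded A.long_words B.long_words]
    have inj: "inj_on \<psi> (verts Q\<^sub>A)"
      using \<psi> by (rule bij_betw_imp_inj_on)
    have count: "count_list ys (\<psi> v) = count_list (path_verts Q\<^sub>A x) v"
      if "rotations ys = rotations (map \<psi> (path_verts Q\<^sub>A x))" "x \<in> A.nz_paths" "v \<in> verts Q\<^sub>A" for ys x v
      using rotations_count_list[OF that(1)] count_list_map[OF inj A.path_verts_subset[OF that(2)] that(3)] by simp
    \<comment> \<open>The occurrences of a vertex on long words are preserved, hence so is the
      presence of its word of length 1.\<close>
    have short: "(\<psi> v, []) \<in> B.ext_paths \<longleftrightarrow> (v, []) \<in> A.ext_paths" if "v \<in> verts Q\<^sub>A" for v
    proof -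
      have "(\<Sum>x\<in>B.long_paths. count_list (path_verts Q\<^sub>B x) (\<psi> v)) =
          (\<Sum>x\<in>A.long_paths. count_list (path_verts Q\<^sub>B (\<phi> x)) (\<psi> v))"
        by (rule sum.reindex_bij_betw[OF \<phi>, symmetric])
      also have "\<dots> = (\<Sum>x\<in>A.long_paths. count_list (path_verts Q\<^sub>A x) v)"
        using rot that by (intro sum.cong refl count) (auto dest: A.long_pathD)
      finally show ?thesis
        using that bij_betwE[OF \<psi>] by (simp add: A.trivial_path_iff_count B.trivial_path_iff_count)
    qed
    \<comment> \<open>A word of length 1 must go where its letter goes; the bijection
      \<open>\<phi>\<close> is available on long words only.\<close>
    define \<Phi> where "\<Phi> p = (if snd p = [] then (\<psi> (fst p), []) else \<phi> p)" for p
    let ?S = "{p \<in> A.ext_paths. snd p = []}" and ?S' = "{p \<in> B.ext_paths. snd p = []}"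
    have ext: "A.long_paths \<union> ?S = A.ext_paths" "B.long_paths \<union> ?S' = B.ext_paths"
      using A.extended_maximal_paths_long B.extended_maximal_paths_long by blast+
    have "bij_betw \<Phi> (A.long_paths \<union> ?S) (B.long_paths \<union> ?S')"
    proof (rule bij_betw_combine)
      show "bij_betw \<Phi> A.long_paths B.long_paths"
      proof -
        have "\<Phi> p = \<phi> p" if "p \<in> A.long_paths" for p
          using A.long_pathD(2)[OF that] by (simp add: \<Phi>_def)
        then show ?thesis
          using \<phi> bij_betw_cong[of A.long_paths \<Phi> \<phi> B.long_paths] by simp
      qed
      have v: "fst p \<in> verts Q\<^sub>A" "p = (fst p, [])" if "p \<in> ?S" for p
        using that A.ext_paths_nz A.nz_paths_Nil by (cases p; auto)+
      have v': "fst p \<in> verts Q\<^sub>B" "p = (fst p, [])" if "p \<in> ?S'" for p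
        using that B.ext_paths_nz B.nz_paths_Nil by (cases p; auto)+
      show "bij_betw \<Phi> ?S ?S'"
        unfolding bij_betw_def
      proof
        show "inj_on \<Phi> ?S"
        proof (rule inj_onI)
          fix p q assume "p \<in> ?S" "q \<in> ?S" "\<Phi> p = \<Phi> q"
          then show "p = q"
            using v(1)[of p] v(1)[of q] inj by (auto simp: \<Phi>_def prod_eq_iff dest: inj_onD)
        qed
        show "\<Phi> ` ?S = ?S'"
        proof
          show "\<Phi> ` ?S \<subseteq> ?S'"
          proof (rule image_subsetI)
            fix p assume p: "p \<in> ?S"
            obtain u where u: "p = (u, [])"
              using v(2)[OF p] by blast
            then show "\<Phi> p \<in> ?S'"
              using short[of u] v(1)[OF p] p by (simp add: \<Phi>_def)
          qed
          show "?S' \<subseteq> \<Phi> ` ?S"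
          proof
            fix p assume p: "p \<in> ?S'"
            then obtain u where u: "u \<in> verts Q\<^sub>A" "fst p = \<psi> u"
              using v'(1)[OF p] \<psi> unfolding bij_betw_def by blast
            then have "(u, []) \<in> ?S"
              using short[OF u(1)] v'(2)[OF p] p by simp
            moreover have "p = \<Phi> (u, [])"
              using u v'(2)[OF p] by (simp add: \<Phi>_def)
            ultimately show "p \<in> \<Phi> ` ?S"
              by blast
          qed
        qed
      qed
      show "B.long_paths \<inter> ?S' = {}"
        by (auto dest: B.long_pathD)
    qed
    then have bij: "bij_betw \<Phi> A.ext_paths B.ext_paths"
      unfolding ext .
    have rot_\<Phi>: "rotations (path_verts Q\<^sub>B (\<Phi> p)) = rotations (map \<psi> (path_verts Q\<^sub>A p))"
      if "p \<in> A.ext_paths" for p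
      using that rot[of p] A.extended_maximal_paths_long[of p]
      by (cases "snd p = []") (auto simp: \<Phi>_def path_verts_def)
    show "hypergraph_iso (hypergraph_of Q\<^sub>A I\<^sub>A) (hypergraph_of Q\<^sub>B I\<^sub>B)"
      unfolding hypergraph_iso_def
    proof (intro exI conjI ballI)
      show "bij_betw \<Phi> (hverts (hypergraph_of Q\<^sub>A I\<^sub>A)) (hverts (hypergraph_of Q\<^sub>B I\<^sub>B))"
        using bij by (simp add: hypergraph_of_def)
      show "bij_betw \<psi> (hedges (hypergraph_of Q\<^sub>A I\<^sub>A)) (hedges (hypergraph_of Q\<^sub>B I\<^sub>B))"
        using \<psi> by (simp add: hypergraph_of_def)
    next
      fix v assume "v \<in> hedges (hypergraph_of Q\<^sub>A I\<^sub>A)"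
      then have v: "v \<in> verts Q\<^sub>A"
        by (simp add: hypergraph_of_def)
      \<comment> \<open>Multiplicities in a hyperedge are letter counts of the cyclic words, and
        these are invariant under rotation; so the matching of hyperedges follows from
        \<open>rot_\<Phi>\<close>.\<close>
      have "(\<Sum>p\<in>B.ext_paths. replicate_mset (count_list (path_verts Q\<^sub>B p) (\<psi> v)) p) =
          (\<Sum>p\<in>A.ext_paths. replicate_mset (count_list (path_verts Q\<^sub>B (\<Phi> p)) (\<psi> v)) (\<Phi> p))"
        by (rule sum.reindex_bij_betw[OF bij, symmetric])
      also have "\<dots> = (\<Sum>p\<in>A.ext_paths. replicate_mset (count_list (path_verts Q\<^sub>A p) v) (\<Phi> p))"
        using count[OF rot_\<Phi> _ v] A.ext_paths_nz by (intro sum.cong) auto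
      also have "\<dots> = image_mset \<Phi> (\<Sum>p\<in>A.ext_paths. replicate_mset (count_list (path_verts Q\<^sub>A p) v) p)"
        by (simp flip: sum_comp_morphism[of "image_mset \<Phi>"] add: o_def)
      finally show "members (hypergraph_of Q\<^sub>B I\<^sub>B) (\<psi> v) = image_mset \<Phi> (members (hypergraph_of Q\<^sub>A I\<^sub>A) v)"
        by (simp add: hypergraph_of_def)
    next
      fix p assume "p \<in> hverts (hypergraph_of Q\<^sub>A I\<^sub>A)"
      then have "p \<in> A.ext_paths"
        by (simp add: hypergraph_of_def)
      then show "orient (hypergraph_of Q\<^sub>B I\<^sub>B) (\<Phi> p) = map \<psi> ` orient (hypergraph_of Q\<^sub>A I\<^sub>A) p"
        using rot_\<Phi> by (simp add: hypergraph_of_def map_rotations)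
    qed
  qed
qed

end
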